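(* For $G\in\mathcal{A}$ let $\mathcal{F}_H^0(G)=\{f=h+\bar g\in\mathcal{H}:\big|\frac{h'(z)}{G'(z)}-1\big|<1-\big|\frac{g'(z)}{G'(z)}\big|\text{ for all }z\in\mathbb{D}\}$. Let $r_C$ denote the radius of convexity of the union of the classes $\mathcal{F}_H^0(G)$ over $G$ in the indicated family. Then: (a) if $G\in\mathcal{S}$, $r_C=1/5$; (b) if $G\in\mathcal{S}^*$, $r_C=1/5$; (c) if $G\in\mathcal{K}$, $r_C=1/3$; (d) if $G\in\mathcal{R}$, $r_C=(\sqrt{17}-3)/4$; (e) if $G\in\mathcal{A}$ with $\operatorname{Re}G'(z)>1/2$ in $\mathbb{D}$, $r_C$ is the smallest positive root of $r^4+2r^3+13r^2+4r-4=0$. All these results are sharp.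
   Context: $\mathbb{D}$ is the open unit disk. $\mathcal{H}$ is the class of harmonic $f=h+\bar g$ in $\mathbb{D}$ ($h,g$ analytic) with $f(0)=0$, $f_z(0)=1$, $f_{\bar z}(0)=0$. $\mathcal{A}$ is the class of analytic $f$ in $\mathbb{D}$ with $f(0)=0$, $f'(0)=1$; $\mathcal{S}$ the univalent ones; $\mathcal{S}^*$, $\mathcal{K}$ those in $\mathcal{S}$ mapping $\mathbb{D}$ onto a domain starlike with respect to $0$, resp. convex; $\mathcal{R}=\{f\in\mathcal{A}:\operatorname{Re}f'>0\text{ in }\mathbb{D}\}$. The radius of convexity is the largest $r\le1$ such that every $f$ in the class maps $|z|<r$ univalently onto a convex domain; "sharp" means no larger radius works. *)

theory Defs
  imports "HOL-Analysis.Analysis"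
begin

abbreviation unit_disk :: "complex set" where
  "unit_disk \<equiv> ball 0 1"

definition class_A :: "(complex \<Rightarrow> complex) set" where
  "class_A = {G. G holomorphic_on unit_disk \<and> G 0 = 0 \<and> deriv G 0 = 1}"

definition class_S :: "(complex \<Rightarrow> complex) set" where
  "class_S = {G \<in> class_A. inj_on G unit_disk}"

definition class_S_star :: "(complex \<Rightarrow> complex) set" where
  "class_S_star = {G \<in> class_S. \<forall>w \<in> G ` unit_disk. closed_segment 0 w \<subseteq> G ` unit_disk}"

definition class_K :: "(complex \<Rightarrow> complex) set" where
  "class_K = {G \<in> class_S. convex (G ` unit_disk)}"

definition class_R :: "(complex \<Rightarrow> complex) set" where
  "class_R = {G \<in> class_A. \<forall>z \<in> unit_disk. Re (deriv G z) > 0}"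

text \<open>Harmonic f = h + conj g in the disk, normalized: f(0)=0, f_z(0)=h'(0)=1,
  f_{zbar}(0) = conj(g'(0)) = 0.\<close>
definition harmonic_decomp :: "(complex \<Rightarrow> complex) \<Rightarrow> (complex \<Rightarrow> complex) \<Rightarrow> (complex \<Rightarrow> complex) \<Rightarrow> bool" where
  "harmonic_decomp f h g \<longleftrightarrow> h holomorphic_on unit_disk \<and> g holomorphic_on unit_disk \<and>
     (\<forall>z \<in> unit_disk. f z = h z + cnj (g z))"

definition class_H :: "(complex \<Rightarrow> complex) set" where
  "class_H = {f. \<exists>h g. harmonic_decomp f h g \<and> f 0 = 0 \<and> deriv h 0 = 1 \<and> deriv g 0 = 0}"

definition F_H0 :: "(complex \<Rightarrow> complex) \<Rightarrow> (complex \<Rightarrow> complex) set" where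
  "F_H0 G = {f. \<exists>h g. harmonic_decomp f h g \<and> f 0 = 0 \<and> deriv h 0 = 1 \<and> deriv g 0 = 0 \<and>
     (\<forall>z \<in> unit_disk. cmod (deriv h z / deriv G z - 1) < 1 - cmod (deriv g z / deriv G z))}"

definition radius_convexity :: "(complex \<Rightarrow> complex) set \<Rightarrow> real" where
  "radius_convexity C = Sup {r. 0 < r \<and> r \<le> 1 \<and>
     (\<forall>\<rho>. 0 < \<rho> \<and> \<rho> \<le> r \<longrightarrow>
        (\<forall>f \<in> C. inj_on f (ball 0 \<rho>) \<and> convex (f ` ball 0 \<rho>)))}"

end

theory Submission
  imports Defs "HOL-Complex_Analysis.Complex_Analysis"
begin

text \<open>
  Write $\kappa_G(z) = \mathrm{Re}\,(1 + zG''(z)/G'(z))$. If $f = h + \overline{g}$ is in the class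
  of $G$ and $|\epsilon| = 1$, then $h' + \epsilon g' = G'(1 + w)$ with a Schwarz function $w$, and
  $\mathrm{Re}\,(zw'/(1 + w)) \ge -|z|/(1 - |z|)$ by Schwarz-Pick. In direction $n$ the support
  function of $f$ agrees with that of the analytic function $h + n^2 g$, so $f$ is convex on every
  disk where $\kappa_G(z) > |z|/(1 - |z|)$. Conversely, $w(\zeta) = -|z|\zeta/z$ and $g = 0$ give
  an analytic member of the class that violates Study's criterion as soon as
  $\kappa_G(z) < |z|/(1 - |z|)$. Hence the radius is governed by the sharp lower bound for $\kappa_G$
  in each family; for univalent $G$ this is Bieberbach's $|a_2| \le 2$ applied to Koebe transforms.
\<close>

section \<open>Support lines and convexity of harmonic images\<close>

text \<open>The threshold |z|/(1 - |z|) does not depend on \<open>G\<close>, and both directions are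
  pointwise in \<open>z\<close>; so the radius is the point where the minimum of \<kappa>_G over the
  family, as a function of r = |z|, meets r/(1 - r) = r(1 + r)/(1 - r^2). The sharp minima are (1 -
  4r + r^2)/(1 - r^2) for univalent and for starlike \<open>G\<close>, (1 - r)/(1 + r) for convex
  \<open>G\<close>, 1 - 2r/(1 - r^2) for Re G' > 0, and 2 sqrt(2/(1 - r^2)) - 2/(1 - r^2) for Re G'
  > 1/2 once r > 1/3. Clearing denominators leaves 1 - 5r, 1 - 3r, 1 - 3r - 2r^2 and, after one
  squaring, the quartic. The longest part is the area theorem behind |a_2| \<le> 2. It rests on a
  change of variables over an annulus: the image has at most the area of an enclosing disk, and the
  error of this enclosure must vanish as the inner radius shrinks.\<close>

text \<open>
  On the circle through $z_0$ the argument of $zF'(z)$ increases by exactly $2\pi$, so the derivative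
  of $\mathrm{Re}\,F$ along the circle changes sign only at $z_0$ and at one further point.
\<close>

lemma Re_less_at_outward_normal:
  fixes F :: "complex \<Rightarrow> complex"
  assumes hol: "F holomorphic_on ball 0 R"
    and nz: "\<And>z. cmod z < R \<Longrightarrow> deriv F z \<noteq> 0"
    and pos: "\<And>z. cmod z < R \<Longrightarrow> Re (1 + z * deriv (deriv F) z / deriv F z) > 0"
    and z0: "z0 \<noteq> 0" "cmod z0 < R"
    and c: "z0 * deriv F z0 = of_real c" "c > 0"
    and z: "cmod z \<le> cmod z0" "z \<noteq> z0"
  shows "Re (F z) < Re (F z0)"
proof -
  define \<rho> where "\<rho> = cmod z0"
  have \<rho>: "0 < \<rho>" "\<rho> < R" using z0 by (auto simp: \<rho>_def)
  have holF': "deriv F holomorphic_on ball 0 R"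
    using hol by (intro holomorphic_deriv) auto
  obtain L where L: "L holomorphic_on ball 0 R" "\<And>z. z \<in> ball 0 R \<Longrightarrow> deriv F z = exp (L z)"
  proof (rule contractible_imp_holomorphic_log[OF holF'])
    show "contractible (ball (0::complex) R)"
      by (simp add: convex_imp_contractible)
  qed (use nz in auto)
  have L': "deriv L w = deriv (deriv F) w / deriv F w" if "cmod w < R" for w
  proof -
    have "(L has_field_derivative deriv L w) (at w)"
      using L(1) that by (auto intro: holomorphic_derivI)
    then have "((\<lambda>z. exp (L z)) has_field_derivative exp (L w) * deriv L w) (at w)"
      by (auto intro!: derivative_eq_intros)
    then have "(deriv F has_field_derivative exp (L w) * deriv L w) (at w)"
      by (rule has_field_derivative_transform_within_open[where S="ball 0 R"]) (use that L(2) in auto)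
    then show ?thesis
      using L(2)[of w] that by (auto dest: DERIV_imp_deriv)
  qed
  define e where "e t = of_real \<rho> * exp (\<i> * of_real t)" for t :: real
  have ne: "cmod (e t) = \<rho>" for t
    using \<rho> by (simp add: e_def norm_mult)
  have e_der: "(e has_vector_derivative \<i> * e t) (at t)" for t
    unfolding e_def by (auto intro!: derivative_eq_intros has_vector_derivative_real_field)
  \<comment> \<open>A continuous branch of the argument of \<open>z * deriv F z\<close> along the
    circle; its derivative is the real part assumed positive in \<open>pos\<close>.\<close>
  define \<phi> where "\<phi> t = t + Im (L (e t))" for t
  have \<phi>': "(\<phi> has_real_derivative 1 + Im (\<i> * e t * deriv L (e t))) (at t)" for t
  proof -
    have "(L has_field_derivative deriv L (e t)) (at (e t))"
      using L(1) ne[of t] \<rho> by (auto intro: holomorphic_derivI)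
    from field_vector_diff_chain_at[OF e_der this]
    have "((L \<circ> e) has_vector_derivative \<i> * e t * deriv L (e t)) (at t)" .
    then have "((\<lambda>t. Im ((L \<circ> e) t)) has_vector_derivative Im (\<i> * e t * deriv L (e t))) (at t)"
      by (rule bounded_linear.has_vector_derivative[OF bounded_linear_Im])
    then show ?thesis
      unfolding \<phi>_def has_real_derivative_iff_has_vector_derivative[symmetric] o_def
      by (intro DERIV_add DERIV_ident)
  qed
  have \<phi>'_pos: "1 + Im (\<i> * e t * deriv L (e t)) > 0" for t
  proof -
    have "\<i> * e t * deriv L (e t) = \<i> * (e t * deriv (deriv F) (e t) / deriv F (e t))"
      using ne[of t] \<rho> L'[of "e t"] by simp
    then have "Im (\<i> * e t * deriv L (e t)) = Re (e t * deriv (deriv F) (e t) / deriv F (e t))"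
      by (simp only: Im_i_times)
    then show ?thesis using pos[of "e t"] ne[of t] \<rho> by simp
  qed
  have \<phi>_mono: "\<phi> s < \<phi> t" if "s < t" for s t
    using DERIV_pos_imp_increasing[OF that, of \<phi>] \<phi>' \<phi>'_pos by blast
  define u where "u t = Re (F (e t))" for t
  have u': "(u has_real_derivative - (\<rho> * exp (Re (L (e t))) * sin (\<phi> t))) (at t)" for t
  proof -
    have "(F has_field_derivative deriv F (e t)) (at (e t))"
      using hol ne[of t] \<rho> by (auto intro: holomorphic_derivI)
    from field_vector_diff_chain_at[OF e_der this]
    have "((F \<circ> e) has_vector_derivative \<i> * e t * deriv F (e t)) (at t)" .
    then have "((\<lambda>t. Re ((F \<circ> e) t)) has_vector_derivative Re (\<i> * e t * deriv F (e t))) (at t)"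
      by (rule bounded_linear.has_vector_derivative[OF bounded_linear_Re])
    moreover have "Re (\<i> * e t * deriv F (e t)) = - (\<rho> * exp (Re (L (e t))) * sin (\<phi> t))"
    proof -
      have "\<i> * e t * deriv F (e t) = \<i> * (of_real \<rho> * exp (\<i> * of_real t + L (e t)))"
        using ne[of t] \<rho> L(2)[of "e t"] by (simp add: e_def exp_add)
      also have "Re \<dots> = - (\<rho> * exp (Re (L (e t))) * sin (\<phi> t))"
        by (simp add: Im_exp Re_exp \<phi>_def)
      finally show ?thesis .
    qed
    ultimately show ?thesis
      unfolding u_def has_real_derivative_iff_has_vector_derivative[symmetric] o_def by metis
  qed
  obtain \<alpha> where \<alpha>: "z0 = e \<alpha>"
    using Arg_eq[OF z0(1)] unfolding e_def \<rho>_def by blast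
  have e_per: "e (t + 2 * pi) = e t" for t
    by (simp add: e_def distrib_left exp_add exp_two_pi_i' mult.commute[of 2])
  have \<phi>_per: "\<phi> (\<alpha> + 2 * pi) = \<phi> \<alpha> + 2 * pi"
    by (simp add: \<phi>_def e_per)
  \<comment> \<open>Positivity of \<open>c\<close> says that \<open>\<phi> \<alpha>\<close> is a
    multiple of 2 pi, so the sign of \<open>sin (\<phi> t)\<close> depends only on the growth of the
    argument since \<open>\<alpha>\<close>.\<close>
  have "of_real c = of_real \<rho> * exp (\<i> * of_real \<alpha> + L (e \<alpha>))"
    using c L(2)[of "e \<alpha>"] ne[of \<alpha>] \<rho> \<alpha> by (simp add: e_def exp_add mult.assoc)
  then have "Im (of_real \<rho> * exp (\<i> * of_real \<alpha> + L (e \<alpha>))) = 0"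
      "Re (of_real \<rho> * exp (\<i> * of_real \<alpha> + L (e \<alpha>))) > 0"
    using c(2) by (metis Im_complex_of_real, metis Re_complex_of_real)
  then have sc: "sin (\<phi> \<alpha>) = 0" "cos (\<phi> \<alpha>) > 0"
    using \<rho> by (auto simp: Im_exp Re_exp \<phi>_def zero_less_mult_iff)
  then have sc': "cos (\<phi> \<alpha>) = 1"
    using sin_cos_squared_add[of "\<phi> \<alpha>"] by (simp add: power2_eq_1_iff)
  have sin\<phi>: "sin (\<phi> t) = sin (\<phi> t - \<phi> \<alpha>)" for t
    using sc sc' by (simp add: sin_diff)
  \<comment> \<open>The second turning point: there the argument has grown by half of its total
    increase, so \<open>u\<close> falls before \<open>m\<close> and rises after it.\<close>
  have "\<exists>t\<ge>\<alpha>. t \<le> \<alpha> + 2*pi \<and> \<phi> t = \<phi> \<alpha> + pi"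
  proof (rule IVT)
    show "\<forall>x. \<alpha> \<le> x \<and> x \<le> \<alpha> + 2 * pi \<longrightarrow> isCont \<phi> x"
      using \<phi>' DERIV_isCont by blast
  qed (use \<phi>_per in auto)
  then obtain m where m: "\<alpha> \<le> m" "m \<le> \<alpha> + 2*pi" "\<phi> m = \<phi> \<alpha> + pi" by auto
  have dec: "u t < u \<alpha>" if "\<alpha> < t" "t \<le> m" for t
  proof (rule DERIV_neg_imp_decreasing_open[OF that(1)])
    fix x assume x: "\<alpha> < x" "x < t"
    have "sin (\<phi> x) > 0"
      unfolding sin\<phi>[of x] using \<phi>_mono[OF x(1)] \<phi>_mono[of x m] x that m
      by (intro sin_gt_zero) auto
    then have "- (\<rho> * exp (Re (L (e x))) * sin (\<phi> x)) < 0"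
      using \<rho> by simp
    then show "\<exists>y. (u has_real_derivative y) (at x) \<and> y < 0"
      using u' by blast
  next
    show "continuous_on {\<alpha>..t} u"
      using u' DERIV_isCont continuous_at_imp_continuous_on by blast
  qed
  have inc: "u t < u (\<alpha> + 2*pi)" if "m \<le> t" "t < \<alpha> + 2*pi" for t
  proof (rule DERIV_pos_imp_increasing_open[OF that(2)])
    fix x assume x: "t < x" "x < \<alpha> + 2*pi"
    have "sin (\<phi> x) < 0"
      unfolding sin\<phi>[of x] using \<phi>_mono[OF x(2)] \<phi>_mono[of m x] x that m \<phi>_per
      by (intro sin_lt_zero) auto
    then have "- (\<rho> * exp (Re (L (e x))) * sin (\<phi> x)) > 0"
      using \<rho> by (simp add: mult_pos_neg)
    then show "\<exists>y. (u has_real_derivative y) (at x) \<and> y > 0"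
      using u' by blast
  next
    show "continuous_on {t..\<alpha> + 2*pi} u"
      using u' DERIV_isCont continuous_at_imp_continuous_on by blast
  qed
  have "u (\<alpha> + 2*pi) = u \<alpha>" by (simp add: u_def e_per)
  with dec inc have u_less: "u t < u \<alpha>" if "\<alpha> < t" "t < \<alpha> + 2*pi" for t
    using that by (cases "t \<le> m") auto
  have circle: "Re (F w) < Re (F z0)" if w: "cmod w = \<rho>" "w \<noteq> z0" for w
  proof -
    define t where "t = \<alpha> + Arg2pi (w / z0)"
    have "w / z0 = exp (\<i> * of_real (Arg2pi (w / z0)))"
      using Arg2pi_eq[of "w / z0"] w z0 \<rho>_def by (simp add: norm_divide)
    then have wt: "w = e t"
      using z0 \<alpha> by (simp add: t_def e_def field_simps exp_add)
    have "Arg2pi (w / z0) \<noteq> 0"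
      using wt w \<alpha> by (auto simp: t_def)
    then have "\<alpha> < t" "t < \<alpha> + 2 * pi"
      using Arg2pi_ge_0[of "w / z0"] Arg2pi_lt_2pi[of "w / z0"] by (auto simp: t_def)
    from u_less[OF this] show ?thesis
      by (simp add: u_def wt \<alpha>)
  qed
  show ?thesis
  proof (cases "cmod z = \<rho>")
    case True
    then show ?thesis using circle z by auto
  next
    case False
    then have zlt: "cmod z < \<rho>" using z \<rho>_def by simp
    \<comment> \<open>Inside the circle the maximum principle gives only a weak inequality; openness
      of \<open>F\<close> on the disk makes it strict.\<close>
    have le: "Re (F w) \<le> Re (F z0)" if "w \<in> ball 0 \<rho>" for w
    proof (rule maximum_real_frontier[of F "cball 0 \<rho>"])
      show "F holomorphic_on interior (cball 0 \<rho>)"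
        using hol \<rho> by (auto intro: holomorphic_on_subset)
      show "continuous_on (closure (cball 0 \<rho>)) F"
        using hol \<rho> by (auto intro!: holomorphic_on_imp_continuous_on intro: holomorphic_on_subset)
      show "Re (F w) \<le> Re (F z0)" if "w \<in> frontier (cball 0 \<rho>)" for w
        using circle[of w] that \<rho> by (cases "w = z0") (auto simp: frontier_cball)
    qed (use that in auto)
    have "open (F ` ball 0 \<rho>)"
    proof (rule open_mapping_thm2[of F "ball 0 \<rho>"])
      show "F holomorphic_on ball 0 \<rho>"
        using hol \<rho> by (auto intro: holomorphic_on_subset)
      fix X :: "complex set" assume X: "open X" "X \<subseteq> ball 0 \<rho>" "X \<noteq> {}"
      show "\<not> F constant_on X"
      proof
        assume "F constant_on X"
        then obtain k where k: "\<And>x. x \<in> X \<Longrightarrow> F x = k" by (auto simp: constant_on_def)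
        obtain x where x: "x \<in> X" using X by auto
        have "((\<lambda>_. k) has_field_derivative 0) (at x)" by simp
        then have "(F has_field_derivative 0) (at x)"
          by (rule has_field_derivative_transform_within_open[where S=X]) (use X x k in auto)
        then have "deriv F x = 0" by (rule DERIV_imp_deriv)
        then show False using nz[of x] x X \<rho> by (auto simp: subset_iff)
      qed
    qed auto
    then obtain d where d: "d > 0" "ball (F z) d \<subseteq> F ` ball 0 \<rho>"
      using zlt by (metis openE imageI mem_ball_0)
    have "F z + of_real (d/2) \<in> ball (F z) d"
      using d by (simp add: dist_norm)
    then obtain w where "w \<in> ball 0 \<rho>" "F w = F z + of_real (d/2)"
      using d by (metis imageE subsetD)
    then show ?thesis using le[of w] d by simp
  qed
qed

text \<open>Each \<open>z0\<close> other than 0 is the unique maximiser, over the closed disk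
  through it, of a real linear functional of \<open>f\<close>. Strictness gives injectivity, and the
  resulting support lines give convexity. The condition \<open>pos\<close> is asked for every
  unimodular \<open>\<epsilon>\<close> because the analytic function that replaces \<open>f\<close>
  changes with the direction of the normal.\<close>

lemma harmonic_inj_convex_image:
  fixes f h g :: "complex \<Rightarrow> complex"
  assumes h: "h holomorphic_on ball 0 R" and g: "g holomorphic_on ball 0 R"
    and f: "\<And>z. cmod z < R \<Longrightarrow> f z = h z + cnj (g z)"
    and jac: "\<And>z. cmod z < R \<Longrightarrow> cmod (deriv g z) < cmod (deriv h z)"
    and pos: "\<And>\<epsilon> z. cmod \<epsilon> = 1 \<Longrightarrow> cmod z < R \<Longrightarrow>
       Re (1 + z * (deriv (deriv h) z + \<epsilon> * deriv (deriv g) z) / (deriv h z + \<epsilon> * deriv g z)) > 0"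
  shows "inj_on f (ball 0 R)" and "convex (f ` ball 0 R)"
proof -
  have support: "\<exists>n. \<forall>z. cmod z \<le> cmod z0 \<longrightarrow> z \<noteq> z0 \<longrightarrow> Re (n * f z) < Re (n * f z0)"
    if z0: "z0 \<noteq> 0" "cmod z0 < R" for z0
  proof -
    define A where "A = z0 * deriv h z0"
    define B where "B = cnj (z0 * deriv g z0)"
    have AB: "cmod B < cmod A"
      using jac[OF z0(2)] z0(1) by (simp add: A_def B_def norm_mult)
    \<comment> \<open>The tangent of the curve t \<mapsto> f(z0 exp(i t)) at t = 0 is i(A - B), so
      \<open>N\<close> is its outward normal.\<close>
    define N where "N = A - B"
    have N: "N \<noteq> 0" using AB by (auto simp: N_def)
    \<comment> \<open>With this \<open>\<epsilon>\<close> the product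
      \<open>cnj N * \<epsilon>\<close> is \<open>N\<close>, so \<open>F\<close> and
      \<open>cnj N * f\<close> have the same real part, and \<open>z0 * deriv F z0\<close> becomes
      |A|^2 - |B|^2, which is positive by \<open>jac\<close>.\<close>
    define \<epsilon> where "\<epsilon> = N / cnj N"
    have \<epsilon>: "cmod \<epsilon> = 1" using N by (simp add: \<epsilon>_def norm_divide)
    define F where "F z = cnj N * (h z + \<epsilon> * g z)" for z
    have dh: "(h has_field_derivative deriv h z) (at z)" 
         "(g has_field_derivative deriv g z) (at z)" 
         "(deriv h has_field_derivative deriv (deriv h) z) (at z)" 
         "(deriv g has_field_derivative deriv (deriv g) z) (at z)" if "cmod z < R" for z
      using h g that by (auto intro!: holomorphic_derivI[where S="ball 0 R"] holomorphic_deriv)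
    have F1: "deriv F z = cnj N * (deriv h z + \<epsilon> * deriv g z)" if "cmod z < R" for z
    proof (rule DERIV_imp_deriv)
      show "(F has_field_derivative cnj N * (deriv h z + \<epsilon> * deriv g z)) (at z)"
        unfolding F_def by (intro DERIV_cmult DERIV_add dh[OF that])
    qed
    have F2: "deriv (deriv F) z = cnj N * (deriv (deriv h) z + \<epsilon> * deriv (deriv g) z)" if "cmod z < R" for z
    proof -
      have "((\<lambda>z. cnj N * (deriv h z + \<epsilon> * deriv g z)) has_field_derivative cnj N * (deriv (deriv h) z + \<epsilon> * deriv (deriv g) z)) (at z)"
        by (intro DERIV_cmult DERIV_add dh[OF that])
      then have "(deriv F has_field_derivative cnj N * (deriv (deriv h) z + \<epsilon> * deriv (deriv g) z)) (at z)"
        by (rule has_field_derivative_transform_within_open[where S="ball 0 R"]) (use that F1 in auto)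
      then show ?thesis by (rule DERIV_imp_deriv)
    qed
    have nz: "deriv h z + \<epsilon> * deriv g z \<noteq> 0" if "cmod z < R" for z
    proof
      assume "deriv h z + \<epsilon> * deriv g z = 0"
      then have "deriv h z = - (\<epsilon> * deriv g z)" by (simp add: add_eq_0_iff2)
      then have "cmod (deriv h z) = cmod (deriv g z)" using \<epsilon> by (simp add: norm_mult)
      then show False using jac[OF that] by simp
    qed
    have ReF: "Re (F z) = Re (cnj N * f z)" if "cmod z < R" for z
    proof -
      have "F z = cnj N * h z + N * g z"
        using N by (simp add: F_def \<epsilon>_def field_simps)
      then show ?thesis using f[OF that] by (simp add: algebra_simps)
    qed
    have "z0 * deriv F z0 = cnj N * A + N * cnj B"
    proof -
      have "deriv F z0 = cnj N * deriv h z0 + N * deriv g z0"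
        unfolding F1[OF z0(2)] using N by (simp add: \<epsilon>_def field_simps)
      then show ?thesis by (simp add: A_def B_def algebra_simps)
    qed
    also have "\<dots> = A * cnj A - B * cnj B"
      by (simp add: N_def algebra_simps)
    also have "\<dots> = of_real ((cmod A)\<^sup>2 - (cmod B)\<^sup>2)"
      by (simp only: complex_norm_square[symmetric] of_real_diff)
    finally have c: "z0 * deriv F z0 = of_real ((cmod A)\<^sup>2 - (cmod B)\<^sup>2)" .
    have "Re (F z) < Re (F z0)" if z: "cmod z \<le> cmod z0" "z \<noteq> z0" for z
    proof (rule Re_less_at_outward_normal[of F R z0, OF _ _ _ z0 c _ z])
      show "F holomorphic_on ball 0 R"
        unfolding F_def by (intro holomorphic_intros h g)
      show "Re (1 + z * deriv (deriv F) z / deriv F z) > 0" if "cmod z < R" for z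
        using pos[OF \<epsilon> that] N by (simp add: F1 F2 that)
    qed (use N nz AB in \<open>auto simp: F1 power_strict_mono\<close>)
    then show ?thesis
      using ReF z0 by (metis order.strict_trans1)
  qed
  show inj: "inj_on f (ball 0 R)"
  proof (rule inj_onI, rule ccontr)
    fix x y assume xy: "x \<in> ball 0 R" "y \<in> ball 0 R" "f x = f y" "x \<noteq> y"
    show False
    \<comment> \<open>Of two points with equal image, one of largest modulus would be a strict
      maximiser and yet share its value with the other.\<close>
    proof (cases "cmod x \<le> cmod y")
      case True
      then have "y \<noteq> 0" using xy by auto
      then obtain n where "\<forall>z. cmod z \<le> cmod y \<longrightarrow> z \<noteq> y \<longrightarrow> Re (n * f z) < Re (n * f y)"
        using support[of y] xy by auto
      then show False using xy True by (metis less_irrefl)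
    next
      case False
      then have "x \<noteq> 0" by auto
      then obtain n where "\<forall>z. cmod z \<le> cmod x \<longrightarrow> z \<noteq> x \<longrightarrow> Re (n * f z) < Re (n * f x)"
        using support[of x] xy by auto
      then show False using xy False by (metis less_irrefl linear)
    qed
  qed
  have contf: "continuous_on (ball 0 R) f"
  proof -
    have "continuous_on (ball 0 R) (\<lambda>z. h z + cnj (g z))"
      by (intro continuous_intros holomorphic_on_imp_continuous_on h g)
    then show ?thesis by (rule continuous_on_eq) (use f in auto)
  qed
  \<comment> \<open>If a point \<open>w\<close> of the segment is missed, follow the ray from
    \<open>f 0\<close> to \<open>w\<close> up to its last point in the compact image. That point
    comes from the bounding circle, and its support line has \<open>f 0\<close> strictly inside and
    hence \<open>w\<close> strictly outside, although \<open>w\<close> lies between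
    \<open>f x\<close> and \<open>f y\<close>.\<close>
  have cb: "closed_segment (f x) (f y) \<subseteq> f ` cball 0 \<rho>"
    if \<rho>: "0 < \<rho>" "\<rho> < R" and xy: "x \<in> cball 0 \<rho>" "y \<in> cball 0 \<rho>" for x y \<rho>
  proof (rule subsetI, rule ccontr)
    fix w assume w: "w \<in> closed_segment (f x) (f y)" "w \<notin> f ` cball 0 \<rho>"
    have sub: "cball 0 \<rho> \<subseteq> ball (0::complex) R" "ball 0 \<rho> \<subseteq> ball (0::complex) R" using \<rho> by auto
    define K where "K = f ` cball 0 \<rho>"
    have "compact K"
      unfolding K_def by (intro compact_continuous_image continuous_on_subset[OF contf]) (use sub in auto)
    define l where "l s = f 0 + of_real s * (w - f 0)" for s :: real
    have "closed K" using \<open>compact K\<close> compact_imp_closed by blast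
    moreover have "continuous_on UNIV l" unfolding l_def by (intro continuous_intros)
    ultimately have "closed (l -` K)" by (simp add: closed_vimage)
    then have S: "compact ({0..1} \<inter> l -` K)" by (intro compact_Int_closed) auto
    have "0 \<in> {0..1} \<inter> l -` K" using \<rho> by (auto simp: l_def K_def)
    then obtain s where s: "s \<in> {0..1} \<inter> l -` K" "\<And>t. t \<in> {0..1} \<inter> l -` K \<Longrightarrow> t \<le> s"
      using compact_attains_sup[OF S] by blast
    have s1: "s < 1"
    proof -
      have "l 1 = w" by (simp add: l_def)
      then show ?thesis using s(1) w K_def by (cases "s = 1") auto
    qed
    from s obtain z0 where z0: "z0 \<in> cball 0 \<rho>" "l s = f z0" by (auto simp: K_def)
    show False
    proof (cases "cmod z0 = \<rho>")
      case True
      then obtain n where n: "\<And>z. cmod z \<le> \<rho> \<Longrightarrow> z \<noteq> z0 \<Longrightarrow> Re (n * f z) < Re (n * f z0)"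
        using support[of z0] \<rho> by (metis norm_zero less_irrefl)
      have le: "Re (n * f z) \<le> Re (n * f z0)" if "cmod z \<le> \<rho>" for z
        using n[OF that] by (cases "z = z0") auto
      obtain u where u: "0 \<le> u" "u \<le> 1" "w = (1 - u) *\<^sub>R f x + u *\<^sub>R f y"
        using w by (auto simp: closed_segment_def)
      have "Re (n * w) = (1 - u) * Re (n * f x) + u * Re (n * f y)"
        by (simp add: u(3) algebra_simps)
      also have "\<dots> \<le> (1 - u) * Re (n * f z0) + u * Re (n * f z0)"
        using xy le u by (intro add_mono mult_left_mono) auto
      finally have wle: "Re (n * w) \<le> Re (n * f z0)" by (simp add: algebra_simps)
      have "Re (n * f z0) = (1 - s) * Re (n * f 0) + s * Re (n * w)"
        by (simp add: z0(2)[symmetric] l_def algebra_simps)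
      moreover have "(1 - s) * Re (n * f 0) < (1 - s) * Re (n * f z0)"
        using n[of 0] \<rho> True s1 by (intro mult_strict_left_mono) auto
      moreover have "s * Re (n * w) \<le> s * Re (n * f z0)"
        using s wle by (intro mult_left_mono) auto
      ultimately show False by (simp add: algebra_simps)
    next
      \<comment> \<open>A last point that comes from the open disk could be passed, since
        \<open>f\<close> is open there by invariance of domain.\<close>
      case False
      have "open (f ` ball 0 \<rho>)"
        by (rule invariance_of_domain)
          (use sub in \<open>auto intro: continuous_on_subset[OF contf] inj_on_subset[OF inj]\<close>)
      then have "open (l -` (f ` ball 0 \<rho>))"
        by (rule open_vimage) (auto simp: l_def intro!: continuous_intros)
      moreover have "s \<in> l -` (f ` ball 0 \<rho>)" using z0 False by auto
      ultimately obtain d where d: "d > 0" "ball s d \<subseteq> l -` (f ` ball 0 \<rho>)"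
        by (meson openE)
      define t where "t = min 1 (s + d/2)"
      have "t \<in> ball s d" "t > s" using d s1 by (auto simp: t_def dist_real_def)
      then have "t \<in> {0..1} \<inter> l -` K"
      proof -
        have "l t \<in> f ` ball 0 \<rho>" using \<open>t \<in> ball s d\<close> d by blast
        moreover have "ball 0 \<rho> \<subseteq> cball (0::complex) \<rho>" by auto
        ultimately have "l t \<in> K" unfolding K_def by blast
        moreover have "0 \<le> t" "t \<le> 1" using \<open>t > s\<close> s(1) by (auto simp: t_def)
        ultimately show ?thesis by simp
      qed
      then show False using s(2)[of t] \<open>t > s\<close> by simp
    qed
  qed
  show "convex (f ` ball 0 R)"
    unfolding convex_contains_segment
  proof (intro ballI)
    fix a b assume "a \<in> f ` ball 0 R" "b \<in> f ` ball 0 R"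
    then obtain x y where xy: "x \<in> ball 0 R" "y \<in> ball 0 R" "a = f x" "b = f y" by auto
    have R: "R > 0" using xy by (metis mem_ball_0 norm_ge_zero order.strict_trans1)
    obtain \<rho> where \<rho>: "max (R/2) (max (cmod x) (cmod y)) < \<rho>" "\<rho> < R"
      using dense[of "max (R/2) (max (cmod x) (cmod y))" R] xy R by auto
    have "closed_segment a b \<subseteq> f ` cball 0 \<rho>"
      unfolding xy(3,4) by (rule cb) (use \<rho> R in auto)
    also have "\<dots> \<subseteq> f ` ball 0 R" using \<rho> by auto
    finally show "closed_segment a b \<subseteq> f ` ball 0 R" .
  qed
qed

section \<open>Schwarz-Pick estimates\<close>

lemma has_field_derivative_Moebius_function:
  assumes "cmod w < 1" "cmod z < 1"
  shows "(Moebius_function 0 w has_field_derivative of_real (1 - (cmod w)\<^sup>2) / (1 - cnj w * z)\<^sup>2) (at z)"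
proof -
  have "cmod (cnj w * z) < 1"
    using assms by (metis complex_mod_cnj norm_ge_zero norm_mult norm_mult_less mult_1)
  then have nz: "1 - cnj w * z \<noteq> 0" by auto
  have *: "of_real (1 - (cmod w)\<^sup>2) = 1 - w * cnj w"
    by (simp only: of_real_diff of_real_1 complex_norm_square)
  have "((\<lambda>z. (z - w) / (1 - cnj w * z)) has_field_derivative of_real (1 - (cmod w)\<^sup>2) / (1 - cnj w * z)\<^sup>2) (at z)"
    unfolding * using nz
    by (auto intro!: derivative_eq_intros simp: power2_eq_square field_simps)
  then show ?thesis
    by (simp add: Moebius_function_simple[abs_def])
qed

text \<open>Schwarz' lemma at 0 for \<open>f\<close> composed with the disk automorphisms that carry
  0 to \<open>a\<close> and \<open>f a\<close> to 0.\<close>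

lemma Schwarz_Pick_deriv:
  assumes hol: "f holomorphic_on ball 0 1" and f1: "\<And>z. cmod z < 1 \<Longrightarrow> cmod (f z) < 1"
    and a: "cmod a < 1"
  shows "cmod (deriv f a) * (1 - (cmod a)\<^sup>2) \<le> 1 - (cmod (f a))\<^sup>2"
proof -
  define M where "M = Moebius_function 0 (-a)"
  define N where "N = Moebius_function 0 (f a)"
  have M0: "M 0 = a" by (simp add: M_def Moebius_function_of_zero)
  have holM: "M holomorphic_on ball 0 1" and holN: "N holomorphic_on ball 0 1"
    using a f1[OF a] by (auto simp: M_def N_def Moebius_function_holomorphic)
  have M1: "cmod (M z) < 1" if "cmod z < 1" for z
    using a that by (simp add: M_def Moebius_function_norm_lt_1)
  have N1: "cmod (N z) < 1" if "cmod z < 1" for z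
    using f1[OF a] that by (simp add: N_def Moebius_function_norm_lt_1)
  have hol': "(\<lambda>z. N (f (M z))) holomorphic_on ball 0 1"
  proof -
    have "(f \<circ> M) holomorphic_on ball 0 1"
      by (rule holomorphic_on_compose_gen[OF holM hol]) (use M1 in auto)
    then have "(N \<circ> (f \<circ> M)) holomorphic_on ball 0 1"
      by (rule holomorphic_on_compose_gen[OF _ holN]) (use M1 f1 in auto)
    then show ?thesis by (simp add: o_def)
  qed
  have "cmod (deriv (\<lambda>z. N (f (M z))) 0) \<le> 1"
    by (rule Schwarz_Lemma(2)[OF hol', of 0])
       (use M0 M1 N1 f1 in \<open>auto simp: N_def Moebius_function_eq_zero\<close>)
  moreover have "((\<lambda>z. N (f (M z))) has_field_derivative
      (of_real (1 - (cmod (f a))\<^sup>2) / (1 - cnj (f a) * f a)\<^sup>2) * (deriv f a * (of_real (1 - (cmod (-a))\<^sup>2) / (1 - cnj (-a) * 0)\<^sup>2))) (at 0)"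
  proof (rule DERIV_chain2[of N], goal_cases)
    case 1
    show ?case
      using has_field_derivative_Moebius_function[of "f a" "f a"] f1[OF a] by (simp add: N_def M0)
  next
    case 2
    show ?case
      unfolding M_def using hol a
      by (intro DERIV_chain2[of f] has_field_derivative_Moebius_function)
         (auto simp: Moebius_function_of_zero intro!: holomorphic_derivI)
  qed
  ultimately have le: "cmod ((of_real (1 - (cmod (f a))\<^sup>2) / (1 - cnj (f a) * f a)\<^sup>2) * (deriv f a * (of_real (1 - (cmod (-a))\<^sup>2) / (1 - cnj (-a) * 0)\<^sup>2))) \<le> 1"
    by (simp only: DERIV_imp_deriv)
  define A B where "A = 1 - (cmod (f a))\<^sup>2" and "B = 1 - (cmod a)\<^sup>2"
  have "1 - cnj (f a) * f a = of_real A"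
    unfolding A_def by (simp only: of_real_diff of_real_1 complex_norm_square mult.commute)
  moreover have pos: "A > 0" "B > 0"
    using f1[OF a] a by (auto simp: A_def B_def power_less_one_iff abs_square_less_1)
  ultimately have "A / A\<^sup>2 * (cmod (deriv f a) * B) \<le> 1"
    using le by (simp add: A_def[symmetric] B_def[symmetric] norm_mult norm_divide norm_power)
  then have "cmod (deriv f a) * B \<le> A"
    using pos by (simp add: field_simps power2_eq_square)
  then show ?thesis
    by (simp only: A_def B_def)
qed

text \<open>This is Schwarz-Pick for \<psi>(z) = f(z)/z, because z f' - f = z^2 \<psi>'. Rotations
  are treated apart: for them \<psi> is a unimodular constant and does not map into the open
  disk.\<close>

lemma Schwarz_Pick_deriv_zero:
  assumes hol: "f holomorphic_on ball 0 1" and f1: "\<And>z. cmod z < 1 \<Longrightarrow> cmod (f z) < 1"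
    and f0: "f 0 = 0" and z: "cmod z < 1"
  shows "cmod (z * deriv f z - f z) * (1 - (cmod z)\<^sup>2) \<le> (cmod z)\<^sup>2 - (cmod (f z))\<^sup>2"
proof -
  obtain \<psi> where \<psi>: "\<psi> holomorphic_on ball 0 1" "\<And>z. cmod z < 1 \<Longrightarrow> f z = z * \<psi> z" "deriv f 0 = \<psi> 0"
    using Schwarz3[OF hol f0] by blast
  have df: "(f has_field_derivative \<psi> z + z * deriv \<psi> z) (at z)"
  proof -
    have "((\<lambda>z. z * \<psi> z) has_field_derivative \<psi> z + z * deriv \<psi> z) (at z)"
      using \<psi>(1) z by (auto intro!: derivative_eq_intros holomorphic_derivI)
    then show ?thesis
      by (rule has_field_derivative_transform_within_open[where S="ball 0 1"]) (use z \<psi>(2) in auto)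
  qed
  have eq: "z * deriv f z - f z = z\<^sup>2 * deriv \<psi> z"
    using DERIV_imp_deriv[OF df] \<psi>(2)[OF z] by (simp add: algebra_simps power2_eq_square)
  show ?thesis
  proof (cases "\<exists>\<alpha>. (\<forall>z. cmod z < 1 \<longrightarrow> f z = \<alpha> * z) \<and> cmod \<alpha> = 1")
    case True
    then obtain \<alpha> where \<alpha>: "\<And>z. cmod z < 1 \<Longrightarrow> f z = \<alpha> * z" "cmod \<alpha> = 1" by blast
    have "((\<lambda>z. \<alpha> * z) has_field_derivative \<alpha>) (at z)"
      by (auto intro!: derivative_eq_intros)
    then have "(f has_field_derivative \<alpha>) (at z)"
      by (rule has_field_derivative_transform_within_open[where S="ball 0 1"]) (use z \<alpha>(1) in auto)
    then show ?thesis using \<alpha> z by (simp add: DERIV_imp_deriv norm_mult mult.commute)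
  next
    case False
    have \<psi>1: "cmod (\<psi> w) < 1" if w: "cmod w < 1" for w
    proof (cases "w = 0")
      case True
      then show ?thesis using Schwarz_Lemma[OF hol f0 f1 w] False \<psi>(3) by fastforce
    next
      case w0: False
      have "cmod (f w) \<le> cmod w" "cmod (f w) \<noteq> cmod w"
        using Schwarz_Lemma[OF hol f0 f1 w] False w w0 by blast+
      then show ?thesis using \<psi>(2)[OF w] w0 by (simp add: norm_mult)
    qed
    have "(cmod z)\<^sup>2 * (cmod (deriv \<psi> z) * (1 - (cmod z)\<^sup>2)) \<le> (cmod z)\<^sup>2 * (1 - (cmod (\<psi> z))\<^sup>2)"
      using Schwarz_Pick_deriv[OF \<psi>(1) \<psi>1 z] by (intro mult_left_mono) auto
    then show ?thesis
      unfolding eq using \<psi>(2)[OF z] by (simp add: norm_mult norm_power algebra_simps)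
  qed
qed

text \<open>The bound on |z f'| carries a factor 1 - |f(z)|, which cancels against the lower bound 1
  - |f(z)| for the denominator. A rotation f with f(z) = -|z| gives equality.\<close>

lemma Re_Schwarz_log_deriv_ge:
  assumes hol: "f holomorphic_on ball 0 1" and f1: "\<And>z. cmod z < 1 \<Longrightarrow> cmod (f z) < 1"
    and f0: "f 0 = 0" and z: "cmod z < 1"
  shows "Re (z * deriv f z / (1 + f z)) \<ge> - (cmod z / (1 - cmod z))"
proof -
  define r where "r = cmod z"
  define x where "x = cmod (f z)"
  have r: "0 \<le> r" "r < 1" using z by (auto simp: r_def)
  have x: "0 \<le> x" "x \<le> r" 
    using Schwarz_Lemma(1)[OF hol f0 f1 z] by (auto simp: x_def r_def)
  have r2: "0 < 1 - r\<^sup>2" using r by (simp add: power_less_one_iff abs_square_less_1)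
  have "cmod (z * deriv f z) \<le> cmod (z * deriv f z - f z) + x"
    unfolding x_def by (metis diff_add_cancel norm_triangle_ineq)
  then have "cmod (z * deriv f z) * (1 - r\<^sup>2) \<le> cmod (z * deriv f z - f z) * (1 - r\<^sup>2) + x * (1 - r\<^sup>2)"
    using r2 by (metis distrib_right mult_le_cancel_right_pos)
  also have "\<dots> \<le> r\<^sup>2 - x\<^sup>2 + x * (1 - r\<^sup>2)"
    using Schwarz_Pick_deriv_zero[OF hol f1 f0 z] by (simp add: r_def x_def)
  \<comment> \<open>The difference of the two sides is exactly (r - x)(1 - x).\<close>
  also have "\<dots> \<le> r * (1 + r) * (1 - x)"
  proof -
    have "0 \<le> (r - x) * (1 - x)" using x r by simp
    then show ?thesis by (simp add: algebra_simps power2_eq_square)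
  qed
  also have "\<dots> = r / (1 - r) * (1 - x) * (1 - r\<^sup>2)"
    using r by (simp add: field_simps power2_eq_square)
  finally have A: "cmod (z * deriv f z) \<le> r / (1 - r) * (1 - x)"
    using r2 by (rule mult_right_le_imp_le)
  have B: "1 - x \<le> cmod (1 + f z)"
    unfolding x_def by (metis add_diff_cancel norm_minus_commute norm_one norm_triangle_ineq2 norm_minus_cancel diff_minus_eq_add)
  have "cmod (z * deriv f z / (1 + f z)) \<le> r / (1 - r)"
  proof -
    have "cmod (z * deriv f z) \<le> r / (1 - r) * cmod (1 + f z)"
      using A B r by (meson divide_nonneg_pos diff_gt_0_iff_gt mult_left_mono order_trans)
    moreover have "cmod (1 + f z) > 0" using B x r by linarith
    ultimately show ?thesis by (simp add: norm_divide divide_le_eq)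
  qed
  then show ?thesis
    using abs_Re_le_cmod[of "z * deriv f z / (1 + f z)"] unfolding r_def by linarith
qed

section \<open>Functions with values in a half-plane\<close>

lemma cmod_less_add_one_iff: "cmod (p - 1) < cmod (p + 1) \<longleftrightarrow> Re p > 0"
proof -
  have "cmod (p - 1) < cmod (p + 1) \<longleftrightarrow> (cmod (p - 1))\<^sup>2 < (cmod (p + 1))\<^sup>2"
    by (smt (verit) norm_ge_zero power2_less_imp_less power_strict_mono zero_less_numeral)
  also have "\<dots> \<longleftrightarrow> Re p > 0"
    unfolding cmod_power2 by (simp add: power2_eq_square algebra_simps)
  finally show ?thesis .
qed

text \<open>Schwarz-Pick for the Cayley transform \<omega> = (p - 1)/(p + 1): both 1 - |\<omega>|^2
  = 4 Re p / |p + 1|^2 and |\<omega>'| = 2|p'| / |p + 1|^2 have the same denominator.\<close>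

lemma positive_real_part_deriv_le:
  assumes hol: "p holomorphic_on ball 0 1" and pos: "\<And>z. cmod z < 1 \<Longrightarrow> Re (p z) > 0"
    and z: "cmod z < 1"
  shows "cmod (deriv p z) * (1 - (cmod z)\<^sup>2) \<le> 2 * Re (p z)"
proof -
  have nz: "p w + 1 \<noteq> 0" if "cmod w < 1" for w
    using pos[OF that] by (metis add_eq_0_iff2 less_asym uminus_complex.sel(1) one_complex.sel(1) neg_0_less_iff_less zero_less_one)
  define \<omega> where "\<omega> w = (p w - 1) / (p w + 1)" for w
  have hol\<omega>: "\<omega> holomorphic_on ball 0 1"
    unfolding \<omega>_def by (intro holomorphic_intros hol) (use nz in auto)
  have \<omega>1: "cmod (\<omega> w) < 1" if "cmod w < 1" for w
    using pos[OF that] nz[OF that] cmod_less_add_one_iff[of "p w"] by (simp add: \<omega>_def norm_divide)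
  have d: "deriv \<omega> z = 2 * deriv p z / (p z + 1)\<^sup>2"
  proof (rule DERIV_imp_deriv)
    have "(p has_field_derivative deriv p z) (at z)"
      using hol z by (auto intro: holomorphic_derivI)
    then show "(\<omega> has_field_derivative 2 * deriv p z / (p z + 1)\<^sup>2) (at z)"
      unfolding \<omega>_def using nz[OF z]
      by (auto intro!: derivative_eq_intros simp: power2_eq_square field_simps)
  qed
  have q: "(cmod (p z + 1))\<^sup>2 > 0" using nz[OF z] by simp
  have "1 - (cmod (\<omega> z))\<^sup>2 = ((cmod (p z + 1))\<^sup>2 - (cmod (p z - 1))\<^sup>2) / (cmod (p z + 1))\<^sup>2"
  proof -
    have "(cmod (\<omega> z))\<^sup>2 = (cmod (p z - 1))\<^sup>2 / (cmod (p z + 1))\<^sup>2"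
      by (simp add: \<omega>_def norm_divide power_divide)
    then show ?thesis using q by (simp only: diff_divide_distrib) simp
  qed
  also have "(cmod (p z + 1))\<^sup>2 - (cmod (p z - 1))\<^sup>2 = 4 * Re (p z)"
    unfolding cmod_power2 by (simp add: power2_eq_square algebra_simps)
  finally have "2 * cmod (deriv p z) / (cmod (p z + 1))\<^sup>2 * (1 - (cmod z)\<^sup>2) \<le> 4 * Re (p z) / (cmod (p z + 1))\<^sup>2"
    using Schwarz_Pick_deriv[OF hol\<omega> \<omega>1 z] unfolding d by (simp add: norm_mult norm_divide norm_power)
  then have "2 * cmod (deriv p z) * (1 - (cmod z)\<^sup>2) / (cmod (p z + 1))\<^sup>2 \<le> 4 * Re (p z) / (cmod (p z + 1))\<^sup>2"
    by simp
  then show ?thesis using q unfolding divide_le_cancel by linarith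
qed

text \<open>Harnack's inequality: the Cayley transform \<omega> of \<open>p\<close> fixes 0, so
  |\<omega>(z)| \<le> |z|, while Re p = (1 - |\<omega>|^2)/|1 - \<omega>|^2 is at least (1 -
  |\<omega>|)/(1 + |\<omega>|).\<close>

lemma positive_real_part_ge:
  assumes hol: "p holomorphic_on ball 0 1" and pos: "\<And>z. cmod z < 1 \<Longrightarrow> Re (p z) > 0"
    and p0: "p 0 = 1" and z: "cmod z < 1"
  shows "Re (p z) \<ge> (1 - cmod z) / (1 + cmod z)"
proof -
  have nz: "p w + 1 \<noteq> 0" if "cmod w < 1" for w
    using pos[OF that] by (metis add_eq_0_iff2 less_asym uminus_complex.sel(1) one_complex.sel(1) neg_0_less_iff_less zero_less_one)
  define \<omega> where "\<omega> w = (p w - 1) / (p w + 1)" for w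
  have hol\<omega>: "\<omega> holomorphic_on ball 0 1"
    unfolding \<omega>_def by (intro holomorphic_intros hol) (use nz in auto)
  have \<omega>1: "cmod (\<omega> w) < 1" if "cmod w < 1" for w
    using pos[OF that] nz[OF that] cmod_less_add_one_iff[of "p w"] by (simp add: \<omega>_def norm_divide)
  have \<omega>0: "\<omega> 0 = 0" using p0 by (simp add: \<omega>_def)
  define x where "x = cmod (\<omega> z)"
  have x: "0 \<le> x" "x \<le> cmod z" 
    using Schwarz_Lemma(1)[OF hol\<omega> \<omega>0 \<omega>1 z] by (auto simp: x_def)
  have n1: "1 - \<omega> z \<noteq> 0" using \<omega>1[OF z] by auto
  have p: "p z = (1 + \<omega> z) / (1 - \<omega> z)"
  proof -
    have "1 + \<omega> z = 2 * p z / (p z + 1)" "1 - \<omega> z = 2 / (p z + 1)"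
      using nz[OF z] by (auto simp: \<omega>_def field_simps)
    then show ?thesis using nz[OF z] by simp
  qed
  have "Re (p z) = (1 - x\<^sup>2) / (cmod (1 - \<omega> z))\<^sup>2"
    unfolding p x_def cmod_power2 Re_divide by (simp add: power2_eq_square algebra_simps)
  also have "\<dots> \<ge> (1 - x\<^sup>2) / (1 + x)\<^sup>2"
  proof (rule divide_left_mono)
    have "cmod (1 - \<omega> z) \<le> 1 + x" using norm_triangle_ineq4[of 1 "\<omega> z"] by (simp add: x_def)
    then show "(cmod (1 - \<omega> z))\<^sup>2 \<le> (1 + x)\<^sup>2" by (intro power_mono) auto
    show "0 \<le> 1 - x\<^sup>2" using x z by (simp add: power_le_one)
    show "0 < (1 + x)\<^sup>2 * (cmod (1 - \<omega> z))\<^sup>2" using n1 x by auto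
  qed
  finally have "Re (p z) \<ge> (1 - x\<^sup>2) / (1 + x)\<^sup>2" .
  moreover have "(1 - x\<^sup>2) / (1 + x)\<^sup>2 = (1 - x) / (1 + x)"
  proof -
    have "1 - x\<^sup>2 = (1 + x) * (1 - x)" by (simp add: power2_eq_square algebra_simps)
    then show ?thesis using x by (simp add: power2_eq_square)
  qed
  moreover have "(1 - x) / (1 + x) \<ge> (1 - cmod z) / (1 + cmod z)"
    using x z by (intro frac_le) auto
  ultimately show ?thesis by linarith
qed

text \<open>Convexity of an image yields only a weak inequality in Study's criterion. Replacing
  \<open>p\<close> by (p + d)/(1 + d) makes it strict and keeps the value 1 at 0; then d tends to
  0.\<close>

lemma nonneg_real_part_ge:
  assumes hol: "p holomorphic_on ball 0 1" and nn: "\<And>z. cmod z < 1 \<Longrightarrow> Re (p z) \<ge> 0"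
    and p0: "p 0 = 1" and z: "cmod z < 1"
  shows "Re (p z) \<ge> (1 - cmod z) / (1 + cmod z)"
proof (rule field_le_epsilon)
  fix d :: real assume d: "d > 0"
  define q where "q w = (p w + of_real d) / of_real (1 + d)" for w
  have "Re (q z) \<ge> (1 - cmod z) / (1 + cmod z)"
  proof (rule positive_real_part_ge[OF _ _ _ z])
    show "q holomorphic_on ball 0 1" unfolding q_def using d by (intro holomorphic_intros hol) auto
    show "q 0 = 1" using p0 d by (simp add: q_def) (metis add_pos_pos less_irrefl of_real_1 of_real_add of_real_eq_0_iff zero_less_one)
    show "Re (q w) > 0" if "cmod w < 1" for w
      using nn[OF that] d by (simp add: q_def Re_divide_of_real del: of_real_add)
  qed
  moreover have "Re (q z) = (Re (p z) + d) / (1 + d)"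
    by (simp add: q_def Re_divide_of_real del: of_real_add)
  moreover have "\<dots> \<le> Re (p z) + d"
    using nn[OF z] d by (simp add: divide_le_eq algebra_simps)
  ultimately show "(1 - cmod z) / (1 + cmod z) \<le> Re (p z) + d" by linarith
qed

text \<open>
  With $q = 1/(1 - \omega)$ the estimate reduces to minimising $2m + 1/(m(1 - |z|^2))$ over $m = |q(z)|$;
  the right-hand side is the value at $m = 1/\sqrt{2(1 - |z|^2)}$.
\<close>

lemma Re_half_log_deriv_ge:
  assumes hol: "q holomorphic_on ball 0 1" and half: "\<And>z. cmod z < 1 \<Longrightarrow> Re (q z) > 1/2"
    and q0: "q 0 = 1" and z: "cmod z < 1"
  shows "Re (z * deriv q z / q z) \<ge> 2 * sqrt (2 / (1 - (cmod z)\<^sup>2)) - 2 / (1 - (cmod z)\<^sup>2) - 1"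
proof -
  define R where "R = 1 - (cmod z)\<^sup>2"
  have R: "R > 0" using z by (simp add: R_def power_less_one_iff abs_square_less_1)
  have nz: "q w \<noteq> 0" if "cmod w < 1" for w using half[OF that] by auto
  define \<omega> where "\<omega> w = 1 - 1 / q w" for w
  have hol\<omega>: "\<omega> holomorphic_on ball 0 1"
    unfolding \<omega>_def by (intro holomorphic_intros hol) (use nz in auto)
  have \<omega>q: "q w * \<omega> w = q w - 1" if "cmod w < 1" for w
    using nz[OF that] by (simp add: \<omega>_def field_simps)
  have cm: "(cmod (x - 1))\<^sup>2 = (cmod x)\<^sup>2 - (2 * Re x - 1)" for x
    unfolding cmod_power2 by (simp add: power2_eq_square algebra_simps)
  have \<omega>1: "cmod (\<omega> w) < 1" if w: "cmod w < 1" for w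
  proof -
    have "(cmod (q w - 1))\<^sup>2 < (cmod (q w))\<^sup>2" using half[OF w] cm[of "q w"] by simp
    then have "cmod (q w - 1) < cmod (q w)" by (rule power2_less_imp_less) auto
    then have "cmod (q w) * cmod (\<omega> w) < cmod (q w) * 1" 
      using \<omega>q[OF w] by (simp add: norm_mult[symmetric])
    then show ?thesis by (simp only: mult_less_cancel_left) auto
  qed
  have \<omega>0: "\<omega> 0 = 0" using q0 by (simp add: \<omega>_def)
  have d: "deriv \<omega> z = deriv q z / (q z)\<^sup>2"
  proof (rule DERIV_imp_deriv)
    have "(q has_field_derivative deriv q z) (at z)"
      using hol z by (auto intro: holomorphic_derivI)
    then show "(\<omega> has_field_derivative deriv q z / (q z)\<^sup>2) (at z)"
      unfolding \<omega>_def using nz[OF z]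
      by (auto intro!: derivative_eq_intros simp: power2_eq_square field_simps)
  qed
  define m where "m = cmod (q z)"
  define x where "x = Re (q z)"
  have x: "1/2 < x" "x \<le> m" using half[OF z] complex_Re_le_cmod by (auto simp: x_def m_def)
  have m: "m > 0" using x by simp
  define E where "E = z * deriv \<omega> z - \<omega> z"
  \<comment> \<open>Separating z \<omega>' - \<omega> exposes the quantity that the refined
    Schwarz-Pick inequality controls; the remainder q \<omega> = q - 1 is explicit.\<close>
  have eq: "z * deriv q z / q z = q z - 1 + q z * E"
  proof -
    have "q z * E = z * deriv q z / q z - q z * \<omega> z"
      using nz[OF z] unfolding E_def d by (simp add: field_simps power2_eq_square)
    then show ?thesis using \<omega>q[OF z] by simp
  qed
  \<comment> \<open>The factor m^2 turns |\<omega>|^2 into |q - 1|^2 = m^2 - (2x - 1), so that only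
    \<open>m\<close>, \<open>x\<close> and \<open>R\<close> remain.\<close>
  have "m * (m * (cmod E * R)) \<le> m * (m * ((cmod z)\<^sup>2 - (cmod (\<omega> z))\<^sup>2))"
    using Schwarz_Pick_deriv_zero[OF hol\<omega> \<omega>1 \<omega>0 z] m
    by (intro mult_left_mono) (auto simp: E_def R_def)
  also have "\<dots> = (1 - R) * m\<^sup>2 - (cmod (q z * \<omega> z))\<^sup>2"
    by (simp add: R_def m_def norm_mult power2_eq_square algebra_simps)
  also have "\<dots> = (2 * x - 1) - R * m\<^sup>2"
    unfolding \<omega>q[OF z] cm by (simp add: m_def x_def algebra_simps)
  finally have "m * cmod E \<le> ((2 * x - 1) - R * m\<^sup>2) / (m * R)"
    using m R by (simp add: pos_le_divide_eq mult_ac)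
  also have "\<dots> = (2 * x - 1) / (m * R) - m"
    using m R by (simp add: field_simps power2_eq_square)
  finally have E: "cmod (q z * E) \<le> (2 * x - 1) / (m * R) - m"
    by (simp add: norm_mult m_def)
  \<comment> \<open>This fixes the sign of 1 - 2/(m R), the coefficient of \<open>x\<close> in the
    lower bound: being nonpositive, it allows \<open>x\<close> to be replaced by the larger
    \<open>m\<close>.\<close>
  have mR: "m * R \<le> 2"
  proof -
    have "cmod (\<omega> z) \<le> cmod z" using Schwarz_Lemma(1)[OF hol\<omega> \<omega>0 \<omega>1 z] .
    then have "m * cmod (\<omega> z) \<le> m * cmod z" using m by simp
    then have "cmod (q z - 1) \<le> m * cmod z" using \<omega>q[OF z] by (simp add: m_def norm_mult[symmetric])
    then have "m - 1 \<le> m * cmod z" using norm_triangle_ineq2[of "q z" 1] by (simp add: m_def)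
    then have "m * (1 - cmod z) * (1 + cmod z) \<le> 1 * (1 + cmod z)"
      by (intro mult_right_mono) (auto simp: algebra_simps)
    also have "\<dots> \<le> 2" using z by simp
    finally show ?thesis by (simp add: R_def algebra_simps power2_eq_square)
  qed
  have "Re (z * deriv q z / q z) = x - 1 + Re (q z * E)"
    unfolding eq by (simp add: x_def)
  moreover have "Re (q z * E) \<ge> - ((2 * x - 1) / (m * R) - m)"
    using E abs_Re_le_cmod[of "q z * E"] by linarith
  moreover have "x * (1 - 2 / (m * R)) \<ge> m * (1 - 2 / (m * R))"
    using x mR m R by (intro mult_right_mono_neg) (auto simp: field_simps)
  moreover have "m * (1 - 2 / (m * R)) = m - 2 / R" using m by (simp add: field_simps)
  moreover have "(2 * x - 1) / (m * R) = x * (2 / (m * R)) - 1 / (m * R)"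
    by (simp add: diff_divide_distrib)
  ultimately have 1: "Re (z * deriv q z / q z) \<ge> 2 * m - 1 - 2 / R + 1 / (m * R)"
    by (simp add: algebra_simps)
  define s where "s = sqrt (2 / R)"
  have s2: "s\<^sup>2 = 2 / R" using R by (simp add: s_def)
  have "0 \<le> (2 * m - s)\<^sup>2 / (2 * m)" using m by simp
  also have "\<dots> = 2 * m + s\<^sup>2 / (2 * m) - 2 * s"
    using m by (simp add: field_simps power2_eq_square)
  also have "s\<^sup>2 / (2 * m) = 1 / (m * R)" using s2 m R by (simp add: field_simps)
  finally show ?thesis using 1 by (simp add: s_def R_def)
qed

text \<open>
  For convex $G(D)$ the map $\zeta \mapsto G^{-1}((G(\zeta e^{it}) + G(\zeta e^{-it}))/2)$ satisfies the
  hypotheses of Schwarz' lemma; the claim is its second-order expansion at $t = 0$.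
\<close>

lemma Study_convex_unit_disk:
  assumes hol: "G holomorphic_on ball 0 1" and inj: "inj_on G (ball 0 1)"
    and conv: "convex (G ` ball 0 1)" and z: "cmod z < 1"
  shows "Re (1 + z * deriv (deriv G) z / deriv G z) \<ge> 0"
proof (cases "z = 0")
  case True
  then show ?thesis by simp
next
  case z0: False
  obtain H where H: "H holomorphic_on G ` ball 0 1"
     "\<And>w. w \<in> ball 0 1 \<Longrightarrow> deriv G w * deriv H (G w) = 1"
     "\<And>w. w \<in> ball 0 1 \<Longrightarrow> H (G w) = w"
    using holomorphic_has_inverse[OF hol _ inj] by auto
  have nc: "\<not> G constant_on ball 0 1"
    using inj_on_def[of G "ball 0 1"] inj
    by (metis constant_on_def dist_0_norm inj_onD mem_ball norm_zero z z0 zero_less_one)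
  have opG: "open (G ` ball 0 1)"
    using open_mapping_thm[OF hol _ _ _ _ nc] by auto
  have nz: "deriv G w \<noteq> 0" if "cmod w < 1" for w
    using H(2)[of w] that by auto
  define rot where "rot t = exp (\<i> * of_real t)" for t :: real
  have rot1: "cmod (rot t) = 1" for t by (simp add: rot_def)
  define mid where "mid t \<zeta> = (G (\<zeta> * rot t) + G (\<zeta> * rot (- t))) / 2" for t \<zeta>
  have inD: "\<zeta> * rot t \<in> ball 0 1" if "cmod \<zeta> < 1" for \<zeta> t
    using that by (simp add: norm_mult rot1)
  have midin: "mid t \<zeta> \<in> G ` ball 0 1" if "cmod \<zeta> < 1" for t \<zeta>
  proof -
    have "(1/2) *\<^sub>R G (\<zeta> * rot t) + (1/2) *\<^sub>R G (\<zeta> * rot (- t)) \<in> G ` ball 0 1"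
      by (rule convexD[OF conv]) (use inD[OF that] in \<open>simp_all del: mem_ball_0\<close>)
    then show ?thesis by (simp add: mid_def scaleR_conv_of_real add_divide_distrib)
  qed
  have le: "cmod (H (mid t z)) \<le> cmod z" for t
  proof (rule Schwarz_Lemma(1)[of "\<lambda>\<zeta>. H (mid t \<zeta>)"])
    have "(\<lambda>\<zeta>. G (\<zeta> * rot s)) holomorphic_on ball 0 1" for s
    proof -
      have "(G \<circ> (\<lambda>\<zeta>. \<zeta> * rot s)) holomorphic_on ball 0 1"
        by (rule holomorphic_on_compose_gen[OF _ hol]) (use inD in \<open>auto intro!: holomorphic_intros\<close>)
      then show ?thesis by (simp add: o_def)
    qed
    then have "mid t holomorphic_on ball 0 1"
      unfolding mid_def by (intro holomorphic_intros) auto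
    then have "(H \<circ> mid t) holomorphic_on ball 0 1"
      by (rule holomorphic_on_compose_gen[OF _ H(1)]) (use midin in auto)
    then show "(\<lambda>\<zeta>. H (mid t \<zeta>)) holomorphic_on ball 0 1" by (simp add: o_def)
    show "cmod (H (mid t \<zeta>)) < 1" if "cmod \<zeta> < 1" for \<zeta>
      using midin[OF that, of t] H(3) by auto
  qed (use z H(3) in \<open>auto simp: mid_def\<close>)
  define a where "a t = z * rot t * deriv G (z * rot t)" for t
  have rot': "(rot has_vector_derivative \<i> * rot t) (at t)" for t
    unfolding rot_def by (auto intro!: derivative_eq_intros has_vector_derivative_real_field)
  have zrot': "((\<lambda>t. z * rot t) has_vector_derivative \<i> * (z * rot t)) (at t)" for t
    using has_vector_derivative_mult_right[OF rot'[of t], of z] by (simp add: mult_ac)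
  have Grot': "((\<lambda>t. G (z * rot t)) has_vector_derivative \<i> * a t) (at t)" for t
  proof -
    have "(G has_field_derivative deriv G (z * rot t)) (at (z * rot t))"
      using hol inD[OF z] by (auto intro: holomorphic_derivI)
    from field_vector_diff_chain_at[OF zrot' this] show ?thesis
      by (simp add: o_def a_def mult_ac)
  qed
  have neg: "((\<lambda>t. k (- t)) has_vector_derivative - k') (at t)"
    if "(k has_vector_derivative k') (at (- t))" for k :: "real \<Rightarrow> complex" and k' t
  proof -
    have "(uminus has_vector_derivative (-1::real)) (at t)"
      unfolding has_real_derivative_iff_has_vector_derivative[symmetric]
      by (auto intro!: derivative_eq_intros)
    from vector_diff_chain_at[OF this that] show ?thesis by (simp add: o_def)
  qed
  define b where "b t = \<i> * (a t - a (- t)) / 2" for t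
  have mid': "((\<lambda>t. mid t z) has_vector_derivative b t) (at t)" for t
    unfolding mid_def b_def
    using has_vector_derivative_divide[OF has_vector_derivative_add[OF Grot' neg[OF Grot']]]
    by (simp add: algebra_simps)
  have Hder: "(H has_field_derivative deriv H w) (at w)"
      "(deriv H has_field_derivative deriv (deriv H) w) (at w)" if "w \<in> G ` ball 0 1" for w
    using H(1) opG that by (auto intro!: holomorphic_derivI holomorphic_deriv)
  \<comment> \<open>By \<open>le\<close> this function is at most 1, with equality at t = 0. Its
    first derivative \<open>v\<close> vanishes there, since \<open>b 0 = 0\<close>, and its second
    derivative is minus the real part in question.\<close>
  define u where "u t = Re (H (mid t z) / z)" for t
  define v where "v t = Re (b t * deriv H (mid t z) / z)" for t
  have u': "(u has_real_derivative v t) (at t)" for t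
  proof -
    have "((\<lambda>t. H (mid t z)) has_vector_derivative b t * deriv H (mid t z)) (at t)"
      using field_vector_diff_chain_at[OF mid' Hder(1)[OF midin[OF z]]] by (simp add: o_def)
    from has_vector_derivative_divide[OF this]
    have "((\<lambda>t. H (mid t z) / z) has_vector_derivative b t * deriv H (mid t z) / z) (at t)" .
    from bounded_linear.has_vector_derivative[OF bounded_linear_Re this]
    show ?thesis
      unfolding u_def v_def has_real_derivative_iff_has_vector_derivative .
  qed
  define a1 where "a1 = \<i> * (z * deriv G z + z\<^sup>2 * deriv (deriv G) z)"
  have a': "(a has_vector_derivative a1) (at 0)"
  proof -
    have "((\<lambda>w. w * deriv G w) has_field_derivative deriv G z + z * deriv (deriv G) z) (at (z * rot 0))"
      using hol z by (auto simp: rot_def intro!: derivative_eq_intros holomorphic_derivI holomorphic_deriv)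
    from field_vector_diff_chain_at[OF zrot' this] show ?thesis
      unfolding a_def a1_def by (simp add: o_def rot_def algebra_simps power2_eq_square)
  qed
  have b': "(b has_vector_derivative \<i> * a1) (at 0)"
  proof -
    have "((\<lambda>t. a (- t)) has_vector_derivative - a1) (at 0)"
      using neg[of a a1 0] a' by simp
    from has_vector_derivative_divide[OF has_vector_derivative_mult_right[OF has_vector_derivative_diff[OF a' this]], of \<i> 2]
    show ?thesis unfolding b_def by simp
  qed
  have b0: "b 0 = 0" and mid0: "mid 0 z = G z" by (auto simp: b_def mid_def rot_def)
  have v': "(v has_real_derivative Re (\<i> * a1 * deriv H (G z) / z)) (at 0)"
  proof -
    have 1: "((\<lambda>t. deriv H (mid t z)) has_vector_derivative b 0 * deriv (deriv H) (mid 0 z)) (at 0)"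
      using field_vector_diff_chain_at[OF mid' Hder(2)[OF midin[OF z]]] by (simp add: o_def)
    from has_vector_derivative_mult[OF b' 1]
    have "((\<lambda>t. b t * deriv H (mid t z)) has_vector_derivative \<i> * a1 * deriv H (G z)) (at 0)"
      by (simp add: b0 mid0)
    from bounded_linear.has_vector_derivative[OF bounded_linear_Re has_vector_derivative_divide[OF this]]
    show ?thesis
      unfolding v_def has_real_derivative_iff_has_vector_derivative .
  qed
  have "deriv H (G z) = 1 / deriv G z"
    using H(2)[of z] z nz[OF z] by (simp add: field_simps)
  then have eq: "Re (\<i> * a1 * deriv H (G z) / z) = - Re (1 + z * deriv (deriv G) z / deriv G z)"
  proof -
    assume d: "deriv H (G z) = 1 / deriv G z"
    have "\<i> * a1 * deriv H (G z) / z = - (1 + z * deriv (deriv G) z / deriv G z)"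
      using z0 nz[OF z] by (simp add: d a1_def field_simps power2_eq_square)
    then show ?thesis by simp
  qed
  show ?thesis
  \<comment> \<open>Second derivative test: a positive derivative of \<open>v\<close> at 0 would
    make \<open>v\<close> positive just to the right of 0 and push \<open>u\<close> above its
    maximum.\<close>
  proof (rule ccontr)
    assume "\<not> ?thesis"
    then have "Re (\<i> * a1 * deriv H (G z) / z) > 0" using eq by linarith
    from DERIV_pos_inc_right[OF v' this] obtain d where
      d: "d > 0" "\<And>h. 0 < h \<Longrightarrow> h < d \<Longrightarrow> v 0 < v h" by auto
    have v0: "v 0 = 0" by (simp add: v_def b0)
    have "u 0 < u (d/2)"
    proof (rule DERIV_pos_imp_increasing_open[of 0 "d/2" u])
      show "\<exists>y. (u has_real_derivative y) (at x) \<and> 0 < y" if "0 < x" "x < d/2" for x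
        using u' d(2)[of x] that v0 d(1) by auto
      show "continuous_on {0..d/2} u"
        using u' DERIV_isCont continuous_at_imp_continuous_on by blast
    qed (use d in auto)
    moreover have "u 0 = 1" using z z0 H(3)[of z] by (simp add: u_def mid0)
    moreover have "u (d/2) \<le> 1"
    proof -
      have "u (d/2) \<le> cmod (H (mid (d/2) z) / z)"
        unfolding u_def by (rule complex_Re_le_cmod)
      also have "\<dots> \<le> 1" using le[of "d/2"] z0 by (simp add: norm_divide)
      finally show ?thesis .
    qed
    ultimately show False by simp
  qed
qed

text \<open>The quotient z G''/G' is invariant under rescaling to the unit disk. The sharpness
  argument uses this form on the disk of a supposedly larger radius of convexity.\<close>

lemma Study_convex_ball:
  assumes hol: "G holomorphic_on ball 0 \<rho>" and inj: "inj_on G (ball 0 \<rho>)"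
    and conv: "convex (G ` ball 0 \<rho>)" and z: "cmod z < \<rho>"
  shows "Re (1 + z * deriv (deriv G) z / deriv G z) \<ge> 0"
proof -
  have \<rho>: "\<rho> > 0" using z by (meson norm_ge_zero order.strict_trans1)
  define K where "K w = G (of_real \<rho> * w)" for w
  have img: "(\<lambda>w. of_real \<rho> * w) ` ball 0 1 = ball (0::complex) \<rho>"
  proof -
    have "x \<in> (\<lambda>w. of_real \<rho> * w) ` ball 0 1" if "cmod x < \<rho>" for x
      using that \<rho> by (intro image_eqI[of _ _ "x / of_real \<rho>"]) (auto simp: norm_divide)
    then show ?thesis using \<rho> by (auto simp: norm_mult)
  qed
  have Keq: "K = G \<circ> (\<lambda>w. of_real \<rho> * w)" by (simp add: K_def o_def fun_eq_iff)
  have dK: "deriv K w = of_real \<rho> * deriv G (of_real \<rho> * w)" if "cmod w < 1" for w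
  proof (rule DERIV_imp_deriv)
    have "(G has_field_derivative deriv G (of_real \<rho> * w)) (at (of_real \<rho> * w))"
      using hol that \<rho> by (auto intro!: holomorphic_derivI simp: norm_mult)
    from DERIV_chain2[OF this DERIV_cmult[OF DERIV_ident, of "of_real \<rho>"]]
    show "(K has_field_derivative of_real \<rho> * deriv G (of_real \<rho> * w)) (at w)"
      unfolding K_def by (simp add: mult.commute)
  qed
  have ddK: "deriv (deriv K) w = (of_real \<rho>)\<^sup>2 * deriv (deriv G) (of_real \<rho> * w)" if "cmod w < 1" for w
  proof (rule DERIV_imp_deriv)
    have "(deriv G has_field_derivative deriv (deriv G) (of_real \<rho> * w)) (at (of_real \<rho> * w))"
      using hol that \<rho> by (auto intro!: holomorphic_derivI[where S="ball 0 \<rho>"] holomorphic_deriv simp: norm_mult)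
    from DERIV_chain2[OF this DERIV_cmult[OF DERIV_ident, of "of_real \<rho>"]]
    have "((\<lambda>w. deriv G (of_real \<rho> * w)) has_field_derivative of_real \<rho> * deriv (deriv G) (of_real \<rho> * w)) (at w)"
      by (simp add: mult.commute)
    from DERIV_cmult[OF this, of "of_real \<rho>"]
    have "((\<lambda>w. of_real \<rho> * deriv G (of_real \<rho> * w)) has_field_derivative (of_real \<rho>)\<^sup>2 * deriv (deriv G) (of_real \<rho> * w)) (at w)"
      by (simp add: power2_eq_square mult_ac)
    then show "(deriv K has_field_derivative (of_real \<rho>)\<^sup>2 * deriv (deriv G) (of_real \<rho> * w)) (at w)"
      by (rule has_field_derivative_transform_within_open[where S="ball 0 1"]) (use that dK in auto)
  qed
  define w where "w = z / of_real \<rho>"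
  have w: "cmod w < 1" "of_real \<rho> * w = z" using z \<rho> by (auto simp: w_def norm_divide)
  have "Re (1 + w * deriv (deriv K) w / deriv K w) \<ge> 0"
  proof (rule Study_convex_unit_disk[OF _ _ _ w(1)])
    show "K holomorphic_on ball 0 1"
      unfolding Keq by (rule holomorphic_on_compose_gen[OF _ hol]) (use img in \<open>auto intro!: holomorphic_intros\<close>)
    show "inj_on K (ball 0 1)"
      unfolding Keq using \<rho> by (intro comp_inj_on) (auto simp: img inj intro: inj_onI)
    show "convex (K ` ball 0 1)" unfolding Keq image_comp[symmetric] img by (rule conv)
  qed
  moreover have "w * deriv (deriv K) w / deriv K w = z * deriv (deriv G) z / deriv G z"
  proof -
    have "deriv K w = of_real \<rho> * deriv G z" "deriv (deriv K) w = (of_real \<rho>)\<^sup>2 * deriv (deriv G) z"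
      using dK[OF w(1)] ddK[OF w(1)] by (simp_all only: w(2))
    then have "w * deriv (deriv K) w / deriv K w = (of_real \<rho> * w) * deriv (deriv G) z / deriv G z"
      using \<rho> by (simp add: power2_eq_square)
    then show ?thesis by (simp only: w(2))
  qed
  ultimately show ?thesis by simp
qed

section \<open>Reduction to an estimate for the analytic comparison function\<close>

text \<open>The comparison condition and the two half-plane conditions concern derivatives only, so
  extremal functions can be prescribed by their derivative and then integrated.\<close>

lemma primitive_in_class_A:
  assumes hol: "q holomorphic_on ball 0 1" and q0: "q 0 = 1"
  obtains G where "G \<in> class_A" "\<And>z. cmod z < 1 \<Longrightarrow> deriv G z = q z"
proof -
  obtain g where g: "\<And>z. z \<in> ball 0 1 \<Longrightarrow> (g has_field_derivative q z) (at z within ball 0 1)"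
    using holomorphic_convex_primitive'[OF _ _ hol] by auto
  define G where "G z = g z - g 0" for z
  have G: "(G has_field_derivative q z) (at z)" if "cmod z < 1" for z
  proof -
    have "at z within ball 0 1 = at z" by (rule at_within_open) (use that in auto)
    then have "(g has_field_derivative q z) (at z)"
      using g[of z] that by simp
    from DERIV_diff[OF this DERIV_const[of "g 0"]] show ?thesis unfolding G_def by simp
  qed
  then have dG: "deriv G z = q z" if "cmod z < 1" for z
    using that by (intro DERIV_imp_deriv) auto
  have "G holomorphic_on ball 0 1"
    unfolding holomorphic_on_open[OF open_ball] using G by (metis mem_ball_0)
  then have "G \<in> class_A" using dG[of 0] q0 by (simp add: class_A_def G_def)
  then show ?thesis using that dG by blast
qed

text \<open>The premise \<open>lower\<close> may assume that G' has no zero: with division by zero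
  giving 0, the condition of \<open>F_H0 G\<close> would read 1 < 1 at such a zero, so the class of
  that \<open>G\<close> is empty. In \<open>upper\<close> the nonvanishing is demanded, since
  otherwise no member could be built. Strict inequality for |z| < R suffices to put \<open>R\<close>
  itself into the set whose supremum is taken, because all disks involved are open.\<close>

lemma radius_convexity_F_H0_eqI:
  assumes A: "\<G> \<subseteq> class_A" and R: "0 < R" "R < 1"
    and lower: "\<And>G z. G \<in> \<G> \<Longrightarrow> (\<And>w. cmod w < 1 \<Longrightarrow> deriv G w \<noteq> 0) \<Longrightarrow> cmod z < R \<Longrightarrow>
        cmod z / (1 - cmod z) < Re (1 + z * deriv (deriv G) z / deriv G z)"
    and upper: "\<And>r. R < r \<Longrightarrow> r \<le> 1 \<Longrightarrow> \<exists>G\<in>\<G>. \<exists>z. cmod z < r \<and> (\<forall>w. cmod w < 1 \<longrightarrow> deriv G w \<noteq> 0) \<and>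
        Re (1 + z * deriv (deriv G) z / deriv G z) < cmod z / (1 - cmod z)"
  shows "radius_convexity (\<Union>G\<in>\<G>. F_H0 G) = R"
  unfolding radius_convexity_def
proof (rule cSup_eq_maximum)
  have "inj_on f (ball 0 \<rho>) \<and> convex (f ` ball 0 \<rho>)"
    if \<rho>: "0 < \<rho>" "\<rho> \<le> R" and G: "G \<in> \<G>" and f: "f \<in> F_H0 G" for \<rho> f G
  proof -
    obtain h g where hg: "h holomorphic_on ball 0 1" "g holomorphic_on ball 0 1"
      "\<And>z. cmod z < 1 \<Longrightarrow> f z = h z + cnj (g z)" "deriv h 0 = 1" "deriv g 0 = 0"
      and le: "\<And>z. cmod z < 1 \<Longrightarrow> cmod (deriv h z / deriv G z - 1) < 1 - cmod (deriv g z / deriv G z)"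
      using f unfolding F_H0_def harmonic_decomp_def by auto
    have GA: "G holomorphic_on ball 0 1" "deriv G 0 = 1"
      using A G by (auto simp: class_A_def)
    have nz: "deriv G z \<noteq> 0" if "cmod z < 1" for z
      using le[OF that] by auto
    have sub: "ball 0 \<rho> \<subseteq> ball (0::complex) 1" using \<rho> R by auto
    have jac: "cmod (deriv g z) < cmod (deriv h z)" if z: "cmod z < \<rho>" for z
    proof -
      have z1: "cmod z < 1" using z \<rho> R by simp
      have "1 - cmod (deriv h z / deriv G z) \<le> cmod (deriv h z / deriv G z - 1)"
        by (metis norm_minus_commute norm_one norm_triangle_ineq2)
      then have "cmod (deriv g z / deriv G z) < cmod (deriv h z / deriv G z)"
        using le[OF z1] by linarith
      then show ?thesis using nz[OF z1] by (simp add: norm_divide divide_less_cancel)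
    qed
    have pos: "Re (1 + z * (deriv (deriv h) z + \<epsilon> * deriv (deriv g) z) / (deriv h z + \<epsilon> * deriv g z)) > 0"
      if \<epsilon>: "cmod \<epsilon> = 1" and z: "cmod z < \<rho>" for \<epsilon> z
    proof -
      have z1: "cmod z < 1" using z \<rho> R by simp
      \<comment> \<open>The defining inequality of the class bounds |h'/G' - 1| + |g'/G'|, hence
        |w|, by 1 for all unimodular \<open>\<epsilon>\<close> at once.\<close>
      define w where "w z = (deriv h z + \<epsilon> * deriv g z) / deriv G z - 1" for z
      have holw: "w holomorphic_on ball 0 1"
        unfolding w_def by (intro holomorphic_intros holomorphic_deriv hg GA) (use nz in auto)
      have w1: "cmod (w z) < 1" if "cmod z < 1" for z
      proof -
        have "cmod (w z) \<le> cmod (deriv h z / deriv G z - 1) + cmod (\<epsilon> * (deriv g z / deriv G z))"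
          unfolding w_def using norm_triangle_ineq[of "deriv h z / deriv G z - 1" "\<epsilon> * (deriv g z / deriv G z)"]
          by (simp add: add_divide_distrib algebra_simps)
        then show ?thesis using le[OF that] \<epsilon> by (simp add: norm_mult norm_divide)
      qed
      have w0: "w 0 = 0" by (simp add: w_def hg GA)
      have n1: "1 + w z \<noteq> 0" using w1[OF z1] by (metis add_eq_0_iff2 less_irrefl norm_minus_cancel norm_one)
      have eq: "deriv h v + \<epsilon> * deriv g v = deriv G v * (1 + w v)" if "cmod v < 1" for v
        using nz[OF that] by (simp add: w_def)
      have "((\<lambda>v. deriv h v + \<epsilon> * deriv g v) has_field_derivative
               deriv (deriv h) z + \<epsilon> * deriv (deriv g) z) (at z)"
        using z1 hg by (intro DERIV_add DERIV_cmult holomorphic_derivI[where S="ball 0 1"] holomorphic_deriv) auto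
      moreover have "((\<lambda>v. deriv h v + \<epsilon> * deriv g v) has_field_derivative
               deriv (deriv G) z * (1 + w z) + (0 + deriv w z) * deriv G z) (at z)"
      proof (rule has_field_derivative_transform_within_open[where S="ball 0 1"])
        show "((\<lambda>v. deriv G v * (1 + w v)) has_field_derivative
            deriv (deriv G) z * (1 + w z) + (0 + deriv w z) * deriv G z) (at z)"
          using z1 GA holw by (intro DERIV_mult DERIV_add DERIV_const holomorphic_derivI[where S="ball 0 1"] holomorphic_deriv) auto
      qed (use z1 eq in auto)
      moreover have alg: "1 + z * (a2 * B + W * a) / (a * B) = (1 + z * a2 / a) + z * W / B"
        if "a \<noteq> 0" "B \<noteq> 0" for a a2 B W :: complex
        using that by (simp add: field_simps)
      ultimately have "deriv (deriv h) z + \<epsilon> * deriv (deriv g) z = deriv (deriv G) z * (1 + w z) + deriv w z * deriv G z"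
        using DERIV_unique by fastforce
      then have "1 + z * (deriv (deriv h) z + \<epsilon> * deriv (deriv g) z) / (deriv h z + \<epsilon> * deriv g z) =
           (1 + z * deriv (deriv G) z / deriv G z) + z * deriv w z / (1 + w z)"
        unfolding eq[OF z1] using alg nz[OF z1] n1 by simp
      moreover have "cmod z / (1 - cmod z) < Re (1 + z * deriv (deriv G) z / deriv G z)"
        by (rule lower[OF G nz]) (use z \<rho> in auto)
      ultimately show ?thesis
        using Re_Schwarz_log_deriv_ge[OF holw w1 w0 z1] by simp
    qed
    show ?thesis
      using harmonic_inj_convex_image[of h \<rho> g f, OF _ _ _ jac pos] hg \<rho> R
        holomorphic_on_subset[OF _ sub] by auto
  qed
  then show "R \<in> {r. 0 < r \<and> r \<le> 1 \<and> (\<forall>\<rho>. 0 < \<rho> \<and> \<rho> \<le> r \<longrightarrow>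
        (\<forall>f \<in> \<Union>G\<in>\<G>. F_H0 G. inj_on f (ball 0 \<rho>) \<and> convex (f ` ball 0 \<rho>)))}"
    using R by auto
next
  fix r assume "r \<in> {r. 0 < r \<and> r \<le> 1 \<and> (\<forall>\<rho>. 0 < \<rho> \<and> \<rho> \<le> r \<longrightarrow>
        (\<forall>f \<in> \<Union>G\<in>\<G>. F_H0 G. inj_on f (ball 0 \<rho>) \<and> convex (f ` ball 0 \<rho>)))}"
  then have r: "0 < r" "r \<le> 1"
    and conv: "\<And>G f. G \<in> \<G> \<Longrightarrow> f \<in> F_H0 G \<Longrightarrow> inj_on f (ball 0 r) \<and> convex (f ` ball 0 r)"
    by auto
  show "r \<le> R"
  proof (rule ccontr)
    assume "\<not> r \<le> R"
    then obtain G z where G: "G \<in> \<G>" and z: "cmod z < r"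
      and nz: "\<And>w. cmod w < 1 \<Longrightarrow> deriv G w \<noteq> 0"
      and less: "Re (1 + z * deriv (deriv G) z / deriv G z) < cmod z / (1 - cmod z)"
      using upper[of r] r by auto
    have GA: "G holomorphic_on ball 0 1" "deriv G 0 = 1"
      using A G by (auto simp: class_A_def)
    have z1: "cmod z < 1" using z r by simp
    \<comment> \<open>At 0 the inequality \<open>less\<close> would say 1 < 0.\<close>
    have z0: "z \<noteq> 0" using less by auto
    define \<kappa> where "\<kappa> = of_real (cmod z) / z"
    have \<kappa>: "cmod \<kappa> = 1" "z * \<kappa> = of_real (cmod z)" using z0 by (auto simp: \<kappa>_def norm_divide)
    have "(\<lambda>v. deriv G v * (1 - \<kappa> * v)) holomorphic_on ball 0 1"
      by (intro holomorphic_intros holomorphic_deriv GA) auto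
    from primitive_in_class_A[OF this] GA(2)
    obtain h where hA: "h \<in> class_A" and dh: "\<And>v. cmod v < 1 \<Longrightarrow> deriv h v = deriv G v * (1 - \<kappa> * v)"
      by auto
    have holh: "h holomorphic_on ball 0 1" using hA by (simp add: class_A_def)
    have "h \<in> F_H0 G"
      unfolding F_H0_def harmonic_decomp_def
    proof (intro CollectI exI conjI)
      show "\<forall>v\<in>ball 0 1. h v = h v + cnj ((\<lambda>_. 0) v)" by simp
      show "\<forall>v\<in>ball 0 1. cmod (deriv h v / deriv G v - 1) < 1 - cmod (deriv (\<lambda>_. 0) v / deriv G v)"
        using nz \<kappa>(1) by (auto simp: dh norm_mult)
    qed (use hA in \<open>auto simp: class_A_def\<close>)
    then have ic: "inj_on h (ball 0 r)" "convex (h ` ball 0 r)" using conv[OF G] by auto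
    have "h holomorphic_on ball 0 r"
      using holh r by (auto intro: holomorphic_on_subset)
    from Study_convex_ball[OF this ic z]
    have ge: "Re (1 + z * deriv (deriv h) z / deriv h z) \<ge> 0" .
    have "(deriv h has_field_derivative deriv (deriv G) z * (1 - \<kappa> * z) + (0 - \<kappa> * 1) * deriv G z) (at z)"
    proof (rule has_field_derivative_transform_within_open[where S="ball 0 1"])
      show "((\<lambda>v. deriv G v * (1 - \<kappa> * v)) has_field_derivative
            deriv (deriv G) z * (1 - \<kappa> * z) + (0 - \<kappa> * 1) * deriv G z) (at z)"
        using z1 GA by (intro DERIV_mult DERIV_diff DERIV_const DERIV_cmult DERIV_ident holomorphic_derivI[where S="ball 0 1"] holomorphic_deriv) auto
    qed (use z1 dh in auto)
    then have ddh: "deriv (deriv h) z = deriv (deriv G) z * (1 - \<kappa> * z) - \<kappa> * deriv G z"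
      by (simp add: DERIV_imp_deriv)
    have kz: "1 - \<kappa> * z = of_real (1 - cmod z)" using \<kappa>(2) by (simp add: mult.commute)
    have kz0: "1 - \<kappa> * z \<noteq> 0" unfolding kz using z1 by (simp del: of_real_diff)
    \<comment> \<open>The factor 1 - \<kappa> v contributes exactly -|z|/(1 - |z|) at
      \<open>z\<close>, the extreme value in \<open>Re_Schwarz_log_deriv_ge\<close>.\<close>
    have "z * deriv (deriv h) z / deriv h z = z * deriv (deriv G) z / deriv G z - z * \<kappa> / (1 - \<kappa> * z)"
      unfolding ddh dh[OF z1] using nz[OF z1] kz0 by (simp add: field_simps)
    also have "z * \<kappa> / (1 - \<kappa> * z) = of_real (cmod z / (1 - cmod z))"
      unfolding \<kappa>(2) kz by simp
    finally have "Re (z * deriv (deriv h) z / deriv h z) = Re (z * deriv (deriv G) z / deriv G z) - cmod z / (1 - cmod z)"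
      by simp
    then show False using ge less by simp
  qed
qed

section \<open>Convex functions and functions with derivative of positive real part\<close>

lemma deriv2_eqI:
  assumes 1: "\<And>z. cmod z < 1 \<Longrightarrow> (G has_field_derivative G1 z) (at z)"
    and 2: "\<And>z. cmod z < 1 \<Longrightarrow> (G1 has_field_derivative G2 z) (at z)"
    and z: "cmod z < 1"
  shows "deriv G z = G1 z" "deriv (deriv G) z = G2 z"
proof -
  have dG: "deriv G w = G1 w" if "cmod w < 1" for w
    using 1[OF that] by (rule DERIV_imp_deriv)
  show "deriv G z = G1 z" using dG z .
  have "(deriv G has_field_derivative G2 z) (at z)"
    by (rule has_field_derivative_transform_within_open[OF 2[OF z], where S="ball 0 1"]) (use z dG in auto)
  then show "deriv (deriv G) z = G2 z" by (rule DERIV_imp_deriv)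
qed

text \<open>Brings the threshold to the denominator 1 - x^2 of the distortion bounds. At x = 1 both
  sides are 0 by the convention for division.\<close>

lemma divide_one_minus_eq:
  fixes x :: real
  assumes "0 \<le> x"
  shows "x / (1 - x) = x * (1 + x) / (1 - x\<^sup>2)"
proof -
  have "1 - x\<^sup>2 = (1 - x) * (1 + x)" by (simp add: power2_eq_square algebra_simps)
  then show ?thesis using assms by simp
qed

lemma one_minus_fractions:
  fixes a b R :: real
  assumes "R \<noteq> 0"
  shows "1 - a / R - b / R = (R - a - b) / R"
  using assms by (simp add: field_simps)

text \<open>By Study's criterion 1 + z G''/G' has nonnegative real part and value 1 at 0, so Harnack
  bounds it below by (1 - r)/(1 + r). The half-plane map z/(1 - z) attains this at -r, and (1 - r)^2
  = r(1 + r) means 3r = 1.\<close>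

lemma radius_convexity_class_K: "radius_convexity (\<Union>G\<in>class_K. F_H0 G) = 1/3"
proof (rule radius_convexity_F_H0_eqI)
  show "class_K \<subseteq> class_A" by (auto simp: class_K_def class_S_def)
next
  fix G z assume G: "G \<in> class_K" and nz: "\<And>w. cmod w < 1 \<Longrightarrow> deriv G w \<noteq> 0" and z: "cmod z < 1/3"
  have hol: "G holomorphic_on ball 0 1" and inj: "inj_on G (ball 0 1)" and conv: "convex (G ` ball 0 1)"
    using G by (auto simp: class_K_def class_S_def class_A_def)
  have "Re (1 + z * deriv (deriv G) z / deriv G z) \<ge> (1 - cmod z) / (1 + cmod z)"
  proof (rule nonneg_real_part_ge[of "\<lambda>z. 1 + z * deriv (deriv G) z / deriv G z"])
    show "(\<lambda>z. 1 + z * deriv (deriv G) z / deriv G z) holomorphic_on ball 0 1"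
      by (intro holomorphic_intros holomorphic_deriv hol) (use nz in auto)
    show "Re (1 + w * deriv (deriv G) w / deriv G w) \<ge> 0" if "cmod w < 1" for w
      by (rule Study_convex_unit_disk[OF hol inj conv that])
  qed (use z in auto)
  moreover have "cmod z / (1 - cmod z) < (1 - cmod z) / (1 + cmod z)"
    using z norm_ge_zero[of z] by (simp add: divide_simps algebra_simps del: norm_ge_zero)
  ultimately show "cmod z / (1 - cmod z) < Re (1 + z * deriv (deriv G) z / deriv G z)" by linarith
next
  fix r :: real assume r: "1/3 < r" "r \<le> 1"
  obtain x where x: "1/3 < x" "x < r" using dense r by blast
  define G :: "complex \<Rightarrow> complex" where "G = (\<lambda>z. z / (1 - z))"
  have nz: "1 - z \<noteq> 0" if "cmod z < 1" for z :: complex using that by auto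
  have d1: "(G has_field_derivative 1 / (1 - z)\<^sup>2) (at z)" if "cmod z < 1" for z
    unfolding G_def using nz[OF that] by (auto intro!: derivative_eq_intros simp: power2_eq_square field_simps)
  have d2: "((\<lambda>z. 1 / (1 - z)\<^sup>2) has_field_derivative 2 / (1 - z) ^ 3) (at z)" if "cmod z < 1" for z :: complex
  proof -
    have "((\<lambda>z. 1 / (1 - z)\<^sup>2) has_field_derivative 2 * (1 - z) / ((1 - z)\<^sup>2 * (1 - z)\<^sup>2)) (at z)"
      using nz[OF that] by (auto intro!: derivative_eq_intros)
    moreover have "2 * u / (u\<^sup>2 * u\<^sup>2) = 2 / u ^ 3" if "u \<noteq> 0" for u :: complex
      using that by (simp add: eval_nat_numeral)
    ultimately show ?thesis using nz[OF that] by metis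
  qed
  have dG: "deriv G z = 1 / (1 - z)\<^sup>2" "deriv (deriv G) z = 2 / (1 - z) ^ 3" if "cmod z < 1" for z
    using deriv2_eqI[of G "\<lambda>z. 1 / (1 - z)\<^sup>2" "\<lambda>z. 2 / (1 - z) ^ 3" z] d1 d2 that by blast+
  \<comment> \<open>Membership in \<open>class_K\<close> needs convexity of the image; 2w + 1 = (1 +
    z)/(1 - z) identifies it as a half-plane.\<close>
  have img: "G ` ball 0 1 = {w. Re w > -1/2}"
  proof (intro subset_antisym subsetI)
    fix w assume "w \<in> G ` ball 0 1"
    then obtain z where z: "cmod z < 1" "w = z / (1 - z)" by (auto simp: G_def)
    have "2 * w + 1 = (1 + z) / (1 - z)" using nz[of z] z(1) unfolding z(2) by (simp add: field_simps)
    moreover have "Re ((1 + z) / (1 - z)) > 0"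
    proof -
      have "(cmod z)\<^sup>2 < 1" using z by (simp add: power_less_one_iff abs_square_less_1)
      then have "Re ((1 + z) * cnj (1 - z)) > 0" unfolding cmod_power2 by (simp add: algebra_simps power2_eq_square)
      then show ?thesis using nz[of z] z by (simp add: Re_complex_div_gt_0)
    qed
    ultimately have "Re (2 * w + 1) > 0" by simp
    then show "w \<in> {w. Re w > -1/2}" by simp
  next
    fix w assume "w \<in> {w. Re w > -1/2}"
    then have w: "Re w > -1/2" by simp
    have "(cmod w)\<^sup>2 < (cmod (1 + w))\<^sup>2"
      unfolding cmod_power2 using w by (simp add: power2_eq_square algebra_simps)
    then have lt: "cmod w < cmod (1 + w)" by (rule power2_less_imp_less) auto
    then have n: "1 + w \<noteq> 0" by auto
    have "G (w / (1 + w)) = w" using n by (simp add: G_def field_simps)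
    moreover have "w / (1 + w) \<in> ball 0 1" using lt n by (simp add: norm_divide)
    ultimately show "w \<in> G ` ball 0 1" by (metis imageI)
  qed
  have "G \<in> class_A"
  proof -
    have "G holomorphic_on ball 0 1"
      unfolding holomorphic_on_open[OF open_ball] using d1 by (metis mem_ball_0)
    then show ?thesis using dG(1)[of 0] by (simp add: class_A_def G_def)
  qed
  moreover have "inj_on G (ball 0 1)"
    by (rule inj_onI) (use nz in \<open>auto simp: G_def field_simps\<close>)
  moreover have "convex (G ` ball 0 1)" unfolding img by (rule convex_halfspace_Re_gt)
  ultimately have "G \<in> class_K" by (simp add: class_K_def class_S_def)
  moreover have "cmod (- of_real x) < r" using x by simp
  moreover have "\<forall>w. cmod w < 1 \<longrightarrow> deriv G w \<noteq> 0" using dG(1) nz by auto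
  moreover have "Re (1 + (- of_real x) * deriv (deriv G) (- of_real x) / deriv G (- of_real x)) < cmod (- of_real x) / (1 - cmod (- of_real x))"
  proof -
    have xn: "cmod (- of_real x) < 1" using x r by simp
    have "(- of_real x) * deriv (deriv G) (- of_real x) / deriv G (- of_real x) = of_real (- 2 * x / (1 + x))"
    proof -
      have "(- of_real x) * (2 / u ^ 3) / (1 / u\<^sup>2) = - 2 * of_real x / u" if "u \<noteq> 0" for u :: complex
        using that by (simp add: eval_nat_numeral)
      from this[OF nz[OF xn]] show ?thesis unfolding dG(1)[OF xn] dG(2)[OF xn] by simp
    qed
    then have "Re (1 + (- of_real x) * deriv (deriv G) (- of_real x) / deriv G (- of_real x)) = 1 - 2 * x / (1 + x)"
      by (simp only: plus_complex.sel Re_complex_of_real one_complex.sel)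
    also have "\<dots> < x / (1 - x)"
      using x r by (simp add: divide_simps algebra_simps)
    finally show ?thesis using x by simp
  qed
  ultimately show "\<exists>G\<in>class_K. \<exists>z. cmod z < r \<and> (\<forall>w. cmod w < 1 \<longrightarrow> deriv G w \<noteq> 0) \<and>
        Re (1 + z * deriv (deriv G) z / deriv G z) < cmod z / (1 - cmod z)" by blast
qed auto

text \<open>The bound |G''|(1 - r^2) \<le> 2 Re G' \<le> 2|G'| gives |z G''/G'| \<le> 2r/(1 - r^2).
  Both inequalities are equalities at -r for G' = (1 + z)/(1 - z), which is positive there. The
  radius is the positive root of 2r^2 + 3r - 1.\<close>

lemma radius_convexity_class_R: "radius_convexity (\<Union>G\<in>class_R. F_H0 G) = (sqrt 17 - 3) / 4"
proof (rule radius_convexity_F_H0_eqI)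
  have "3 < sqrt 17" by (rule real_less_rsqrt) auto
  moreover have "sqrt 17 < 5" by (rule real_less_lsqrt) auto
  ultimately show b: "0 < (sqrt 17 - 3) / 4" "(sqrt 17 - 3) / 4 < 1" by auto
  show "class_R \<subseteq> class_A" by (auto simp: class_R_def)
  fix G z assume G: "G \<in> class_R" and nz: "\<And>w. cmod w < 1 \<Longrightarrow> deriv G w \<noteq> 0" and z: "cmod z < (sqrt 17 - 3) / 4"
  have z1: "cmod z < 1" using z b by simp
  define r where "r = cmod z"
  have r: "0 \<le> r" "r < 1" using z1 by (auto simp: r_def)
  have r2: "1 - r\<^sup>2 > 0" using r by (simp add: power_less_one_iff abs_square_less_1)
  have hol: "deriv G holomorphic_on ball 0 1"
    using G by (auto simp: class_R_def class_A_def intro: holomorphic_deriv)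
  have "cmod (deriv (deriv G) z) * (1 - r\<^sup>2) \<le> 2 * Re (deriv G z)"
    unfolding r_def by (rule positive_real_part_deriv_le[OF hol _ z1]) (use G in \<open>auto simp: class_R_def\<close>)
  also have "\<dots> \<le> 2 * cmod (deriv G z)" using complex_Re_le_cmod by simp
  finally have "cmod (deriv (deriv G) z) \<le> 2 / (1 - r\<^sup>2) * cmod (deriv G z)"
    using r2 by (simp add: field_simps)
  then have "r * cmod (deriv (deriv G) z) \<le> r * (2 / (1 - r\<^sup>2) * cmod (deriv G z))"
    using r by (intro mult_left_mono) auto
  then have "cmod (z * deriv (deriv G) z / deriv G z) \<le> 2 * r / (1 - r\<^sup>2)"
    using nz[OF z1] by (simp add: norm_mult norm_divide r_def[symmetric] divide_le_eq mult_ac)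
  then have "Re (1 + z * deriv (deriv G) z / deriv G z) \<ge> 1 - 2 * r / (1 - r\<^sup>2)"
    using abs_Re_le_cmod[of "z * deriv (deriv G) z / deriv G z"] by simp
  moreover have "r / (1 - r) < 1 - 2 * r / (1 - r\<^sup>2)"
  proof -
    have "4 * r + 3 < sqrt 17" using z by (simp add: r_def)
    then have "(4 * r + 3)\<^sup>2 < (sqrt 17)\<^sup>2" using r by (intro power_strict_mono) auto
    then have p: "2 * r\<^sup>2 + 3 * r - 1 < 0" by (simp add: power2_eq_square algebra_simps)
    have "1 - 2 * r / (1 - r\<^sup>2) - r / (1 - r) = (1 - 3 * r - 2 * r\<^sup>2) / (1 - r\<^sup>2)"
    proof -
      have "1 - 2 * r / (1 - r\<^sup>2) - r * (1 + r) / (1 - r\<^sup>2) = ((1 - r\<^sup>2) - 2 * r - r * (1 + r)) / (1 - r\<^sup>2)"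
        using r2 one_minus_fractions[of "1 - r\<^sup>2"] by simp
      also have "(1 - r\<^sup>2) - 2 * r - r * (1 + r) = 1 - 3 * r - 2 * r\<^sup>2"
        by (simp add: algebra_simps power2_eq_square)
      finally show ?thesis using divide_one_minus_eq[of r] r by simp
    qed
    also have "\<dots> > 0" using p r2 by simp
    finally show ?thesis by simp
  qed
  ultimately show "cmod z / (1 - cmod z) < Re (1 + z * deriv (deriv G) z / deriv G z)" by (simp add: r_def)
next
  fix r :: real assume r: "(sqrt 17 - 3) / 4 < r" "r \<le> 1"
  obtain x where x: "(sqrt 17 - 3) / 4 < x" "x < r" using dense r by blast
  have "3 < sqrt 17" by (rule real_less_rsqrt) auto
  with x r have x1: "0 < x" "x < 1" by auto
  define q :: "complex \<Rightarrow> complex" where "q = (\<lambda>z. (1 + z) / (1 - z))"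
  have nz: "1 - z \<noteq> 0" "1 + z \<noteq> 0" if "cmod z < 1" for z :: complex 
    using that by (auto, metis add_eq_0_iff2 less_irrefl norm_minus_cancel norm_one)
  have "q holomorphic_on ball 0 1"
    unfolding q_def by (intro holomorphic_intros) (use nz in auto)
  then obtain G where G: "G \<in> class_A" "\<And>z. cmod z < 1 \<Longrightarrow> deriv G z = q z"
    using primitive_in_class_A[of q] by (auto simp: q_def)
  have d1: "(G has_field_derivative q z) (at z)" if "cmod z < 1" for z
    using G that holomorphic_derivI[of G "ball 0 1" z] by (auto simp: class_A_def)
  have d2: "(q has_field_derivative 2 / (1 - z)\<^sup>2) (at z)" if "cmod z < 1" for z
    unfolding q_def using nz[OF that] by (auto intro!: derivative_eq_intros simp: power2_eq_square field_simps)
  have dG: "deriv G z = q z" "deriv (deriv G) z = 2 / (1 - z)\<^sup>2" if "cmod z < 1" for z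
    using deriv2_eqI[of G "\<lambda>z. q z" "\<lambda>z. 2 / (1 - z)\<^sup>2" z] d1 d2 that by blast+
  have "Re (q z) > 0" if z: "cmod z < 1" for z
  proof -
    have "(cmod z)\<^sup>2 < 1" using z by (simp add: power_less_one_iff abs_square_less_1)
    then have "Re ((1 + z) * cnj (1 - z)) > 0" unfolding cmod_power2 by (simp add: algebra_simps power2_eq_square)
    then show ?thesis using nz[of z] z by (simp add: q_def Re_complex_div_gt_0)
  qed
  then have "G \<in> class_R" using G by (simp add: class_R_def)
  moreover have "cmod (- of_real x) < r" using x x1 by simp
  moreover have "\<forall>w. cmod w < 1 \<longrightarrow> deriv G w \<noteq> 0" using G(2) nz by (auto simp: q_def)
  moreover have "Re (1 + (- of_real x) * deriv (deriv G) (- of_real x) / deriv G (- of_real x)) < cmod (- of_real x) / (1 - cmod (- of_real x))"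
  proof -
    have xn: "cmod (- of_real x) < 1" using x1 by simp
    have x2: "1 - x\<^sup>2 > 0" using x1 by (simp add: power_less_one_iff abs_square_less_1)
    have "(- of_real x) * deriv (deriv G) (- of_real x) / deriv G (- of_real x) = of_real (- 2 * x / (1 - x\<^sup>2))"
    proof -
      have "(- of_real x) * (2 / b\<^sup>2) / (a / b) = - 2 * of_real x / (a * b)" if "a \<noteq> 0" "b \<noteq> 0" for a b :: complex
        using that by (simp add: power2_eq_square mult.commute)
      from this[OF nz(2,1)[OF xn]] show ?thesis unfolding dG(1)[OF xn] dG(2)[OF xn]
        by (simp add: q_def power2_eq_square algebra_simps)
    qed
    then have "Re (1 + (- of_real x) * deriv (deriv G) (- of_real x) / deriv G (- of_real x)) = 1 - 2 * x / (1 - x\<^sup>2)"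
      by (simp only: plus_complex.sel Re_complex_of_real one_complex.sel)
    also have "\<dots> < x / (1 - x)"
    proof -
      have "sqrt 17 < 4 * x + 3" using x by simp
      then have "(sqrt 17)\<^sup>2 < (4 * x + 3)\<^sup>2" by (intro power_strict_mono) auto
      then have p: "2 * x\<^sup>2 + 3 * x - 1 > 0" by (simp add: power2_eq_square algebra_simps)
      have "1 - 2 * x / (1 - x\<^sup>2) - x / (1 - x) = (1 - 3 * x - 2 * x\<^sup>2) / (1 - x\<^sup>2)"
      proof -
        have "1 - 2 * x / (1 - x\<^sup>2) - x * (1 + x) / (1 - x\<^sup>2) = ((1 - x\<^sup>2) - 2 * x - x * (1 + x)) / (1 - x\<^sup>2)"
          using x2 one_minus_fractions[of "1 - x\<^sup>2"] by simp
        also have "(1 - x\<^sup>2) - 2 * x - x * (1 + x) = 1 - 3 * x - 2 * x\<^sup>2"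
          by (simp add: algebra_simps power2_eq_square)
        finally show ?thesis using divide_one_minus_eq[of x] x1 by simp
      qed
      also have "\<dots> < 0" using p x2 by (simp add: divide_less_0_iff)
      finally show ?thesis by simp
    qed
    finally show ?thesis using x1 by simp
  qed
  ultimately show "\<exists>G\<in>class_R. \<exists>z. cmod z < r \<and> (\<forall>w. cmod w < 1 \<longrightarrow> deriv G w \<noteq> 0) \<and>
        Re (1 + z * deriv (deriv G) z / deriv G z) < cmod z / (1 - cmod z)" by blast
qed

section \<open>Functions with derivative in the half-plane to the right of 1/2\<close>

text \<open>Its sign compares (2 + r + r^2)^2 with 8(1 - r^2), hence r/(1 - r) with the lower bound
  2 sqrt(2/(1 - r^2)) - 2/(1 - r^2).\<close>

definition halfplane_quartic :: "real \<Rightarrow> real" where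
  "halfplane_quartic r = r^4 + 2*r^3 + 13*r^2 + 4*r - 4"

text \<open>Monotonicity turns the position of a radius relative to the root into the sign of the
  quartic.\<close>

lemma halfplane_quartic_less: "0 \<le> x \<Longrightarrow> x < y \<Longrightarrow> halfplane_quartic x < halfplane_quartic y"
  using power_strict_mono[of x y 4] power_strict_mono[of x y 3] power_strict_mono[of x y 2]
  by (simp add: halfplane_quartic_def)

lemma halfplane_quartic_eq:
  "halfplane_quartic r = (2 + r + r\<^sup>2)\<^sup>2 - 8 * (1 - r\<^sup>2)"
  by (simp add: halfplane_quartic_def eval_nat_numeral algebra_simps)

text \<open>The lower bound for z G''/G' comes from minimising over a modulus, so sharpness needs a
  derivative that takes the minimising modulus at the given point and turns every inequality used
  into an equality. Such a derivative 1/(1 - z \<psi>(z)), with \<psi> a disk automorphism, exists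
  at points x > 1/3, and the root lies in that range.\<close>

lemma radius_convexity_half_plane:
  assumes r0: "0 < r0" "halfplane_quartic r0 = 0"
  shows "radius_convexity (\<Union>G \<in> {G \<in> class_A. \<forall>z \<in> unit_disk. Re (deriv G z) > 1/2}. F_H0 G) = r0"
proof (rule radius_convexity_F_H0_eqI)
  have "halfplane_quartic 1 > 0" "halfplane_quartic (1/3) < 0"
    by (simp_all add: halfplane_quartic_def power_divide)
  then have b: "1/3 < r0" "r0 < 1"
    using halfplane_quartic_less[of r0 "1/3"] halfplane_quartic_less[of 1 r0] r0 
    by (smt (verit))+
  then show "r0 < 1" by simp
  fix G z assume "G \<in> {G \<in> class_A. \<forall>z \<in> unit_disk. Re (deriv G z) > 1/2}" and z: "cmod z < r0"
  then have G: "G \<in> class_A" "\<And>z. cmod z < 1 \<Longrightarrow> Re (deriv G z) > 1/2" by auto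
  have z1: "cmod z < 1" using z b by simp
  define r where "r = cmod z"
  have r: "0 \<le> r" "r < 1" using z1 by (auto simp: r_def)
  define R where "R = 1 - r\<^sup>2"
  have R: "R > 0" using r by (simp add: R_def power_less_one_iff abs_square_less_1)
  have "deriv G holomorphic_on ball 0 1"
    using G by (auto simp: class_A_def intro: holomorphic_deriv)
  from Re_half_log_deriv_ge[OF this G(2) _ z1]
  have ge: "Re (z * deriv (deriv G) z / deriv G z) \<ge> 2 * sqrt (2 / R) - 2 / R - 1"
    using G(1) by (simp add: class_A_def R_def r_def)
  have "halfplane_quartic r < 0"
    using halfplane_quartic_less[of r r0] z r r0 by (simp add: r_def)
  then have lt: "(2 + r + r\<^sup>2)\<^sup>2 < 8 * R" by (simp add: halfplane_quartic_eq R_def)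
  have "((2 + r + r\<^sup>2) / (2 * R))\<^sup>2 < 2 / R"
    using lt R by (simp add: power_divide power_mult_distrib divide_less_eq) (simp add: field_simps power2_eq_square)
  then have "(2 + r + r\<^sup>2) / (2 * R) < sqrt (2 / R)" by (rule real_less_rsqrt)
  moreover have "r / (1 - r) + 2 / R = 2 * ((2 + r + r\<^sup>2) / (2 * R))"
  proof -
    have "r / (1 - r) + 2 / R = (r * (1 + r) + 2) / R"
      using divide_one_minus_eq[of r] r by (simp add: R_def add_divide_distrib)
    also have "r * (1 + r) + 2 = 2 + r + r\<^sup>2" by (simp add: power2_eq_square algebra_simps)
    also have "t / R = 2 * (t / (2 * R))" for t by simp
    finally show ?thesis .
  qed
  ultimately show "cmod z / (1 - cmod z) < Re (1 + z * deriv (deriv G) z / deriv G z)"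
    unfolding r_def[symmetric] using ge
    by (simp only: plus_complex.sel one_complex.sel)
next
  fix r :: real assume r: "r0 < r" "r \<le> 1"
  obtain x where x: "r0 < x" "x < r" using dense r by blast
  have "halfplane_quartic (1/3) < 0"
    by (simp add: halfplane_quartic_def power_divide)
  then have "1/3 < r0" using halfplane_quartic_less[of r0 "1/3"] r0 by (smt (verit))
  then have x1: "1/3 < x" "x < 1" using x r by auto
  define R where "R = 1 - x\<^sup>2"
  have Rx: "R = (1 - x) * (1 + x)" by (simp add: R_def power2_eq_square algebra_simps)
  have R: "R > 0" using x1 by (simp add: Rx)
  have gt: "(2 + x + x\<^sup>2)\<^sup>2 > 8 * R"
    using halfplane_quartic_less[of r0 x] r0 x by (simp add: halfplane_quartic_eq R_def)
  \<comment> \<open>\<open>1 / y\<close> is the minimiser in \<open>Re_half_log_deriv_ge\<close>; \<open>v\<close> makes it the value of the extremal derivative at \<open>x\<close>\<close>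
  define y where "y = sqrt (2 * R)"
  have y2: "y\<^sup>2 = 2 * R" using R by (simp add: y_def)
  have y: "y > 0" using R by (simp add: y_def)
  have yl: "1 - x < y" 
  proof -
    have "(1 - x) * (1 - x) < (1 - x) * (2 * (1 + x))" using x1 by (intro mult_strict_left_mono) auto
    then have "(1 - x) * (1 - x) < 2 * ((1 - x) * (1 + x))" by (simp only: mult.left_commute[of "1 - x" 2])
    then show ?thesis unfolding y_def Rx by (intro real_less_rsqrt) (simp add: power2_eq_square)
  qed
  \<comment> \<open>Equivalent to x > 1/3, the reason for evaluating the quartic at 1/3. Together
    with \<open>yl\<close> it gives |v| < 1.\<close>
  have yu: "y < 1 + x"
  proof -
    have "(2 * (1 - x)) * (1 + x) < (1 + x) * (1 + x)" using x1 by (intro mult_strict_right_mono) auto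
    then show ?thesis unfolding y_def Rx using x1 by (intro real_less_lsqrt) (auto simp: power2_eq_square)
  qed
  define v where "v = (1 - y) / x"
  have vx: "v * x = 1 - y" using x1 by (simp add: v_def)
  have v: "-1 < v" "v < 1" using yl yu x1 by (auto simp: v_def field_simps)
  have n: "1 + v * x > 0" using yu x1 vx by simp
  \<comment> \<open>Solves (c - x)/(1 - c x) = v, so that the automorphism \<psi> defined below
    takes the value \<open>v\<close> at \<open>x\<close>.\<close>
  define c where "c = (v + x) / (1 + v * x)"
  have c: "-1 < c" "c < 1"
  proof -
    have "0 < (1 - v) * (1 - x)" "0 < (1 + v) * (1 + x)" using v x1 by (auto intro!: mult_pos_pos)
    then show "-1 < c" "c < 1" using n by (simp_all add: c_def field_simps)
  qed
  have "1 - c\<^sup>2 = ((1 + v * x)\<^sup>2 - (v + x)\<^sup>2) / (1 + v * x)\<^sup>2"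
    using n by (simp add: c_def power_divide diff_divide_distrib)
  also have "(1 + v * x)\<^sup>2 - (v + x)\<^sup>2 = (1 - v\<^sup>2) * R"
    by (simp add: R_def power2_eq_square algebra_simps)
  finally have cx3: "1 - c\<^sup>2 = (1 - v\<^sup>2) * R / (1 + v * x)\<^sup>2" .
  have cx: "1 - c * x = R / (1 + v * x)" "c - x = v * (R / (1 + v * x))"
    using n by (simp_all add: c_def R_def field_simps power2_eq_square)
  have cn: "cmod (of_real c) < 1" using c by simp
  \<comment> \<open>For an automorphism Schwarz-Pick is an equality; the minus sign makes its
    derivative negative at \<open>x\<close>, the direction that lowers Re(z q'/q).\<close>
  define \<psi> where "\<psi> = (\<lambda>z. - Moebius_function 0 (of_real c) z)"
  define q where "q = (\<lambda>z. 1 / (1 - z * \<psi> z))"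
  have \<psi>1: "cmod (\<psi> z) < 1" if "cmod z < 1" for z
    using Moebius_function_norm_lt_1[OF cn that] by (simp add: \<psi>_def)
  have hol\<psi>: "\<psi> holomorphic_on ball 0 1"
    unfolding \<psi>_def by (intro holomorphic_intros Moebius_function_holomorphic[OF cn])
  have \<omega>1: "cmod (z * \<psi> z) < 1" if "cmod z < 1" for z
    using \<psi>1[OF that] that norm_mult_less[of z 1 "\<psi> z" 1] by simp
  have nz: "1 - z * \<psi> z \<noteq> 0" if "cmod z < 1" for z using \<omega>1[OF that] by auto
  have holq: "q holomorphic_on ball 0 1"
    unfolding q_def by (intro holomorphic_intros hol\<psi>) (use nz in auto)
  obtain G where G: "G \<in> class_A" "\<And>z. cmod z < 1 \<Longrightarrow> deriv G z = q z"
    using primitive_in_class_A[OF holq] by (auto simp: q_def)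
  have "Re (q z) > 1/2" if z: "cmod z < 1" for z
  proof -
    define w where "w = z * \<psi> z"
    have w: "cmod w < 1" "1 - w \<noteq> 0" using \<omega>1[OF z] nz[OF z] by (auto simp: w_def)
    have "(cmod w)\<^sup>2 < 1" using w by (simp add: power_less_one_iff abs_square_less_1)
    then have lt: "(cmod (1 - w))\<^sup>2 < 2 * (1 - Re w)"
      unfolding cmod_power2 by (simp add: power2_eq_square algebra_simps)
    have "Re (q z) = (1 - Re w) / (cmod (1 - w))\<^sup>2"
      unfolding q_def w_def[symmetric] cmod_power2 by (simp add: Re_divide)
    then show ?thesis using lt w by (simp add: pos_less_divide_eq)
  qed
  then have "G \<in> {G \<in> class_A. \<forall>z \<in> unit_disk. Re (deriv G z) > 1/2}" using G by simp
  moreover have "cmod (of_real x) < r" using x x1 by simp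
  moreover have "\<forall>w. cmod w < 1 \<longrightarrow> deriv G w \<noteq> 0" using G(2) nz by (auto simp: q_def)
  moreover have "Re (1 + of_real x * deriv (deriv G) (of_real x) / deriv G (of_real x)) < cmod (of_real x) / (1 - cmod (of_real x))"
  proof -
    have xn: "cmod (of_real x) < 1" using x1 by simp
    have \<psi>x: "\<psi> (of_real x) = of_real v"
    proof -
      have "\<psi> (of_real x) = of_real ((c - x) / (1 - c * x))"
        by (simp add: \<psi>_def Moebius_function_simple minus_divide_left)
      also have "(c - x) / (1 - c * x) = v" unfolding cx using R n by simp
      finally show ?thesis .
    qed
    have "(\<psi> has_field_derivative - (of_real (1 - (cmod (of_real c))\<^sup>2) / (1 - cnj (of_real c) * of_real x)\<^sup>2)) (at (of_real x))"
      unfolding \<psi>_def by (intro DERIV_minus has_field_derivative_Moebius_function cn xn)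
    also have "- (of_real (1 - (cmod (of_real c))\<^sup>2) / (1 - cnj (of_real c) * of_real x)\<^sup>2) = complex_of_real (- ((1 - c\<^sup>2) / (1 - c * x)\<^sup>2))"
      by simp
    also have "(1 - c\<^sup>2) / (1 - c * x)\<^sup>2 = (1 - v\<^sup>2) / R"
      unfolding cx cx3 using R n by (simp add: power_divide power2_eq_square)
    finally have d\<psi>: "(\<psi> has_field_derivative of_real (- ((1 - v\<^sup>2) / R))) (at (of_real x))" .
    have nx: "1 - of_real x * \<psi> (of_real x) = complex_of_real y"
      unfolding \<psi>x using vx by (metis diff_diff_eq2 add_diff_cancel_left' mult.commute of_real_1 of_real_diff of_real_mult)
    have dq: "deriv q (of_real x) = of_real ((v - x * ((1 - v\<^sup>2) / R)) / y\<^sup>2)"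
    proof (rule DERIV_imp_deriv)
      have "(q has_field_derivative - (0 - (1 * \<psi> (of_real x) + of_real (- ((1 - v\<^sup>2) / R)) * of_real x)) / (1 - of_real x * \<psi> (of_real x))\<^sup>2) (at (of_real x))"
      proof -
        have "((\<lambda>z. 1 - z * \<psi> z) has_field_derivative 0 - (1 * \<psi> (of_real x) + of_real (- ((1 - v\<^sup>2) / R)) * of_real x)) (at (of_real x))"
          by (intro DERIV_diff DERIV_const DERIV_mult DERIV_ident d\<psi>)
        note D = DERIV_inverse'[OF this nz[OF xn]]
        have "- (inverse B * d * inverse B) = - d / B\<^sup>2" for B d :: complex
          by (simp add: divide_inverse power2_eq_square mult_ac)
        then show ?thesis using D unfolding q_def by (simp only: inverse_eq_divide)
      qed
      then show "(q has_field_derivative of_real ((v - x * ((1 - v\<^sup>2) / R)) / y\<^sup>2)) (at (of_real x))"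
        unfolding nx unfolding \<psi>x by (simp add: mult_ac)
    qed
    have "deriv (deriv G) (of_real x) = deriv q (of_real x)"
    proof (rule DERIV_imp_deriv)
      have "(q has_field_derivative deriv q (of_real x)) (at (of_real x))"
        using holq xn by (auto intro: holomorphic_derivI)
      then show "(deriv G has_field_derivative deriv q (of_real x)) (at (of_real x))"
        by (rule has_field_derivative_transform_within_open[where S="ball 0 1"]) (use xn G(2) in auto)
    qed
    moreover have "deriv G (of_real x) = 1 / of_real y"
      unfolding G(2)[OF xn] q_def nx ..
    ultimately have "of_real x * deriv (deriv G) (of_real x) / deriv G (of_real x) = complex_of_real (x * ((v - x * ((1 - v\<^sup>2) / R)) / y\<^sup>2) * y)"
      using dq y by simp
    also have "x * ((v - x * ((1 - v\<^sup>2) / R)) / y\<^sup>2) * y = (v * x - (x\<^sup>2 - (v * x)\<^sup>2) / R) / y"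
      using y R by (simp add: field_simps power2_eq_square)
    also have "\<dots> = (1 - y - (x\<^sup>2 - (1 - y)\<^sup>2) / R) / y" unfolding vx ..
    also have "x\<^sup>2 - (1 - y)\<^sup>2 = 2 * y - y\<^sup>2 - R" by (simp add: R_def power2_eq_square algebra_simps)
    also have "(1 - y - (2 * y - y\<^sup>2 - R) / R) / y = 2 * y / R - 2 / R - 1"
    proof -
      have "(2 * y - y\<^sup>2 - R) / R = 2 * y / R - 2 - 1" unfolding y2 using R by (simp add: diff_divide_distrib)
      moreover have "4 / y = 2 * y / R" using y R y2 by (simp add: field_simps power2_eq_square)
      ultimately show ?thesis using y R by (simp add: field_simps)
    qed
    finally have "Re (1 + of_real x * deriv (deriv G) (of_real x) / deriv G (of_real x)) = 2 * y / R - 2 / R"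
      by (simp only: plus_complex.sel Re_complex_of_real one_complex.sel)
    also have "\<dots> < x / (1 - x)"
    proof -
      have "2 * y < 2 + x + x\<^sup>2"
      proof (rule power2_less_imp_less)
        show "(2 * y)\<^sup>2 < (2 + x + x\<^sup>2)\<^sup>2" using gt y2 by (simp add: power_mult_distrib)
      qed (use x1 in auto)
      then have "2 * y / R < (2 + x + x\<^sup>2) / R" using R by (simp add: divide_strict_right_mono)
      also have "\<dots> = 2 / R + x * (1 + x) / R" by (simp add: add_divide_distrib distrib_left power2_eq_square)
      also have "x * (1 + x) / R = x / (1 - x)" using divide_one_minus_eq[of x] x1 by (simp add: R_def)
      finally show ?thesis by simp
    qed
    finally show ?thesis using x1 by simp
  qed
  ultimately show "\<exists>G\<in>{G \<in> class_A. \<forall>z \<in> unit_disk. Re (deriv G z) > 1/2}. \<exists>z. cmod z < r \<and> (\<forall>w. cmod w < 1 \<longrightarrow> deriv G w \<noteq> 0) \<and>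
        Re (1 + z * deriv (deriv G) z / deriv G z) < cmod z / (1 - cmod z)" by blast
qed (use r0 in auto)

section \<open>The area theorem\<close>

text \<open>The Jacobian formula is applied on \<open>real^2\<close>, while iterated integrals live
  on pairs. The coordinate map carries boxes to boxes of equal content, so the integrals
  agree.\<close>

lemma integral_cbox_real2:
  fixes f :: "real^2 \<Rightarrow> real"
  assumes "continuous_on (cbox a b) f"
  shows "integral (cbox a b) f =
    integral {a$1..b$1} (\<lambda>s. integral {a$2..b$2} (\<lambda>t. f (vector [s, t])))"
proof -
  let ?g = "\<lambda>p::real\<times>real. vector [fst p, snd p] :: real^2"
  let ?h = "\<lambda>x::real^2. (x$1, x$2)"
  have gimg': "?g ` cbox (u1, u2) (v1, v2) = cbox (?g (u1, u2)) (?g (v1, v2))" for u1 u2 v1 v2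
  proof (intro subset_antisym subsetI)
    fix x assume "x \<in> cbox (?g (u1, u2)) (?g (v1, v2))"
    then have "(x$1, x$2) \<in> cbox (u1, u2) (v1, v2)"
      by (auto simp: mem_box_cart forall_2 cbox_Pair_eq)
    moreover have "x = ?g (x$1, x$2)" by (simp add: vec_eq_iff forall_2)
    ultimately show "x \<in> ?g ` cbox (u1, u2) (v1, v2)" by blast
  qed (auto simp: mem_box_cart forall_2 cbox_Pair_eq)
  have gimg: "?g ` cbox u v = cbox (?g u) (?g v)" for u v
    using gimg'[of "fst u" "snd u" "fst v" "snd v"] by (simp only: prod.collapse)
  have himg: "?h ` cbox u v = cbox (?h u) (?h v)" for u v
  proof (intro subset_antisym subsetI)
    fix x assume "x \<in> cbox (?h u) (?h v)"
    then have "?g x \<in> cbox u v"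
      by (cases x) (auto simp: mem_box_cart forall_2 cbox_Pair_eq)
    moreover have "x = ?h (?g x)" by simp
    ultimately show "x \<in> ?h ` cbox u v" by blast
  qed (auto simp: mem_box_cart forall_2 cbox_Pair_eq)
  have ex2: "(\<exists>i::2. P i) = (P 1 \<or> P 2)" for P
    using forall_2[of "\<lambda>i. \<not> P i"] by blast
  have cont: "measure lborel (?g ` cbox u v) = 1 * measure lborel (cbox u v)" for u v
  proof -
    have "measure lborel (cbox u v) = measure lborel (cbox (fst u) (fst v)) * measure lborel (cbox (snd u) (snd v))"
      using content_Pair[of "fst u" "snd u" "fst v" "snd v"] by simp
    also have "\<dots> = measure lborel (cbox (?g u) (?g v))"
      unfolding content_cbox_if_cart by (simp add: interval_eq_empty_cart ex2 prod_2 UNIV_2 forall_2 not_less)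
    finally show ?thesis unfolding gimg by simp
  qed
  have contg: "continuous (at x) ?g" for x
  proof -
    have "linear ?g" by (rule linearI) (simp_all add: vec_eq_iff forall_2)
    then show ?thesis by (simp add: linear_continuous_at linear_conv_bounded_linear)
  qed
  have "(f has_integral integral (cbox a b) f) (cbox a b)"
    using assms integrable_continuous by blast
  then have "((\<lambda>x. f (?g x)) has_integral (1 / 1) *\<^sub>R integral (cbox a b) f) (?h ` cbox a b)"
    by (rule has_integral_twiddle[of 1 ?h ?g, rotated -1])
       (use cont contg gimg himg in \<open>auto simp: vec_eq_iff forall_2\<close>)
  then have "integral (cbox a b) f = integral (cbox (?h a) (?h b)) (\<lambda>x. f (?g x))"
    unfolding himg by (simp add: integral_unique)
  also have "\<dots> = integral (cbox (a$1) (b$1)) (\<lambda>s. integral (cbox (a$2) (b$2)) (\<lambda>t. f (?g (s, t))))"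
  proof (rule integral_prod_continuous)
    have "continuous_on (cbox (?h a) (?h b)) (f \<circ> ?g)"
      by (rule continuous_on_compose)
        (use contg assms gimg[of "?h a" "?h b"] in \<open>auto simp: vec_eq_iff forall_2 intro!: continuous_at_imp_continuous_on elim!: continuous_on_subset\<close>,
         auto simp: mem_box_cart forall_2)
    then show "continuous_on (cbox (?h a) (?h b)) (\<lambda>x. f (?g x))" by (simp add: o_def)
  qed
  finally show ?thesis by simp
qed

text \<open>Cauchy's formula at the centre, where dz/z equals i dt.\<close>

lemma has_integral_circle_mean:
  assumes hol: "V holomorphic_on ball 0 1" and r: "0 < r" "r < 1"
  shows "((\<lambda>t. V (of_real r * cis t)) has_integral 2 * of_real pi * V 0) {0..2*pi}"
proof -
  have gen: "A / (R * c) * R * \<iota> * c / \<iota> = A" if "R \<noteq> 0" "c \<noteq> 0" "\<iota> \<noteq> 0" for A R c \<iota> :: complex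
    using that by simp
  have "V holomorphic_on cball 0 r" using hol r by (auto intro: holomorphic_on_subset)
  from Cauchy_integral_circlepath_simple[OF this, of 0] r
  have "((\<lambda>u. V u / u) has_contour_integral 2 * of_real pi * \<i> * V 0) (part_circlepath 0 r 0 (2 * pi))"
    by (simp add: circlepath_def)
  then have "((\<lambda>t. V (of_real r * cis t) / (of_real r * cis t) * r * \<i> * cis t) has_integral 2 * of_real pi * \<i> * V 0) {0..2*pi}"
    by (subst (asm) has_contour_integral_part_circlepath_iff) auto
  then have "((\<lambda>t. V (of_real r * cis t) / (of_real r * cis t) * r * \<i> * cis t / \<i>) has_integral 2 * of_real pi * \<i> * V 0 / \<i>) {0..2*pi}"
    by (rule has_integral_divide)
  moreover have "V (of_real r * cis t) / (of_real r * cis t) * r * \<i> * cis t / \<i> = V (of_real r * cis t)" for t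
    by (rule gen) (use r in auto)
  moreover have "a * \<iota> * c / \<iota> = a * c" if "\<iota> \<noteq> 0" for a c \<iota> :: complex
    using that by simp
  then have "2 * of_real pi * \<i> * V 0 / \<i> = 2 * of_real pi * V 0"
    using complex_i_not_zero by blast
  ultimately show ?thesis by (simp only:)
qed

text \<open>
  The set of all $v$ with $v = 0$ or $|T(1/v)| > M$ is starshaped and does not meet $\eta(|z| = \epsilon)$,
  so it lies inside $\eta(|z| < \epsilon)$ and injectivity keeps the points with $|z| > \epsilon$ out of it.
\<close>

lemma exterior_not_attained:
  fixes \<eta> T :: "complex \<Rightarrow> complex"
  assumes hol: "\<eta> holomorphic_on ball 0 1" and inj: "inj_on \<eta> (ball 0 1)" and \<eta>0: "\<eta> 0 = 0"
    and T: "\<And>c w. T (of_real c * w) = of_real c * T w"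
    and \<epsilon>: "0 < \<epsilon>" "\<epsilon> < 1"
    and contT: "continuous_on UNIV T"
    and M: "\<And>z. cmod z = \<epsilon> \<Longrightarrow> cmod (T (1 / \<eta> z)) \<le> M"
    and z: "\<epsilon> < cmod z" "cmod z < 1"
  shows "cmod (T (1 / \<eta> z)) \<le> M"
proof -
  \<comment> \<open>In the coordinate v = 1/w the point 0 stands for infinity. Real homogeneity of
    \<open>T\<close> makes |T(1/v)| grow as \<open>v\<close> moves towards 0, hence the star
    shape.\<close>
  define D where "D = insert 0 {v. v \<noteq> 0 \<and> M < cmod (T (1 / v))}"
  have nz: "\<eta> w \<noteq> 0" if "w \<noteq> 0" "cmod w < 1" for w
    using inj_onD[OF inj, of w 0] that \<eta>0 by auto
  have "starlike D"
    unfolding starlike_def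
  proof (intro bexI ballI subsetI)
    fix v y assume v: "v \<in> D" "y \<in> closed_segment 0 v"
    then obtain u where u: "0 \<le> u" "u \<le> 1" "y = of_real u * v"
      by (auto simp: closed_segment_def scaleR_conv_of_real)
    show "y \<in> D"
    proof (cases "y = 0")
      case False
      then have n: "v \<noteq> 0" "u > 0" using u by auto
      have "T (1 / v) = T (of_real u * (1 / y))" using n u by simp
      also have "\<dots> = of_real u * T (1 / y)" by (rule T)
      finally have "cmod (T (1 / v)) = u * cmod (T (1 / y))" using u by (simp add: norm_mult)
      also have "\<dots> \<le> cmod (T (1 / y))" using u by (simp add: mult_left_le_one_le)
      finally show ?thesis using v n False by (auto simp: D_def)
    qed (simp add: D_def)
  qed (simp add: D_def)
  then have conn: "connected D" by (rule starlike_imp_connected)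
  have sub: "ball 0 \<epsilon> \<subseteq> ball (0::complex) 1" "cball 0 \<epsilon> \<subseteq> ball (0::complex) 1" using \<epsilon> by auto
  have cont: "continuous_on (ball 0 1) \<eta>" using hol by (rule holomorphic_on_imp_continuous_on)
  have op: "open (\<eta> ` ball 0 \<epsilon>)"
    by (rule invariance_of_domain) (use sub cont inj in \<open>auto intro: continuous_on_subset inj_on_subset\<close>)
  have "compact (\<eta> ` cball 0 \<epsilon>)"
    by (intro compact_continuous_image continuous_on_subset[OF cont sub(2)]) auto
  then have cl: "closed (\<eta> ` cball 0 \<epsilon>)" by (rule compact_imp_closed)
  \<comment> \<open>The open and the closed disk have the same trace on \<open>D\<close>; that trace
    is therefore both open and closed in a connected set.\<close>
  have eq: "D \<inter> \<eta> ` ball 0 \<epsilon> = D \<inter> \<eta> ` cball 0 \<epsilon>"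
  proof (intro subset_antisym subsetI)
    fix v assume "v \<in> D \<inter> \<eta> ` cball 0 \<epsilon>"
    then obtain w where w: "v \<in> D" "v = \<eta> w" "cmod w \<le> \<epsilon>" by auto
    have "cmod w \<noteq> \<epsilon>"
    proof
      assume "cmod w = \<epsilon>"
      then have "\<eta> w \<noteq> 0" using nz[of w] \<epsilon> by auto
      then show False using w M[OF \<open>cmod w = \<epsilon>\<close>] by (simp add: D_def)
    qed
    then show "v \<in> D \<inter> \<eta> ` ball 0 \<epsilon>" using w by auto
  qed auto
  have "openin (top_of_set D) (D \<inter> \<eta> ` ball 0 \<epsilon>)" using op by (rule openin_open_Int)
  moreover have "closedin (top_of_set D) (D \<inter> \<eta> ` ball 0 \<epsilon>)"
    unfolding eq using cl by (rule closedin_closed_Int)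
  moreover have "0 \<in> D \<inter> \<eta> ` ball 0 \<epsilon>" using \<epsilon> \<eta>0 by (auto simp: D_def image_iff intro!: bexI[of _ 0])
  ultimately have "D \<inter> \<eta> ` ball 0 \<epsilon> = D"
    using conn[unfolded connected_clopen, rule_format, of "D \<inter> \<eta> ` ball 0 \<epsilon>"] by (metis empty_iff)
  then have Dsub: "D \<subseteq> \<eta> ` ball 0 \<epsilon>" by (metis inf.cobounded2)
  show ?thesis
  proof (rule ccontr)
    assume "\<not> ?thesis"
    moreover have "z \<noteq> 0" using z \<epsilon> by auto
    then have "\<eta> z \<noteq> 0" using nz z(2) by blast
    ultimately have "\<eta> z \<in> D" by (simp add: D_def)
    then obtain w where w: "cmod w < \<epsilon>" "\<eta> z = \<eta> w" using Dsub by auto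
    then have "z = w" using inj_onD[OF inj, of z w] z \<epsilon> by simp
    then show False using w z by simp
  qed
qed

section \<open>Area of the image of an annulus\<close>

definition real2_of_complex :: "complex \<Rightarrow> real^2" where
  "real2_of_complex w = vector [Re w, Im w]"

definition complex_of_real2 :: "real^2 \<Rightarrow> complex" where
  "complex_of_real2 x = Complex (x$1) (x$2)"

lemma complex_of_real2_of_complex [simp]: "complex_of_real2 (real2_of_complex w) = w"
  by (simp add: real2_of_complex_def complex_of_real2_def)

lemma bounded_linear_real2_of_complex: "bounded_linear real2_of_complex"
  by (intro linear_conv_bounded_linear[THEN iffD1] linearI)
    (simp_all add: real2_of_complex_def vec_eq_iff forall_2)

lemma bounded_linear_complex_of_real2: "bounded_linear complex_of_real2"
  by (intro linear_conv_bounded_linear[THEN iffD1] linearI)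
    (simp_all add: complex_of_real2_def complex_eq_iff)

lemma norm_real2_of_complex: "norm (real2_of_complex w) = cmod w"
  by (simp add: real2_of_complex_def norm_vec_def L2_set_def sum_2 cmod_def)

text \<open>Multiplication by \<open>q\<close> has Jacobian |q|^2, and w \<mapsto> w - \<beta> cnj w
  has Jacobian 1 - |\<beta>|^2.\<close>

lemma det_conformal_twist:
  "det (matrix (\<lambda>y. real2_of_complex (q * complex_of_real2 y - \<beta> * cnj (q * complex_of_real2 y))))
    = (cmod q)\<^sup>2 * (1 - (cmod \<beta>)\<^sup>2)"
  unfolding cmod_power2
  by (simp add: det_2 matrix_def real2_of_complex_def complex_of_real2_def axis_def)
     (simp add: algebra_simps power2_eq_square)

text \<open>Change of variables for \<Psi> followed by w \<mapsto> w - \<beta> cnj w: the image of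
  the open rectangle lies in a disk of radius \<open>M\<close>. In the application \<Psi> is
  precomposed with exp, which turns an annulus cut along a radius into this rectangle.\<close>

lemma area_image_le:
  fixes \<Psi> :: "complex \<Rightarrow> complex"
  assumes der: "\<And>\<zeta>. Re \<zeta> \<in> {a..b} \<Longrightarrow> (\<Psi> has_field_derivative \<Psi>' \<zeta>) (at \<zeta>)"
    and cont: "continuous_on {\<zeta>. Re \<zeta> \<in> {a..b}} \<Psi>'"
    and inj: "inj_on (\<lambda>\<zeta>. \<Psi> \<zeta> - \<beta> * cnj (\<Psi> \<zeta>)) {\<zeta>. Re \<zeta> \<in> {a<..<b} \<and> Im \<zeta> \<in> {0<..<2*pi}}"
    and \<beta>: "cmod \<beta> \<le> 1"
    and M: "\<And>\<zeta>. Re \<zeta> \<in> {a<..<b} \<Longrightarrow> cmod (\<Psi> \<zeta> - \<beta> * cnj (\<Psi> \<zeta>)) \<le> M"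
    and ab: "a < b"
  shows "(1 - (cmod \<beta>)\<^sup>2) * integral {a..b} (\<lambda>s. integral {0..2*pi} (\<lambda>t. (cmod (\<Psi>' (Complex s t)))\<^sup>2)) \<le> pi * M\<^sup>2"
proof -
  define A :: "real^2" where "A = vector [a, 0]"
  define B :: "real^2" where "B = vector [b, 2*pi]"
  define F where "F x = real2_of_complex (\<Psi> (complex_of_real2 x) - \<beta> * cnj (\<Psi> (complex_of_real2 x)))" for x
  define F' where "F' x y = real2_of_complex (\<Psi>' (complex_of_real2 x) * complex_of_real2 y - \<beta> * cnj (\<Psi>' (complex_of_real2 x) * complex_of_real2 y))" for x y
  have in_box: "x \<in> box A B \<longleftrightarrow> Re (complex_of_real2 x) \<in> {a<..<b} \<and> Im (complex_of_real2 x) \<in> {0<..<2*pi}" for x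
    by (auto simp: mem_box_cart forall_2 A_def B_def complex_of_real2_def)
  have in_cbox: "x \<in> cbox A B \<longleftrightarrow> Re (complex_of_real2 x) \<in> {a..b} \<and> Im (complex_of_real2 x) \<in> {0..2*pi}" for x
    by (auto simp: mem_box_cart forall_2 A_def B_def complex_of_real2_def)
  have F_der: "(F has_derivative F' x) (at x within box A B)" if "x \<in> box A B" for x
  proof -
    have "(\<Psi> has_derivative (\<lambda>h. \<Psi>' (complex_of_real2 x) * h)) (at (complex_of_real2 x))"
      using der[of "complex_of_real2 x"] that in_box by (auto simp: has_field_derivative_def)
    from has_derivative_compose[OF bounded_linear.has_derivative[OF bounded_linear_complex_of_real2 has_derivative_ident] this]
    have D: "((\<lambda>x. \<Psi> (complex_of_real2 x)) has_derivative (\<lambda>y. \<Psi>' (complex_of_real2 x) * complex_of_real2 y)) (at x within box A B)" .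
    have "((\<lambda>x. \<Psi> (complex_of_real2 x) - \<beta> * cnj (\<Psi> (complex_of_real2 x))) has_derivative
       (\<lambda>y. \<Psi>' (complex_of_real2 x) * complex_of_real2 y - \<beta> * cnj (\<Psi>' (complex_of_real2 x) * complex_of_real2 y))) (at x within box A B)"
      by (intro has_derivative_diff D has_derivative_mult_right bounded_linear.has_derivative[OF bounded_linear_cnj D])
    from bounded_linear.has_derivative[OF bounded_linear_real2_of_complex this]
    show ?thesis unfolding F_def F'_def .
  qed
  have injF: "inj_on F (box A B)"
  proof (rule inj_onI)
    fix x y assume xy: "x \<in> box A B" "y \<in> box A B" "F x = F y"
    then have "complex_of_real2 (F x) = complex_of_real2 (F y)" by simp
    then have "\<Psi> (complex_of_real2 x) - \<beta> * cnj (\<Psi> (complex_of_real2 x)) =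
        \<Psi> (complex_of_real2 y) - \<beta> * cnj (\<Psi> (complex_of_real2 y))"
      by (simp only: F_def complex_of_real2_of_complex)
    from inj_onD[OF inj this] have "complex_of_real2 x = complex_of_real2 y"
      using xy(1,2) unfolding in_box by simp
    then show "x = y" by (simp add: complex_of_real2_def vec_eq_iff forall_2)
  qed
  have nn: "1 - (cmod \<beta>)\<^sup>2 \<ge> 0" using \<beta> by (simp add: power_le_one)
  define J where "J x = (1 - (cmod \<beta>)\<^sup>2) * (cmod (\<Psi>' (complex_of_real2 x)))\<^sup>2" for x
  have J: "\<bar>det (matrix (F' x))\<bar> = J x" for x
    unfolding F'_def det_conformal_twist J_def using nn by (simp add: mult.commute)
  have contJ: "continuous_on (cbox A B) J"
  proof -
    have "continuous_on (cbox A B) (\<lambda>x. \<Psi>' (complex_of_real2 x))"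
      by (rule continuous_on_compose2[OF cont])
        (use in_cbox in \<open>auto intro: linear_continuous_on[OF bounded_linear_complex_of_real2]\<close>)
    then show ?thesis unfolding J_def by (intro continuous_intros)
  qed
  have intJ: "J integrable_on cbox A B" using contJ by (rule integrable_continuous)
  then have intJ': "J integrable_on box A B" by (simp add: integrable_on_open_interval)
  have "measure lebesgue (F ` box A B) = integral (box A B) (\<lambda>x. \<bar>det (matrix (F' x))\<bar>)"
    by (rule measure_differentiable_image_eq[OF _ F_der injF]) (use intJ' J in auto)
  also have "\<dots> = integral (cbox A B) J" by (simp add: J integral_open_interval)
  finally have m1: "measure lebesgue (F ` box A B) = integral (cbox A B) J" .
  have meas: "F ` box A B \<in> lmeasurable"
    using measurable_differentiable_image_eq[OF _ F_der injF] intJ' J by auto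
  have "F ` box A B \<subseteq> cball 0 M"
    using M in_box by (auto simp: F_def norm_real2_of_complex)
  then have "measure lebesgue (F ` box A B) \<le> measure lebesgue (cball (0::real^2) M)"
    by (intro measure_mono_fmeasurable) (use meas fmeasurableD in auto)
  also have "\<dots> = pi * M\<^sup>2"
  proof -
    \<comment> \<open>Any point of the strip serves here; it only shows M \<ge> 0.\<close>
    have "Re (of_real ((a + b) / 2)) \<in> {a<..<b}" using ab by simp
    from order_trans[OF norm_ge_zero M[OF this]] have "0 \<le> M" .
    then show ?thesis by (simp add: content_cball unit_ball_vol_2)
  qed
  finally have "integral (cbox A B) J \<le> pi * M\<^sup>2" using m1 by simp
  also have "integral (cbox A B) J = integral {a..b} (\<lambda>s. integral {0..2*pi} (\<lambda>t. J (vector [s, t])))"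
    unfolding integral_cbox_real2[OF contJ] by (simp add: A_def B_def)
  finally show ?thesis by (simp add: J_def complex_of_real2_def)
qed

text \<open>
  On $|z| = r$ the integrand is at least $1/r^2 + |b|^2r^2 + \mathrm{Re}\,W(z)$ with $W$ holomorphic and
  $W(0) = 0$.
\<close>

lemma circle_integral_cmod_square_ge:
  assumes hol: "m holomorphic_on ball 0 1" and r: "0 < r" "r < 1"
  shows "2 * pi * (1 / r\<^sup>2 + (cmod b)\<^sup>2 * r\<^sup>2) \<le>
    integral {0..2*pi} (\<lambda>t. (cmod (- 1 / (of_real r * cis t) + b * (of_real r * cis t) + (of_real r * cis t)\<^sup>2 * m (of_real r * cis t)))\<^sup>2)"
proof -
  \<comment> \<open>Write u = -1/z + b z and v = z^2 m(z). Then \<open>W\<close> collects the cross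
    term of |u|^2 and 2 v cnj u, made holomorphic by cnj z = r^2/z on the circle; |v|^2 is
    dropped.\<close>
  define W where "W z = - 2 * z ^ 3 * m z / of_real (r\<^sup>2) + 2 * cnj b * of_real (r\<^sup>2) * z * m z - 2 * b * z\<^sup>2 / of_real (r\<^sup>2)" for z
  define X where "X z = - 1 / z + b * z + z\<^sup>2 * m z" for z
  have "W holomorphic_on ball 0 1"
    unfolding W_def using r by (intro holomorphic_intros hol) auto
  from has_integral_circle_mean[OF this r]
  have "((\<lambda>t. W (of_real r * cis t)) has_integral 0) {0..2*pi}" by (simp add: W_def)
  from has_integral_linear[OF this bounded_linear_Re]
  have W0: "((\<lambda>t. Re (W (of_real r * cis t))) has_integral 0) {0..2*pi}" by (simp add: o_def)
  have "((\<lambda>t. (1 / r\<^sup>2 + (cmod b)\<^sup>2 * r\<^sup>2) + Re (W (of_real r * cis t))) has_integral (2 * pi - 0) *\<^sub>R (1 / r\<^sup>2 + (cmod b)\<^sup>2 * r\<^sup>2) + 0) {0..2*pi}"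
  proof (rule has_integral_add[OF _ W0])
    show "((\<lambda>t. c) has_integral (2 * pi - 0) *\<^sub>R c) {0..2*pi}" for c :: real
      using has_integral_const_real[of c 0 "2*pi"] by simp
  qed
  then have lower: "((\<lambda>t. (1 / r\<^sup>2 + (cmod b)\<^sup>2 * r\<^sup>2) + Re (W (of_real r * cis t))) has_integral 2 * pi * (1 / r\<^sup>2 + (cmod b)\<^sup>2 * r\<^sup>2)) {0..2*pi}"
    by simp
  have pw: "(1 / r\<^sup>2 + (cmod b)\<^sup>2 * r\<^sup>2) + Re (W z) \<le> (cmod (X z))\<^sup>2" if z: "cmod z = r" for z
  proof -
    define u where "u = - 1 / z + b * z"
    define v where "v = z\<^sup>2 * m z"
    have z0: "z \<noteq> 0" using z r by auto
    have zz: "z * cnj z = of_real (r\<^sup>2)" using z complex_norm_square[of z] by simp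
    then have ci: "cnj (1 / z) = z / of_real (r\<^sup>2)" using z0 r by (simp add: field_simps)
    have u2: "(cmod u)\<^sup>2 = 1 / r\<^sup>2 + (cmod b)\<^sup>2 * r\<^sup>2 - 2 * Re (b * z\<^sup>2 / of_real (r\<^sup>2))"
    proof -
      have "(cmod (p + q))\<^sup>2 = (cmod p)\<^sup>2 + (cmod q)\<^sup>2 + 2 * Re (q * cnj p)" for p q
        unfolding cmod_power2 by (simp add: power2_eq_square algebra_simps)
      note this[of "- (1 / z)" "b * z"]
      moreover have "b * z * cnj (- (1 / z)) = - (b * z\<^sup>2 / of_real (r\<^sup>2))"
        unfolding complex_cnj_minus ci by (simp add: power2_eq_square)
      moreover have "- (1 / z) + b * z = u" by (simp add: u_def)
      moreover have "(cmod (- (1 / z)))\<^sup>2 = 1 / r\<^sup>2" "(cmod (b * z))\<^sup>2 = (cmod b)\<^sup>2 * r\<^sup>2"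
        using z by (auto simp: norm_mult norm_divide power_mult_distrib power_divide)
      ultimately have "(cmod u)\<^sup>2 = 1 / r\<^sup>2 + (cmod b)\<^sup>2 * r\<^sup>2 + 2 * Re (- (b * z\<^sup>2 / of_real (r\<^sup>2)))"
        by metis
      then show ?thesis by (simp only: uminus_complex.sel)
    qed
    have uv: "(cmod (u + v))\<^sup>2 \<ge> (cmod u)\<^sup>2 + 2 * Re (v * cnj u)"
    proof -
      have "(cmod (u + v))\<^sup>2 = (cmod u)\<^sup>2 + (cmod v)\<^sup>2 + 2 * Re (v * cnj u)"
        unfolding cmod_power2 by (simp add: power2_eq_square algebra_simps)
      then show ?thesis by simp
    qed
    have cu: "cnj u = - (z / of_real (r\<^sup>2)) + cnj b * cnj z"
      using ci by (simp add: u_def)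
    have vu: "v * cnj u = - (z ^ 3 * m z / of_real (r\<^sup>2)) + cnj b * (z * cnj z) * z * m z"
      unfolding v_def cu by (simp add: power2_eq_square power3_eq_cube algebra_simps)
    have "W z = 2 * (v * cnj u) - 2 * (b * z\<^sup>2 / of_real (r\<^sup>2))"
      unfolding vu zz by (simp add: W_def algebra_simps)
    then have "Re (W z) = 2 * Re (v * cnj u) - 2 * Re (b * z\<^sup>2 / of_real (r\<^sup>2))"
      by simp
    then show ?thesis using uv u2 by (simp add: X_def u_def v_def)
  qed
  have in_ball: "of_real r * cis t \<in> ball 0 1" for t using r by (simp add: norm_mult)
  have "continuous_on {0..2*pi} (\<lambda>t. m (of_real r * cis t))"
    by (rule continuous_on_compose2[OF holomorphic_on_imp_continuous_on[OF hol]])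
      (use in_ball in \<open>auto intro!: continuous_intros simp del: mem_ball_0\<close>)
  then have "continuous_on {0..2*pi} (\<lambda>t. (cmod (X (of_real r * cis t)))\<^sup>2)"
    unfolding X_def using r by (intro continuous_intros) (auto simp: cis_neq_zero)
  then have "(\<lambda>t. (cmod (X (of_real r * cis t)))\<^sup>2) integrable_on {0..2*pi}"
    by (rule integrable_continuous_real)
  from has_integral_le[OF lower integrable_integral[OF this]]
  show ?thesis using pw r by (simp add: X_def norm_mult)
qed

text \<open>Compare areas for the image of \<epsilon> < |z| < \<rho> under 1/z + b z + z^2 k(z), the
  reciprocal of the univalent function, after applying \<open>T\<close>. The bound \<open>M\<close>
  is 1/\<epsilon> + O(\<epsilon>^2), so its square is 1/\<epsilon>^2 + O(\<epsilon>) and the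
  singular terms of the two sides cancel as \<epsilon> tends to 0.\<close>

lemma area_inequality:
  assumes holk: "k holomorphic_on ball 0 1"
    and nz: "\<And>z. cmod z < 1 \<Longrightarrow> 1 + b * z\<^sup>2 + z ^ 3 * k z \<noteq> 0"
    and inj: "inj_on (\<lambda>z. z / (1 + b * z\<^sup>2 + z ^ 3 * k z)) (ball 0 1)"
    and \<epsilon>: "0 < \<epsilon>" "\<epsilon> < \<rho>" "\<rho> < 1" "cmod b * \<epsilon>\<^sup>2 < 1" "\<epsilon> \<le> 1/2"
    and K: "\<And>z. cmod z \<le> 1/2 \<Longrightarrow> cmod (k z) \<le> K"
  shows "(1 - (cmod b * \<epsilon>\<^sup>2)\<^sup>2) * ((1 / \<epsilon>\<^sup>2 - 1 / \<rho>\<^sup>2) + (cmod b)\<^sup>2 * (\<rho>\<^sup>2 - \<epsilon>\<^sup>2)) \<le> 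
    (1 / \<epsilon> + (K + (cmod b)\<^sup>2 + cmod b * K) * \<epsilon>\<^sup>2)\<^sup>2"
proof -
  define H where "H z = 1 + b * z\<^sup>2 + z ^ 3 * k z" for z
  define \<eta> where "\<eta> z = z / H z" for z
  define \<beta> where "\<beta> = b * of_real (\<epsilon>\<^sup>2)"
  have \<beta>: "cmod \<beta> = cmod b * \<epsilon>\<^sup>2" by (simp add: \<beta>_def norm_mult norm_power)
  \<comment> \<open>\<open>T\<close> straightens the ellipse traced by \<open>1 / z + b * z\<close> on \<open>|z| = \<epsilon>\<close> to a circle;
      enclosing the ellipse itself in a disk would only give \<open>|b| \<le> 1 + sqrt 2\<close>.\<close>
  define T where "T w = w - \<beta> * cnj w" for w
  \<comment> \<open>The main term 1/z keeps modulus 1/\<epsilon>, and \<open>T\<close> removes b z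
    exactly, since \<open>\<beta> * cnj (1 / z) = b * z\<close> on |z| = \<epsilon>. The three
    summands of the constant bound what is left: z^2 k and the images of b z and of z^2 k under
    \<beta> cnj.\<close>
  define M where "M = 1 / \<epsilon> + (K + (cmod b)\<^sup>2 + cmod b * K) * \<epsilon>\<^sup>2"
  have K0: "K \<ge> 0" using order_trans[OF norm_ge_zero K[of 0]] by simp
  have \<eta>inv: "1 / \<eta> z = 1 / z + b * z + z\<^sup>2 * k z" if "z \<noteq> 0" for z
    using that by (simp add: \<eta>_def H_def field_simps power2_eq_square power3_eq_cube)
  have hol\<eta>: "\<eta> holomorphic_on ball 0 1"
    unfolding \<eta>_def H_def by (intro holomorphic_intros holk) (use nz in auto)
  have inj\<eta>: "inj_on \<eta> (ball 0 1)" using inj by (simp add: \<eta>_def[abs_def] H_def)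
  have M: "cmod (T (1 / \<eta> z)) \<le> M" if z: "cmod z = \<epsilon>" for z
  proof -
    have z0: "z \<noteq> 0" using z \<epsilon> by auto
    have zz: "z * cnj z = of_real (\<epsilon>\<^sup>2)" using z complex_norm_square[of z] by simp
    have "\<beta> * cnj (1 / z) = b * z" unfolding \<beta>_def zz[symmetric] using z0 by simp
    then have "T (1 / \<eta> z) = 1 / z + z\<^sup>2 * k z - \<beta> * cnj (b * z) - \<beta> * cnj (z\<^sup>2 * k z)"
      unfolding T_def \<eta>inv[OF z0] by (simp add: algebra_simps)
    also have "cmod \<dots> \<le> cmod (1 / z) + cmod (z\<^sup>2 * k z) + cmod (\<beta> * cnj (b * z)) + cmod (\<beta> * cnj (z\<^sup>2 * k z))"
      by (meson norm_triangle_ineq norm_triangle_ineq4 add_mono order_trans order_refl)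
    also have "\<dots> = 1 / \<epsilon> + \<epsilon>\<^sup>2 * (cmod (k z) + (cmod b)\<^sup>2 * \<epsilon> + cmod b * cmod (k z) * \<epsilon>\<^sup>2)"
      using z by (simp add: norm_mult norm_divide norm_power \<beta> power2_eq_square algebra_simps)
    also have "\<dots> \<le> 1 / \<epsilon> + \<epsilon>\<^sup>2 * (K + (cmod b)\<^sup>2 * 1 + cmod b * K * 1)"
      using K[of z] z \<epsilon> K0 by (intro add_mono mult_left_mono mult_mono) (auto simp: power_le_one)
    finally show ?thesis by (simp add: M_def mult_ac)
  qed
  have ext: "cmod (T (1 / \<eta> z)) \<le> M" if "\<epsilon> < cmod z" "cmod z < 1" for z
  proof (rule exterior_not_attained[of \<eta> T \<epsilon> M z])
    show "T (of_real c * w) = of_real c * T w" for c w by (simp add: T_def algebra_simps)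
    show "continuous_on UNIV T" unfolding T_def by (intro continuous_intros)
    show "\<eta> 0 = 0" by (simp add: \<eta>_def)
  qed (use \<epsilon> hol\<eta> inj\<eta> M that in auto)
  \<comment> \<open>With this \<open>m\<close>, the function \<open>X\<close> below is z times the
    derivative of 1/\<eta>, that is, the derivative of \<Psi> in the logarithmic coordinate.\<close>
  define m where "m z = 2 * k z + z * deriv k z" for z
  have holm: "m holomorphic_on ball 0 1"
    unfolding m_def by (intro holomorphic_intros holomorphic_deriv holk) auto
  define X where "X z = - 1 / z + b * z + z\<^sup>2 * m z" for z
  define \<Psi> where "\<Psi> \<zeta> = exp (- \<zeta>) + b * exp \<zeta> + (exp \<zeta>)\<^sup>2 * k (exp \<zeta>)" for \<zeta>
  have \<Psi>\<eta>: "\<Psi> \<zeta> = 1 / \<eta> (exp \<zeta>)" for \<zeta>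
    using \<eta>inv[of "exp \<zeta>"] by (simp add: \<Psi>_def exp_minus inverse_eq_divide)
  define a c where "a = ln \<epsilon>" and "c = ln \<rho>"
  have ac: "a < c" "c < 0" using \<epsilon> by (auto simp: a_def c_def)
  have ea: "exp a = \<epsilon>" "exp c = \<rho>" using \<epsilon> by (auto simp: a_def c_def)
  have ball: "exp \<zeta> \<in> ball 0 1" if "Re \<zeta> \<le> c" for \<zeta> using that ac by simp
  have derk: "(k has_field_derivative deriv k z) (at z)" if "z \<in> ball 0 1" for z
    using holk that by (auto intro: holomorphic_derivI)
  have area: "(1 - (cmod \<beta>)\<^sup>2) * integral {a..c} (\<lambda>s. integral {0..2*pi} (\<lambda>t. (cmod (X (exp (Complex s t))))\<^sup>2)) \<le> pi * M\<^sup>2"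
  proof (rule area_image_le)
    show "(\<Psi> has_field_derivative X (exp \<zeta>)) (at \<zeta>)" if "Re \<zeta> \<in> {a..c}" for \<zeta>
    proof -
      have "exp \<zeta> \<in> ball 0 1" using ball that by simp
      from DERIV_chain2[OF derk[OF this] DERIV_exp]
      have k': "((\<lambda>\<zeta>. k (exp \<zeta>)) has_field_derivative deriv k (exp \<zeta>) * exp \<zeta>) (at \<zeta>)" .
      show ?thesis
        unfolding \<Psi>_def X_def m_def
        by (rule derivative_eq_intros k' refl)+ (simp add: exp_minus inverse_eq_divide power2_eq_square algebra_simps)
    qed
    have "continuous_on {\<zeta>. Re \<zeta> \<in> {a..c}} (\<lambda>\<zeta>. m (exp \<zeta>))"
      by (rule continuous_on_compose2[OF holomorphic_on_imp_continuous_on[OF holm]])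
        (use ball in \<open>auto intro!: continuous_intros simp del: mem_ball_0\<close>)
    then show "continuous_on {\<zeta>. Re \<zeta> \<in> {a..c}} (\<lambda>\<zeta>. X (exp \<zeta>))"
      unfolding X_def by (intro continuous_intros) auto
    show "inj_on (\<lambda>\<zeta>. \<Psi> \<zeta> - \<beta> * cnj (\<Psi> \<zeta>)) {\<zeta>. Re \<zeta> \<in> {a<..<c} \<and> Im \<zeta> \<in> {0<..<2*pi}}"
    proof (rule inj_onI)
      fix x y assume x: "x \<in> {\<zeta>. Re \<zeta> \<in> {a<..<c} \<and> Im \<zeta> \<in> {0<..<2*pi}}"
        and y: "y \<in> {\<zeta>. Re \<zeta> \<in> {a<..<c} \<and> Im \<zeta> \<in> {0<..<2*pi}}"
        and eq: "\<Psi> x - \<beta> * cnj (\<Psi> x) = \<Psi> y - \<beta> * cnj (\<Psi> y)"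
      \<comment> \<open>Since |\<beta>| < 1 the twist is injective; then \<eta> is, and exp is on a
        strip of height below 2 pi.\<close>
      have "\<Psi> x - \<Psi> y = \<beta> * cnj (\<Psi> x - \<Psi> y)" using eq by (simp add: algebra_simps)
      then have "cmod (\<Psi> x - \<Psi> y) = cmod \<beta> * cmod (\<Psi> x - \<Psi> y)" by (metis complex_mod_cnj norm_mult)
      then have "\<Psi> x = \<Psi> y" using \<beta> \<epsilon>(4) by auto
      then have "\<eta> (exp x) = \<eta> (exp y)" unfolding \<Psi>\<eta> by simp
      then have "exp x = exp y" using inj_onD[OF inj\<eta>] ball x y by auto
      moreover have "\<bar>Im x - Im y\<bar> < 2 * pi" using x y by auto
      ultimately show "x = y" by (metis exp_complex_eqI)
    qed
    show "cmod (\<Psi> \<zeta> - \<beta> * cnj (\<Psi> \<zeta>)) \<le> M" if "Re \<zeta> \<in> {a<..<c}" for \<zeta>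
    proof -
      have "\<epsilon> < cmod (exp \<zeta>)" "cmod (exp \<zeta>) < 1"
        using that ac ea(1) by (auto simp: norm_exp_eq_Re)
      from ext[OF this] show ?thesis unfolding \<Psi>\<eta> T_def .
    qed
  qed (use \<beta> \<epsilon> ac in auto)
  have lower: "integral {a..c} (\<lambda>s. integral {0..2*pi} (\<lambda>t. (cmod (X (exp (Complex s t))))\<^sup>2)) \<ge>
      pi * ((1 / \<epsilon>\<^sup>2 - 1 / \<rho>\<^sup>2) + (cmod b)\<^sup>2 * (\<rho>\<^sup>2 - \<epsilon>\<^sup>2))"
  proof -
    \<comment> \<open>The lower bound on the circle of radius exp(s), with antiderivative
      \<open>F\<close> in s; the substitution r = exp(s) supplies the weight dr/r.\<close>
    define f where "f s = 2 * pi * (exp (- 2 * s) + (cmod b)\<^sup>2 * exp (2 * s))" for s :: real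
    define F where "F s = pi * (- exp (- 2 * s) + (cmod b)\<^sup>2 * exp (2 * s))" for s :: real
    have "(F has_vector_derivative f s) (at s within {a..c})" for s
      unfolding has_real_derivative_iff_has_vector_derivative[symmetric] F_def f_def
      by (auto intro!: derivative_eq_intros simp: algebra_simps)
    then have fint: "(f has_integral F c - F a) {a..c}"
      using ac by (intro fundamental_theorem_of_calculus) auto
    have "continuous_on ({a..c} \<times> cbox 0 (2*pi)) (\<lambda>(s, t). (cmod (X (exp (Complex s t))))\<^sup>2)"
    proof -
      have ce: "continuous_on ({a..c} \<times> cbox 0 (2*pi)) (\<lambda>p. exp (Complex (fst p) (snd p)))"
        by (intro continuous_intros)
      have "continuous_on ({a..c} \<times> cbox 0 (2*pi)) (\<lambda>p. m (exp (Complex (fst p) (snd p))))"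
        by (rule continuous_on_compose2[OF holomorphic_on_imp_continuous_on[OF holm] ce])
          (use ac in \<open>auto simp: norm_exp_eq_Re\<close>)
      then have "continuous_on ({a..c} \<times> cbox 0 (2*pi)) (\<lambda>p. (cmod (X (exp (Complex (fst p) (snd p)))))\<^sup>2)"
        unfolding X_def by (intro continuous_intros ce) auto
      then show ?thesis by (simp add: case_prod_unfold)
    qed
    from integral_continuous_on_param[OF this]
    have "(\<lambda>s. integral {0..2*pi} (\<lambda>t. (cmod (X (exp (Complex s t))))\<^sup>2)) integrable_on {a..c}"
      by (intro integrable_continuous_real) simp
    moreover have "f s \<le> integral {0..2*pi} (\<lambda>t. (cmod (X (exp (Complex s t))))\<^sup>2)" if s: "s \<in> {a..c}" for s
    proof -
      have e: "exp (Complex s t) = of_real (exp s) * cis t" for t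
        by (simp add: exp_eq_polar)
      have "f s = 2 * pi * (1 / (exp s)\<^sup>2 + (cmod b)\<^sup>2 * (exp s)\<^sup>2)"
        by (simp add: f_def exp_minus inverse_eq_divide exp_double)
      also have "\<dots> \<le> integral {0..2*pi} (\<lambda>t. (cmod (X (exp (Complex s t))))\<^sup>2)"
        unfolding X_def e by (rule circle_integral_cmod_square_ge[OF holm]) (use s ac in auto)
      finally show ?thesis .
    qed
    ultimately have "F c - F a \<le> integral {a..c} (\<lambda>s. integral {0..2*pi} (\<lambda>t. (cmod (X (exp (Complex s t))))\<^sup>2))"
      using has_integral_le[OF fint integrable_integral] by blast
    also have "F c - F a = pi * ((1 / \<epsilon>\<^sup>2 - 1 / \<rho>\<^sup>2) + (cmod b)\<^sup>2 * (\<rho>\<^sup>2 - \<epsilon>\<^sup>2))"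
    proof -
      have "exp (2 * s) = (exp s)\<^sup>2" "exp (- 2 * s) = 1 / (exp s)\<^sup>2" for s :: real
        by (simp_all add: exp_minus inverse_eq_divide exp_double)
      then show ?thesis by (simp only: F_def ea) (simp add: algebra_simps)
    qed
    finally show ?thesis .
  qed
  have "1 - (cmod \<beta>)\<^sup>2 \<ge> 0" using \<beta> \<epsilon> by (simp add: power_le_one)
  from order_trans[OF mult_left_mono[OF lower this] area]
  have "pi * ((1 - (cmod \<beta>)\<^sup>2) * ((1 / \<epsilon>\<^sup>2 - 1 / \<rho>\<^sup>2) + (cmod b)\<^sup>2 * (\<rho>\<^sup>2 - \<epsilon>\<^sup>2))) \<le> pi * M\<^sup>2"
    by (simp only: mult.left_commute)
  then show ?thesis unfolding \<beta> M_def by (simp only: mult_le_cancel_left_pos pi_gt_zero)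
qed

text \<open>For fixed \<rho>, letting \<epsilon> tend to 0 in \<open>area_inequality\<close> leaves
  |b|^2 \<rho>^2 \<le> 1/\<rho>^2; then \<rho> tends to 1.\<close>

lemma area_theorem:
  assumes holk: "k holomorphic_on ball 0 1"
    and nz: "\<And>z. cmod z < 1 \<Longrightarrow> 1 + b * z\<^sup>2 + z ^ 3 * k z \<noteq> 0"
    and inj: "inj_on (\<lambda>z. z / (1 + b * z\<^sup>2 + z ^ 3 * k z)) (ball 0 1)"
  shows "cmod b \<le> 1"
proof -
  have "compact (k ` cball 0 (1/2))"
    by (intro compact_continuous_image holomorphic_on_imp_continuous_on holomorphic_on_subset[OF holk]) auto
  then have "bounded (k ` cball 0 (1/2))" by (rule compact_imp_bounded)
  then obtain K where "\<forall>x\<in>k ` cball 0 (1/2). cmod x \<le> K"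
    unfolding bounded_iff by blast
  then have K: "\<And>z. cmod z \<le> 1/2 \<Longrightarrow> cmod (k z) \<le> K" by auto
  have B: "cmod b * \<rho>\<^sup>2 \<le> 1" if \<rho>: "0 < \<rho>" "\<rho> < 1" for \<rho>
  proof -
    define B where "B = cmod b"
    define C where "C = K + B\<^sup>2 + B * K"
    let ?f = "\<lambda>\<epsilon>. (1 - (B * \<epsilon>\<^sup>2)\<^sup>2) * ((1 / \<epsilon>\<^sup>2 - 1 / \<rho>\<^sup>2) + B\<^sup>2 * (\<rho>\<^sup>2 - \<epsilon>\<^sup>2)) - (1 / \<epsilon> + C * \<epsilon>\<^sup>2)\<^sup>2"
    \<comment> \<open>The expansion of \<open>?f\<close> after the terms 1/\<epsilon>^2 have
      cancelled; being polynomial in \<epsilon>, it has an evident limit at 0.\<close>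
    let ?g = "\<lambda>\<epsilon>. B\<^sup>2 * \<rho>\<^sup>2 - 1 / \<rho>\<^sup>2 - 2 * B\<^sup>2 * \<epsilon>\<^sup>2 + B\<^sup>2 * \<epsilon>^4 * (1 / \<rho>\<^sup>2)
       - B^4 * \<epsilon>^4 * (\<rho>\<^sup>2 - \<epsilon>\<^sup>2) - 2 * C * \<epsilon> - C\<^sup>2 * \<epsilon>^4"
    have fg: "?f \<epsilon> = ?g \<epsilon>" if "\<epsilon> \<noteq> 0" for \<epsilon>
    proof -
      have "(1 / \<epsilon> + C * \<epsilon>\<^sup>2)\<^sup>2 = 1 / \<epsilon>\<^sup>2 + 2 * C * \<epsilon> + C\<^sup>2 * \<epsilon>^4" "(B * \<epsilon>\<^sup>2)\<^sup>2 * (1 / \<epsilon>\<^sup>2) = B\<^sup>2 * \<epsilon>\<^sup>2"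
        using that by (simp_all add: field_simps eval_nat_numeral)
      moreover have "(1 - v) * ((e - p) + B\<^sup>2 * q) = e - v * e - p + v * p + B\<^sup>2 * q - v * B\<^sup>2 * q" for v e p q
        by (simp add: algebra_simps)
      ultimately show ?thesis
        by (simp add: algebra_simps eval_nat_numeral)
    qed
    have "(?g \<longlongrightarrow> B\<^sup>2 * \<rho>\<^sup>2 - 1 / \<rho>\<^sup>2 - 2 * B\<^sup>2 * 0\<^sup>2 + B\<^sup>2 * 0^4 * (1 / \<rho>\<^sup>2)
       - B^4 * 0^4 * (\<rho>\<^sup>2 - 0\<^sup>2) - 2 * C * 0 - C\<^sup>2 * 0^4) (at_right 0)"
      by (intro tendsto_intros)
    then have lim: "(?g \<longlongrightarrow> B\<^sup>2 * \<rho>\<^sup>2 - 1 / \<rho>\<^sup>2) (at_right 0)" by simp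
    have "((\<lambda>\<epsilon>. B * \<epsilon>\<^sup>2) \<longlongrightarrow> B * 0\<^sup>2) (at_right 0)"
      by (intro tendsto_intros)
    then have ev1: "eventually (\<lambda>\<epsilon>. B * \<epsilon>\<^sup>2 < 1) (at_right 0)"
      by (rule order_tendstoD) simp
    have ev2: "eventually (\<lambda>\<epsilon>. \<epsilon> \<in> {0<..<min \<rho> (1/2)}) (at_right 0)"
      by (rule eventually_at_right_real) (use \<rho> in auto)
    have "eventually (\<lambda>\<epsilon>. ?g \<epsilon> \<le> 0) (at_right 0)"
      using ev1 ev2
    proof eventually_elim
      case (elim \<epsilon>)
      then show ?case
        using area_inequality[OF holk nz inj, of \<epsilon> \<rho> K] K \<rho> fg[of \<epsilon>] by (simp add: B_def C_def)
    qed
    from tendsto_upperbound[OF lim this] have "B\<^sup>2 * \<rho>\<^sup>2 - 1 / \<rho>\<^sup>2 \<le> 0" by simp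
    then have "(B * \<rho>\<^sup>2)\<^sup>2 \<le> 1\<^sup>2" using \<rho> by (simp add: field_simps power2_eq_square)
    then show ?thesis unfolding B_def by (rule power2_le_imp_le) auto
  qed
  have "((\<lambda>\<rho>. cmod b * \<rho>\<^sup>2) \<longlongrightarrow> cmod b * 1\<^sup>2) (at_left 1)"
    by (intro tendsto_intros)
  moreover have "eventually (\<lambda>\<rho>. cmod b * \<rho>\<^sup>2 \<le> 1) (at_left 1)"
    using eventually_at_left_real[of 0 1] B by (auto elim!: eventually_mono)
  ultimately show ?thesis using tendsto_upperbound by fastforce
qed

section \<open>Univalent functions\<close>

text \<open>
  With $E = (G(z)/z)^{-1/2}$ the function $z/E(z^2)$ is the square root transform of $G$, to which the
  area theorem applies.
\<close>

lemma Bieberbach_second_coefficient: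
  assumes G: "G \<in> class_S"
  shows "cmod (deriv (deriv G) 0) \<le> 4"
proof -
  have hol: "G holomorphic_on ball 0 1" and G0: "G 0 = 0" "deriv G 0 = 1" and inj: "inj_on G (ball 0 1)"
    using G by (auto simp: class_S_def class_A_def)
  obtain g where g: "g holomorphic_on ball 0 1" "\<And>z. cmod z < 1 \<Longrightarrow> G z = z * g z" "deriv G 0 = g 0"
    using Schwarz3[OF hol G0(1)] by blast
  have gnz: "g z \<noteq> 0" if "z \<in> ball 0 1" for z
  proof (cases "z = 0")
    case False
    then have "G z \<noteq> G 0" using inj_onD[OF inj, of z 0] that by auto
    then show ?thesis using g(2)[of z] G0 that by auto
  qed (use g G0 in auto)
  obtain L where L: "L holomorphic_on ball 0 1" "\<And>z. z \<in> ball 0 1 \<Longrightarrow> g z = exp (L z)"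
    using contractible_imp_holomorphic_log[OF g(1) _ gnz] by (metis convex_ball convex_imp_contractible)
  \<comment> \<open>Subtracting \<open>L 0\<close>, which may be a nonzero multiple of 2 pi i,
    selects the branch with value 1 at 0.\<close>
  define E where "E z = exp (- (L z - L 0) / 2)" for z
  have holE: "E holomorphic_on ball 0 1" unfolding E_def by (intro holomorphic_intros L) auto
  have E0: "E 0 = 1" by (simp add: E_def)
  have Eg: "(E z)\<^sup>2 * g z = 1" if "cmod z < 1" for z
  proof -
    have "(E z)\<^sup>2 = exp (- (L z - L 0))"
    proof -
      have "2 * (- (L z - L 0) / 2) = - (L z - L 0)" by simp
      then show ?thesis unfolding E_def exp_double[symmetric] by (rule arg_cong)
    qed
    then have "(E z)\<^sup>2 * g z = exp (- (L z - L 0)) * exp (L z)"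
      using L(2)[of z] that by simp
    also have "\<dots> = exp (L 0)" by (simp add: exp_add[symmetric])
    also have "\<dots> = 1" using L(2)[of 0] g(3) G0 by simp
    finally show ?thesis .
  qed
  have "(\<lambda>z. E z - 1) holomorphic_on ball 0 1" by (intro holomorphic_intros holE)
  from Schwarz3[OF this] obtain e1 where e1: "e1 holomorphic_on ball 0 1"
    "\<And>z. cmod z < 1 \<Longrightarrow> E z - 1 = z * e1 z" "deriv (\<lambda>z. E z - 1) 0 = e1 0"
    by (auto simp: E0)
  have "(\<lambda>z. e1 z - e1 0) holomorphic_on ball 0 1" by (intro holomorphic_intros e1)
  from Schwarz3[OF this] obtain e2 where e2: "e2 holomorphic_on ball 0 1"
    "\<And>z. cmod z < 1 \<Longrightarrow> e1 z - e1 0 = z * e2 z"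
    by auto
  define b where "b = e1 0"
  \<comment> \<open>Dividing out z twice gives E(z) = 1 + b z + z^2 e2(z). At z^2 the remainder is
    z^4 e2(z^2), and the extra factor z moves into \<open>k\<close> to match the form of
    \<open>area_theorem\<close>.\<close>
  define k where "k z = z * e2 (z\<^sup>2)" for z
  have sq: "cmod (z\<^sup>2) < 1" if "cmod z < 1" for z :: complex
    using that by (simp add: norm_power power_less_one_iff abs_square_less_1)
  have H: "1 + b * z\<^sup>2 + z ^ 3 * k z = E (z\<^sup>2)" if "cmod z < 1" for z
  proof -
    have "E (z\<^sup>2) = 1 + z\<^sup>2 * (b + z\<^sup>2 * e2 (z\<^sup>2))"
      using e1(2)[OF sq[OF that]] e2(2)[OF sq[OF that]] by (simp add: b_def algebra_simps)
    then show ?thesis by (simp add: k_def algebra_simps power2_eq_square power3_eq_cube)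
  qed
  have "cmod b \<le> 1"
  proof (rule area_theorem[of k b])
    have "(e2 \<circ> (\<lambda>z. z\<^sup>2)) holomorphic_on ball 0 1"
      by (rule holomorphic_on_compose_gen[OF _ e2(1)]) (use sq in \<open>auto intro!: holomorphic_intros\<close>)
    then show "k holomorphic_on ball 0 1" unfolding k_def o_def by (intro holomorphic_intros)
    show "1 + b * z\<^sup>2 + z ^ 3 * k z \<noteq> 0" if "cmod z < 1" for z
      unfolding H[OF that] by (simp add: E_def)
    show "inj_on (\<lambda>z. z / (1 + b * z\<^sup>2 + z ^ 3 * k z)) (ball 0 1)"
    proof (rule inj_onI)
      fix z w assume z: "z \<in> ball 0 1" and w: "w \<in> ball 0 1" and
        "z / (1 + b * z\<^sup>2 + z ^ 3 * k z) = w / (1 + b * w\<^sup>2 + w ^ 3 * k w)"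
      then have eq: "z / E (z\<^sup>2) = w / E (w\<^sup>2)" using H by simp
      have Enz: "E v \<noteq> 0" for v by (simp add: E_def)
      have Gsq: "G (v\<^sup>2) = (v / E (v\<^sup>2))\<^sup>2" if "cmod v < 1" for v
        using Eg[OF sq[OF that]] g(2)[OF sq[OF that]] Enz[of "v\<^sup>2"]
        by (simp add: power_divide field_simps)
      then have "G (z\<^sup>2) = G (w\<^sup>2)" using Gsq[of z] Gsq[of w] eq z w by simp
      then have zw: "z\<^sup>2 = w\<^sup>2" using inj_onD[OF inj] sq z w by simp
      then have "z = w \<or> z = - w" by (simp add: power2_eq_iff)
      \<comment> \<open>Equal squares give equal denominators in \<open>eq\<close>, which rules out
        z = -w unless both are 0.\<close>
      moreover have "z = w" using eq Enz unfolding zw by simp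
      ultimately show "z = w" by simp
    qed
  qed
  have dE: "(E has_field_derivative b) (at 0)"
  proof -
    have "(E has_field_derivative deriv E 0) (at 0)"
      using holE by (auto intro!: holomorphic_derivI)
    moreover from DERIV_diff[OF this DERIV_const[of 1]] have "deriv (\<lambda>z. E z - 1) 0 = deriv E 0"
      by (intro DERIV_imp_deriv) simp
    ultimately show ?thesis using e1(3) by (simp add: b_def)
  qed
  have dg: "(g has_field_derivative deriv g z) (at z)" 
    "(deriv g has_field_derivative deriv (deriv g) z) (at z)" if "cmod z < 1" for z
    using g(1) that by (auto intro!: holomorphic_derivI[where S="ball 0 1"] holomorphic_deriv)
  \<comment> \<open>Differentiating E^2 g = 1 at 0 gives g'(0) = -2b, hence G''(0) = 2 g'(0) =
    -4b.\<close>
  have "((\<lambda>z. (E z)\<^sup>2 * g z) has_field_derivative (2 * b + deriv g 0)) (at 0)"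
    using DERIV_mult[OF DERIV_power[OF dE, of 2] dg(1)[of 0]] g(3) G0 E0 by simp
  moreover have "((\<lambda>z. (E z)\<^sup>2 * g z) has_field_derivative 0) (at 0)"
    by (rule has_field_derivative_transform_within_open[OF DERIV_const[of 1], where S="ball 0 1"])
      (use Eg in auto)
  ultimately have "2 * b + deriv g 0 = 0" by (rule DERIV_unique)
  then have "deriv g 0 = - (2 * b)" by (rule add_eq_0_iff[THEN iffD1])
  moreover have "deriv (deriv G) 0 = 2 * deriv g 0"
  proof -
    have d1: "(G has_field_derivative g z + z * deriv g z) (at z)" if "cmod z < 1" for z
    proof (rule has_field_derivative_transform_within_open[where S="ball 0 1"])
      show "((\<lambda>z. z * g z) has_field_derivative g z + z * deriv g z) (at z)"
        using DERIV_mult[OF DERIV_ident dg(1)[OF that]] by (simp add: mult.commute)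
    qed (use that g(2) in auto)
    have d2: "((\<lambda>z. g z + z * deriv g z) has_field_derivative deriv g z + (deriv g z + z * deriv (deriv g) z)) (at z)" if "cmod z < 1" for z
      using DERIV_add[OF dg(1)[OF that] DERIV_mult[OF DERIV_ident dg(2)[OF that]]] by (simp add: mult.commute)
    have "deriv (deriv G) 0 = deriv g 0 + (deriv g 0 + 0 * deriv (deriv g) 0)"
      by (rule deriv2_eqI(2)[where G=G and z=0, OF d1 d2]) auto
    then show ?thesis by simp
  qed
  ultimately have "deriv (deriv G) 0 = - (4 * b)" by simp
  then show ?thesis using \<open>cmod b \<le> 1\<close> by (simp add: norm_mult)
qed

text \<open>The quantity on the left is the second derivative at 0 of the Koebe transform of
  \<open>G\<close> centred at \<open>a\<close>, which is again in \<open>class_S\<close>.\<close>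

lemma class_S_second_derivative_bound:
  assumes G: "G \<in> class_S" and a: "cmod a < 1"
  shows "cmod (of_real (1 - (cmod a)\<^sup>2) * deriv (deriv G) a / deriv G a - 2 * cnj a) \<le> 4"
proof -
  have hol: "G holomorphic_on ball 0 1" and inj: "inj_on G (ball 0 1)"
    using G by (auto simp: class_S_def class_A_def)
  define R where "R = complex_of_real (1 - (cmod a)\<^sup>2)"
  have R: "R \<noteq> 0"
  proof -
    have "(cmod a)\<^sup>2 < 1" using a by (simp add: power_less_one_iff abs_square_less_1)
    then show ?thesis unfolding R_def of_real_eq_0_iff by simp
  qed
  have Ga: "deriv G a \<noteq> 0"
    using holomorphic_injective_imp_regular[OF hol _ inj] a by auto
  define M where "M = Moebius_function 0 (- a)"
  have M0: "M 0 = a" by (simp add: M_def Moebius_function_of_zero)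
  have M1: "cmod (M z) < 1" if "cmod z < 1" for z
    using a that by (simp add: M_def Moebius_function_norm_lt_1)
  have D: "1 + cnj a * z \<noteq> 0" if "cmod z < 1" for z
  proof -
    have "cmod (cnj a * z) < 1" using norm_mult_less[of "cnj a" 1 z 1] a that by simp
    then show ?thesis by (metis add_eq_0_iff2 less_irrefl norm_minus_cancel norm_one)
  qed
  have dM: "(M has_field_derivative R / (1 + cnj a * z)\<^sup>2) (at z)" if "cmod z < 1" for z
    using has_field_derivative_Moebius_function[of "- a" z] a that by (simp add: M_def R_def)
  have dG: "(G has_field_derivative deriv G z) (at z)" 
    "(deriv G has_field_derivative deriv (deriv G) z) (at z)" if "cmod z < 1" for z
    using hol that by (auto intro!: holomorphic_derivI[where S="ball 0 1"] holomorphic_deriv)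
  define F where "F z = (G (M z) - G a) / (R * deriv G a)" for z
  define F1 where "F1 z = deriv G (M z) / (1 + cnj a * z)\<^sup>2 / deriv G a" for z
  define F2 where "F2 z = (deriv (deriv G) (M z) * (R / (1 + cnj a * z)\<^sup>2) / (1 + cnj a * z)\<^sup>2
      - 2 * cnj a * deriv G (M z) / (1 + cnj a * z) ^ 3) / deriv G a" for z
  have d1: "(F has_field_derivative F1 z) (at z)" if z: "cmod z < 1" for z
  proof -
    have "((\<lambda>z. (G (M z) - G a) / (R * deriv G a)) has_field_derivative (deriv G (M z) * (R / (1 + cnj a * z)\<^sup>2) - 0) / (R * deriv G a)) (at z)"
      by (intro DERIV_cdivide DERIV_diff DERIV_const DERIV_chain2[OF dG(1)[OF M1[OF z]] dM[OF z]])
    moreover have "(d * (R / u) - 0) / (R * e) = d / u / e" for d u e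
      using R by simp
    ultimately show ?thesis unfolding F_def F1_def by (simp only:)
  qed
  have d2: "(F1 has_field_derivative F2 z) (at z)" if z: "cmod z < 1" for z
  proof -
    have q: "((\<lambda>z. inverse ((1 + cnj a * z)\<^sup>2)) has_field_derivative - (2 * cnj a / (1 + cnj a * z) ^ 3)) (at z)"
    proof -
      have "((\<lambda>z. inverse ((1 + cnj a * z)\<^sup>2)) has_field_derivative - (inverse ((1 + cnj a * z)\<^sup>2) * (2 * (1 + cnj a * z) * cnj a) * inverse ((1 + cnj a * z)\<^sup>2))) (at z)"
        using D[OF z] by (auto intro!: derivative_eq_intros)
      moreover have "inverse (u\<^sup>2) * (2 * u * cnj a) * inverse (u\<^sup>2) = 2 * cnj a / u ^ 3" if "u \<noteq> 0" for u
        using that by (simp add: power2_eq_square power3_eq_cube divide_inverse)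
      note this[OF D[OF z]]
      ultimately show ?thesis by (simp only:)
    qed
    have "((\<lambda>z. deriv G (M z) * inverse ((1 + cnj a * z)\<^sup>2) / deriv G a) has_field_derivative
       (deriv (deriv G) (M z) * (R / (1 + cnj a * z)\<^sup>2) * inverse ((1 + cnj a * z)\<^sup>2) + - (2 * cnj a / (1 + cnj a * z) ^ 3) * deriv G (M z)) / deriv G a) (at z)"
      by (intro DERIV_cdivide DERIV_mult q DERIV_chain2[OF dG(2)[OF M1[OF z]] dM[OF z]])
    moreover have "p * inverse u + - (c / v) * d = p / u - c * d / v" "d * inverse u = d / u" for p u c v d :: complex
      by (simp_all add: divide_inverse)
    ultimately show ?thesis unfolding F1_def F2_def by (simp only:)
  qed
  have dF: "deriv F z = F1 z" "deriv (deriv F) z = F2 z" if "cmod z < 1" for z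
    using deriv2_eqI[of F F1 F2 z] d1 d2 that by blast+
  have "F \<in> class_S"
    unfolding class_S_def class_A_def
  proof (intro CollectI conjI)
    show "F holomorphic_on ball 0 1"
      unfolding holomorphic_on_open[OF open_ball] using d1 by (metis mem_ball_0)
    show "F 0 = 0" by (simp add: F_def M0)
    show "deriv F 0 = 1" using dF(1)[of 0] Ga by (simp add: F1_def M0)
    show "inj_on F (ball 0 1)"
    proof (rule inj_onI)
      fix z w assume z: "z \<in> ball 0 1" and w: "w \<in> ball 0 1" and "F z = F w"
      then have "G (M z) = G (M w)" using R Ga by (simp add: F_def)
      then have "M z = M w" using inj_onD[OF inj] M1 z w by simp
      moreover have "Moebius_function 0 a (M v) = v" if "v \<in> ball 0 1" for v
        unfolding M_def by (rule Moebius_function_compose) (use a that in auto)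
      ultimately show "z = w" using z w by metis
    qed
  qed
  from Bieberbach_second_coefficient[OF this] have "cmod (F2 0) \<le> 4" by (simp add: dF)
  also have "F2 0 = R * deriv (deriv G) a / deriv G a - 2 * cnj a"
    using Ga by (simp add: F2_def M0 field_simps)
  finally show ?thesis unfolding R_def .
qed

section \<open>The sharp bound for univalent functions and the Koebe function\<close>

lemma class_S_Re_lower_bound:
  assumes G: "G \<in> class_S" and z: "cmod z < 1/5"
  shows "cmod z / (1 - cmod z) < Re (1 + z * deriv (deriv G) z / deriv G z)"
proof -
  define r where "r = cmod z"
  have r: "0 \<le> r" "r < 1/5" using z by (auto simp: r_def)
  define R where "R = 1 - r\<^sup>2"
  have R: "R > 0" using r by (simp add: R_def power_less_one_iff abs_square_less_1)
  define Q where "Q = z * deriv (deriv G) z / deriv G z"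
  \<comment> \<open>Multiplication by \<open>z\<close> turns the estimate into a disk for z G''/G'
    with centre 2r^2/(1 - r^2) and radius 4r/(1 - r^2); its leftmost point is what matters.\<close>
  have "cmod z * cmod (of_real R * deriv (deriv G) z / deriv G z - 2 * cnj z) \<le> r * 4"
    using class_S_second_derivative_bound[OF G, of z] z by (simp add: R_def r_def mult_left_mono)
  then have "cmod (z * (of_real R * deriv (deriv G) z / deriv G z - 2 * cnj z)) \<le> r * 4"
    by (simp only: norm_mult)
  moreover have "z * (of_real R * deriv (deriv G) z / deriv G z - 2 * cnj z) = of_real R * Q - 2 * of_real (r\<^sup>2)"
    using complex_norm_square[of z] by (simp add: Q_def r_def algebra_simps)
  ultimately have "\<bar>Re (of_real R * Q - 2 * of_real (r\<^sup>2))\<bar> \<le> r * 4"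
    by (metis abs_Re_le_cmod order_trans)
  then have "R * Re Q \<ge> 2 * r\<^sup>2 - 4 * r" by (simp add: power2_eq_square)
  then have "Re Q \<ge> (2 * r\<^sup>2 - 4 * r) / R" using R by (simp add: field_simps)
  moreover have "r / (1 - r) < 1 + (2 * r\<^sup>2 - 4 * r) / R"
  proof -
    have "1 - (4 * r - 2 * r\<^sup>2) / R - r * (1 + r) / R = (R - (4 * r - 2 * r\<^sup>2) - r * (1 + r)) / R"
      using R by (intro one_minus_fractions) simp
    also have "R - (4 * r - 2 * r\<^sup>2) - r * (1 + r) = 1 - 5 * r"
      by (simp add: R_def power2_eq_square algebra_simps)
    also have "(1 - 5 * r) / R > 0" using r R by simp
    finally show ?thesis
      using divide_one_minus_eq[of r] r by (simp add: R_def diff_divide_distrib)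
  qed
  ultimately show ?thesis by (simp add: Q_def[symmetric] r_def[symmetric])
qed

text \<open>At -x the Koebe function reaches the leftmost point of the disk allowed for z G''/G'.
  Since it is starlike, one example shows sharpness for univalent and for starlike
  \<open>G\<close>.\<close>

lemma Koebe_function_extremal:
  fixes r :: real
  assumes r: "1/5 < r" "r \<le> 1"
  shows "\<exists>G\<in>class_S_star. \<exists>z. cmod z < r \<and> (\<forall>w. cmod w < 1 \<longrightarrow> deriv G w \<noteq> 0) \<and>
        Re (1 + z * deriv (deriv G) z / deriv G z) < cmod z / (1 - cmod z)"
proof -
  obtain x where x: "1/5 < x" "x < r" using dense r by blast
  define G :: "complex \<Rightarrow> complex" where "G = (\<lambda>z. z / (1 - z)\<^sup>2)"
  have nz: "1 - z \<noteq> 0" "1 + z \<noteq> 0" if "cmod z < 1" for z :: complex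
    using that by (auto, metis add_eq_0_iff2 less_irrefl norm_minus_cancel norm_one)
  have d1: "(G has_field_derivative (1 + z) / (1 - z) ^ 3) (at z)" if "cmod z < 1" for z
  proof -
    have "(G has_field_derivative ((1 - z)\<^sup>2 + 2 * z * (1 - z)) / ((1 - z)\<^sup>2 * (1 - z)\<^sup>2)) (at z)"
      unfolding G_def using nz[OF that] by (auto intro!: derivative_eq_intros simp: algebra_simps)
    moreover have "(u\<^sup>2 + 2 * z * u) / (u\<^sup>2 * u\<^sup>2) = (u + 2 * z) / u ^ 3" if "u \<noteq> 0" for u
      using that by (simp add: eval_nat_numeral field_simps)
    note this[OF nz(1)[OF that]]
    moreover have "1 - z + 2 * z = 1 + z" by simp
    ultimately show ?thesis by (simp only:)
  qed
  have d2: "((\<lambda>z. (1 + z) / (1 - z) ^ 3) has_field_derivative (4 + 2 * z) / (1 - z) ^ 4) (at z)" if "cmod z < 1" for z :: complex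
  proof -
    have "((\<lambda>z. (1 + z) / (1 - z) ^ 3) has_field_derivative ((1 - z) ^ 3 + 3 * (1 + z) * (1 - z)\<^sup>2) / ((1 - z) ^ 3 * (1 - z) ^ 3)) (at z)"
      using nz[OF that] by (auto intro!: derivative_eq_intros simp: algebra_simps)
    moreover have "(u ^ 3 + 3 * (1 + z) * u\<^sup>2) / (u ^ 3 * u ^ 3) = (u + 3 * (1 + z)) / u ^ 4" if "u \<noteq> 0" for u
      using that by (simp add: eval_nat_numeral field_simps)
    note this[OF nz(1)[OF that]]
    moreover have "1 - z + 3 * (1 + z) = 4 + 2 * z" by simp
    ultimately show ?thesis by (simp only:)
  qed
  have dG: "deriv G z = (1 + z) / (1 - z) ^ 3" "deriv (deriv G) z = (4 + 2 * z) / (1 - z) ^ 4" if "cmod z < 1" for z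
    using deriv2_eqI[of G "\<lambda>z. (1 + z) / (1 - z) ^ 3" "\<lambda>z. (4 + 2 * z) / (1 - z) ^ 4" z] d1 d2 that by blast+
  have GA: "G \<in> class_A"
  proof -
    have "G holomorphic_on ball 0 1"
      unfolding holomorphic_on_open[OF open_ball] using d1 by (metis mem_ball_0)
    then show ?thesis using dG(1)[of 0] by (simp add: class_A_def G_def)
  qed
  have inj: "inj_on G (ball 0 1)"
  proof (rule inj_onI)
    fix z w assume z: "z \<in> ball 0 1" and w: "w \<in> ball 0 1" and eq: "G z = G w"
    have "z * (1 - w)\<^sup>2 = w * (1 - z)\<^sup>2"
    proof -
      have "(1 - z)\<^sup>2 \<noteq> 0" "(1 - w)\<^sup>2 \<noteq> 0" using nz(1) z w by auto
      from frac_eq_eq[OF this, of z w] show ?thesis using eq unfolding G_def by blast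
    qed
    then have "(z - w) * (1 - z * w) = 0" by (simp add: power2_eq_square algebra_simps)
    moreover have "cmod (z * w) < 1" using norm_mult_less[of z 1 w 1] z w by simp
    then have "1 - z * w \<noteq> 0" by auto
    ultimately show "z = w" by simp
  qed
  have quarter: "1 + 4 * G z = ((1 + z) / (1 - z))\<^sup>2" if "cmod z < 1" for z
    using nz(1)[OF that] by (simp add: G_def power_divide divide_simps) (simp add: power2_eq_square algebra_simps)
  \<comment> \<open>By \<open>quarter\<close>, 1 + 4G is the square of a map onto the right
    half-plane, so the image is the plane slit along the reals up to -1/4; the principal square root
    inverts it.\<close>
  have img: "G ` ball 0 1 = {w. 1 + 4 * w \<notin> \<real>\<^sub>\<le>\<^sub>0}"
  proof (intro subset_antisym subsetI)
    fix w assume "w \<in> G ` ball 0 1"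
    then obtain z where z: "cmod z < 1" "w = G z" by auto
    define s where "s = (1 + z) / (1 - z)"
    have "(cmod z)\<^sup>2 < 1" using z by (simp add: power_less_one_iff abs_square_less_1)
    then have "Re ((1 + z) * cnj (1 - z)) > 0" unfolding cmod_power2 by (simp add: algebra_simps power2_eq_square)
    then have s: "Re s > 0" using nz[of z] z by (simp add: s_def Re_complex_div_gt_0)
    have "s\<^sup>2 \<notin> \<real>\<^sub>\<le>\<^sub>0"
    proof
      assume "s\<^sup>2 \<in> \<real>\<^sub>\<le>\<^sub>0"
      then have le: "Re (s\<^sup>2) \<le> 0" and "Im (s\<^sup>2) = 0" by (auto simp: complex_nonpos_Reals_iff)
      then have "Im s = 0" using s by (simp add: power2_eq_square)
      then show False using le s by (simp add: power2_eq_square) (metis mult_pos_pos not_less)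
    qed
    then show "w \<in> {w. 1 + 4 * w \<notin> \<real>\<^sub>\<le>\<^sub>0}" using quarter[OF z(1)] z by (simp add: s_def)
  next
    fix w :: complex assume "w \<in> {w. 1 + 4 * w \<notin> \<real>\<^sub>\<le>\<^sub>0}"
    then have w: "1 + 4 * w \<notin> \<real>\<^sub>\<le>\<^sub>0" by simp
    define s where "s = csqrt (1 + 4 * w)"
    have s2: "s\<^sup>2 = 1 + 4 * w" by (simp add: s_def)
    have s: "Re s > 0"
    proof (rule ccontr)
      assume "\<not> Re s > 0"
      then have "Re s = 0" using Re_csqrt[of "1 + 4 * w"] by (simp add: s_def)
      then have "s\<^sup>2 \<in> \<real>\<^sub>\<le>\<^sub>0" by (simp add: complex_nonpos_Reals_iff power2_eq_square)
      then show False using w s2 by simp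
    qed
    have lt: "cmod (s - 1) < cmod (s + 1)" using s by (simp add: cmod_less_add_one_iff)
    then have n: "s + 1 \<noteq> 0" by auto
    define z where "z = (s - 1) / (s + 1)"
    have z: "cmod z < 1" using lt n by (simp add: z_def norm_divide)
    have "1 - z = 2 / (s + 1)" using n by (simp add: z_def field_simps)
    then have "G z = (s - 1) * (s + 1) / 4" 
      using n by (simp add: G_def z_def power2_eq_square)
    also have "\<dots> = (s\<^sup>2 - 1) / 4" by (simp add: power2_eq_square algebra_simps)
    also have "\<dots> = w" by (simp add: s2)
    finally show "w \<in> G ` ball 0 1" using z by (metis imageI mem_ball_0)
  qed
  have star: "closed_segment 0 w \<subseteq> G ` ball 0 1" if "w \<in> G ` ball 0 1" for w
  proof
    fix v assume "v \<in> closed_segment 0 w"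
    then obtain u where u: "0 \<le> u" "u \<le> 1" "v = of_real u * w"
      by (auto simp: closed_segment_def scaleR_conv_of_real)
    show "v \<in> G ` ball 0 1"
    proof (rule ccontr)
      assume "v \<notin> G ` ball 0 1"
      then have "Re (1 + 4 * v) \<le> 0" "Im (1 + 4 * v) = 0" unfolding img by (auto simp: complex_nonpos_Reals_iff)
      then have v: "1 + 4 * (u * Re w) \<le> 0" "u * Im w = 0" by (auto simp: u)
      then have u0: "u > 0" using u by (cases "u = 0") auto
      then have "Im w = 0" using v by simp
      \<comment> \<open>Uses u \<le> 1: moving outward along a ray that has met the slit stays on
        the slit.\<close>
      moreover have "u * (1 + 4 * Re w) \<le> 0" using v u by (simp add: algebra_simps)
      then have "1 + 4 * Re w \<le> 0" using u0 by (simp add: mult_le_0_iff)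
      ultimately have "1 + 4 * w \<in> \<real>\<^sub>\<le>\<^sub>0" by (simp add: complex_nonpos_Reals_iff)
      then show False using that unfolding img by simp
    qed
  qed
  have "G \<in> class_S_star" using GA inj star by (simp add: class_S_star_def class_S_def)
  moreover have "cmod (- of_real x) < r" using x by simp
  moreover have "\<forall>w. cmod w < 1 \<longrightarrow> deriv G w \<noteq> 0" using dG(1) nz by auto
  moreover have "Re (1 + (- of_real x) * deriv (deriv G) (- of_real x) / deriv G (- of_real x)) < cmod (- of_real x) / (1 - cmod (- of_real x))"
  proof -
    have xn: "cmod (- of_real x) < 1" using x r by simp
    have x1: "0 < x" "x < 1" using x r by auto
    define R where "R = 1 - x\<^sup>2"
    have R: "R > 0" using x1 by (simp add: R_def power_less_one_iff abs_square_less_1)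
    have "(- of_real x) * deriv (deriv G) (- of_real x) / deriv G (- of_real x) = of_real (- (4 * x - 2 * x\<^sup>2) / R)"
    proof -
      have "(- of_real x) * (c / u ^ 4) / (v / u ^ 3) = - (of_real x * c) / (v * u)" if "u \<noteq> 0" "v \<noteq> 0" for u v c :: complex
        using that by (simp add: eval_nat_numeral field_simps)
      from this[OF nz[OF xn]]
      have "(- of_real x) * deriv (deriv G) (- of_real x) / deriv G (- of_real x) =
          - (of_real x * (4 + 2 * (- of_real x))) / ((1 + - of_real x) * (1 - - complex_of_real x))"
        unfolding dG(1)[OF xn] dG(2)[OF xn] by blast
      moreover have "(1 + - of_real x) * (1 - - complex_of_real x) = of_real R"
        by (simp add: R_def power2_eq_square algebra_simps)
      moreover have "- (of_real x * (4 + 2 * (- of_real x))) = complex_of_real (- (4 * x - 2 * x\<^sup>2))"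
        by (simp add: power2_eq_square algebra_simps)
      ultimately show ?thesis by (simp only: of_real_divide)
    qed
    then have "Re (1 + (- of_real x) * deriv (deriv G) (- of_real x) / deriv G (- of_real x)) = 1 - (4 * x - 2 * x\<^sup>2) / R"
      by (simp only: plus_complex.sel Re_complex_of_real one_complex.sel minus_divide_left[symmetric])
    also have "\<dots> < x / (1 - x)"
    proof -
      have "1 - (4 * x - 2 * x\<^sup>2) / R - x * (1 + x) / R = (R - (4 * x - 2 * x\<^sup>2) - x * (1 + x)) / R"
        using R by (intro one_minus_fractions) simp
      also have "R - (4 * x - 2 * x\<^sup>2) - x * (1 + x) = 1 - 5 * x"
        by (simp add: R_def power2_eq_square algebra_simps)
      also have "(1 - 5 * x) / R < 0" using x R by (simp add: divide_less_0_iff)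
      finally show ?thesis using divide_one_minus_eq[of x] x1 by (simp add: R_def)
    qed
    finally show ?thesis using x1 by simp
  qed
  ultimately show ?thesis by blast
qed

theorem theorem4p8:
  shows "radius_convexity (\<Union>G \<in> class_S. F_H0 G) = 1/5 \<and>
    radius_convexity (\<Union>G \<in> class_S_star. F_H0 G) = 1/5 \<and>
    radius_convexity (\<Union>G \<in> class_K. F_H0 G) = 1/3 \<and>
    radius_convexity (\<Union>G \<in> class_R. F_H0 G) = (sqrt 17 - 3) / 4 \<and>
    (\<forall>r0::real. 0 < r0 \<and> r0^4 + 2*r0^3 + 13*r0^2 + 4*r0 - 4 = 0 \<and>
           (\<forall>r. 0 < r \<and> r < r0 \<longrightarrow> r^4 + 2*r^3 + 13*r^2 + 4*r - 4 \<noteq> 0) \<longrightarrow>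
           radius_convexity (\<Union>G \<in> {G \<in> class_A. \<forall>z \<in> unit_disk. Re (deriv G z) > 1/2}. F_H0 G) = r0)"
proof -
  have sub: "class_S_star \<subseteq> class_S" "class_S \<subseteq> class_A"
    by (auto simp: class_S_star_def class_S_def)
  \<comment> \<open>Every family between \<open>class_S_star\<close> and \<open>class_S\<close> has
    the same radius: the estimate comes from the larger class, the extremal function from the
    smaller.\<close>
  have "radius_convexity (\<Union>G \<in> \<G>. F_H0 G) = 1/5" if "class_S_star \<subseteq> \<G>" "\<G> \<subseteq> class_S" for \<G>
  proof (rule radius_convexity_F_H0_eqI)
    show "\<G> \<subseteq> class_A" using that sub by blast
    show "cmod z / (1 - cmod z) < Re (1 + z * deriv (deriv G) z / deriv G z)"
      if "G \<in> \<G>" "cmod z < 1/5" for G z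
      using class_S_Re_lower_bound that \<open>\<G> \<subseteq> class_S\<close> by blast
    show "\<exists>G\<in>\<G>. \<exists>z. cmod z < r \<and> (\<forall>w. cmod w < 1 \<longrightarrow> deriv G w \<noteq> 0) \<and>
        Re (1 + z * deriv (deriv G) z / deriv G z) < cmod z / (1 - cmod z)" if "1/5 < r" "r \<le> 1" for r
      using Koebe_function_extremal[OF that] \<open>class_S_star \<subseteq> \<G>\<close> by blast
  qed auto
  then show ?thesis
    using sub radius_convexity_class_K radius_convexity_class_R
      radius_convexity_half_plane[unfolded halfplane_quartic_def] by blast
qed

end
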